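(* Let $X$ be an arbitrary finite $T_0$ space and let $F:X\multimap X$ be a multivalued map with acyclic values which is strongly upper semicontinuous or strongly lower semicontinuous. If the Lefschetz number satisfies $L(F)\neq 0$, then $F$ has a fixed point, i.e. there exists $x\in X$ with $x\in F(x)$.
   Context: A finite $T_0$ space $X$ is identified with a finite poset: $x\le y$ iff $x$ lies in the smallest open set $U_y$ containing $y$; open sets are exactly the down-sets. $X^{op}$ is the finite space with the opposite order. $\mathcal{K}(X)$ is the order complex (simplicial complex of nonempty chains; the same symbol denotes its geometric realization), so $\mathcal{K}(X)=\mathcal{K}(X^{op})$. $\mu_X:\mathcal{K}(X)\to X$ denotes McCord's weak homotopy equivalence, sending a point in the open simplex of a chain $x_0<\dots<x_n$ to $x_0$ (and correspondingly for $X^{op}$). A multivalued map $F:X\multimap Y$ assigns to each $x\in X$ a subset $F(x)\subset Y$. For $X$ a topological space and $Y$ a set, $F$ is strongly upper semicontinuous (susc) if for every subset $B\subset Y$ the set $\{x\in X: F(x)\subset B\}$ is open in $X$; it is strongly lower semicontinuous (slsc) if for every subset $B\subset Y$ the set $\{x\in X: F(x)\cap B\ne\emptyset\}$ is open in $X$. $F$ has acyclic values if each $F(x)$ (with the subspace topology) is acyclic, i.e. nonempty with all reduced singular homology groups with integer coefficients trivial. $H_n$ denotes unreduced singular homology with integer coefficients. Induced maps: let $X$ be a finite $T_0$ space and $Y$ a topological space. If $F:X\multimap Y$ is susc with acyclic values, regard $F$ as the subspace $\{(x,y): y\in F(x)\}\subset X\times Y$ with projections $p_1:F\to X$, $p_2:F\to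 Y$; then $(p_1)_*:H_n(F)\to H_n(X)$ is an isomorphism for all $n$ and $F_*:=(p_2)_*(p_1)_*^{-1}:H_n(X)\to H_n(Y)$. If $F:X\multimap Y$ is slsc with acyclic values, then the map $F':X^{op}\multimap Y$ with the same values is susc, and $F_*:=F'_*(\mu_{X^{op}})_*(\mu_X)_*^{-1}:H_n(X)\to H_n(Y)$. Lefschetz number: for $F:X\multimap X$ susc or slsc with acyclic values on a finite $T_0$ space $X$, $L(F)=\sum_{n\ge 0}(-1)^n\operatorname{tr}(F_n)$, where $\operatorname{tr}(F_n)$ is the trace of the endomorphism of $H_n(X)/T_n(X)$ induced by $F_*$, with $T_n(X)$ the torsion subgroup of $H_n(X)$. *)

theory Defs
  imports "HOL-Analysis.Analysis" "HOL-Homology.Homology"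
begin

section \<open>Finite spaces as posets\<close>

definition min_open :: "'a topology \<Rightarrow> 'a \<Rightarrow> 'a set"
  where "min_open X y = \<Inter>{U. openin X U \<and> y \<in> U}"

text \<open>The guard is needed because \<^term>\<open>min_open X y\<close> is \<^term>\<open>UNIV\<close> for
  \<^term>\<open>y\<close> outside the space.\<close>
definition space_le :: "'a topology \<Rightarrow> 'a \<Rightarrow> 'a \<Rightarrow> bool"
  where "space_le X x y \<longleftrightarrow> y \<in> topspace X \<and> x \<in> min_open X y"

text \<open>Open sets of a finite space are the down-sets of \<^const>\<open>space_le\<close>, so those of the
  opposite space are the up-sets.\<close>
definition op_space :: "'a topology \<Rightarrow> 'a topology"
  where "op_space X =
    topology (\<lambda>U. U \<subseteq> topspace X \<and> (\<forall>x\<in>U. \<forall>y. space_le X x y \<longrightarrow> y \<in> U))"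

lemma space_le_in_topspace:
  assumes "space_le X x y"
  shows "x \<in> topspace X" "y \<in> topspace X"
proof -
  show "y \<in> topspace X" using assms by (simp add: space_le_def)
  then show "x \<in> topspace X" using assms by (auto simp: space_le_def min_open_def)
qed

lemma space_le_refl: "x \<in> topspace X \<Longrightarrow> space_le X x x"
  by (auto simp: space_le_def min_open_def)

lemma space_le_trans: "space_le X x y \<Longrightarrow> space_le X y z \<Longrightarrow> space_le X x z"
  by (auto simp: space_le_def min_open_def)

lemma space_le_antisym:
  assumes "t0_space X" "space_le X x y" "space_le X y x"
  shows "x = y"
proof (rule ccontr)
  assume "x \<noteq> y"
  then obtain U where "openin X U" "x \<notin> U \<longleftrightarrow> y \<in> U"
    using assms(1) space_le_in_topspace[OF assms(2)] unfolding t0_space_def by blast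
  then show False
    using assms(2,3) by (auto simp: space_le_def min_open_def)
qed

lemma openin_iff_down_set:
  assumes "finite (topspace X)"
  shows "openin X U \<longleftrightarrow> U \<subseteq> topspace X \<and> (\<forall>y\<in>U. \<forall>x. space_le X x y \<longrightarrow> x \<in> U)"
    (is "_ \<longleftrightarrow> ?R")
proof
  assume "openin X U"
  then show ?R using openin_subset by (auto simp: space_le_def min_open_def)
next
  assume R: ?R
  have fin: "finite {V. openin X V \<and> y \<in> V}" for y
    by (rule finite_subset[of _ "Pow (topspace X)"]) (use assms openin_subset in auto)
  have "openin X (min_open X y) \<and> y \<in> min_open X y \<and> min_open X y \<subseteq> U" if "y \<in> U" for y
  proof -
    have "y \<in> topspace X" using R that by auto
    then have "{V. openin X V \<and> y \<in> V} \<noteq> {}" by blast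
    with fin have "openin X (min_open X y)"
      unfolding min_open_def by (intro openin_Inter) auto
    moreover have "min_open X y \<subseteq> U"
      using R that by (auto simp: space_le_def)
    ultimately show ?thesis by (auto simp: min_open_def)
  qed
  then show "openin X U" by (subst openin_subopen) blast
qed

lemma openin_op_space:
  "openin (op_space X) U \<longleftrightarrow>
    U \<subseteq> topspace X \<and> (\<forall>x\<in>U. \<forall>y. space_le X x y \<longrightarrow> y \<in> U)"
proof -
  have "istopology (\<lambda>U. U \<subseteq> topspace X \<and> (\<forall>x\<in>U. \<forall>y. space_le X x y \<longrightarrow> y \<in> U))"
    (is "istopology ?L")
    unfolding istopology_def
  proof (intro conjI allI impI)
    fix S T assume "?L S" "?L T"
    then show "S \<inter> T \<subseteq> topspace X"
      and "\<forall>x\<in>S \<inter> T. \<forall>y. space_le X x y \<longrightarrow> y \<in> S \<inter> T" by auto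
  next
    fix K assume "\<forall>V\<in>K. ?L V"
    then show "\<Union>K \<subseteq> topspace X"
      and "\<forall>x\<in>\<Union>K. \<forall>y. space_le X x y \<longrightarrow> y \<in> \<Union>K" by (auto, metis)
  qed
  then show ?thesis by (simp add: op_space_def)
qed

lemma topspace_op_space [simp]: "topspace (op_space X) = topspace X"
proof
  show "topspace (op_space X) \<subseteq> topspace X"
    using openin_topspace[of "op_space X"] unfolding openin_op_space by blast
  have "openin (op_space X) (topspace X)"
    unfolding openin_op_space by (auto dest: space_le_in_topspace)
  then show "topspace X \<subseteq> topspace (op_space X)"
    by (rule openin_subset)
qed

lemma space_le_op_space: "space_le (op_space X) x y \<longleftrightarrow> space_le X y x"
proof
  assume L: "space_le (op_space X) x y"
  then have y: "y \<in> topspace X" by (simp add: space_le_def)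
  have "openin (op_space X) {z. space_le X y z}"
    unfolding openin_op_space by (auto dest: space_le_in_topspace space_le_trans)
  moreover have "x \<in> \<Inter>{U. openin (op_space X) U \<and> y \<in> U}"
    using L unfolding space_le_def[of "op_space X"] min_open_def by (rule conjunct2)
  ultimately show "space_le X y x" using space_le_refl[OF y] by blast
next
  assume L: "space_le X y x"
  show "space_le (op_space X) x y"
    unfolding space_le_def[of "op_space X" x y] min_open_def openin_op_space topspace_op_space
    using L space_le_in_topspace[OF L] by auto
qed


section \<open>Order complex and McCord map\<close>

definition order_chains :: "'a topology \<Rightarrow> 'a set set"
  where "order_chains X =
    {C. C \<noteq> {} \<and> finite C \<and> C \<subseteq> topspace X \<and>
        (\<forall>x\<in>C. \<forall>y\<in>C. space_le X x y \<or> space_le X y x)}"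

text \<open>Geometric realization by barycentric coordinates.  The product topology is the usual
  topology of the realization because the complexes of interest are finite.\<close>
definition order_complex :: "'a topology \<Rightarrow> ('a \<Rightarrow> real) topology"
  where "order_complex X =
    subtopology (powertop_real UNIV)
      {t. (\<forall>x. 0 \<le> t x) \<and> {x. t x \<noteq> 0} \<in> order_chains X \<and> (\<Sum>x | t x \<noteq> 0. t x) = 1}"

definition mccord_map :: "'a topology \<Rightarrow> ('a \<Rightarrow> real) \<Rightarrow> 'a"
  where "mccord_map X t =
    (THE x. t x \<noteq> 0 \<and> (\<forall>y. t y \<noteq> 0 \<longrightarrow> space_le X x y))"

lemma order_complex_op_space: "order_complex (op_space X) = order_complex X"
proof -
  have "order_chains (op_space X) = order_chains X"
    by (auto simp: order_chains_def space_le_op_space)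
  then show ?thesis by (simp add: order_complex_def)
qed


section \<open>Multivalued maps\<close>

definition multimap :: "'a topology \<Rightarrow> 'b set \<Rightarrow> ('a \<Rightarrow> 'b set) \<Rightarrow> bool"
  where "multimap X Y F \<longleftrightarrow> (\<forall>x\<in>topspace X. F x \<subseteq> Y)"

definition susc :: "'a topology \<Rightarrow> 'b set \<Rightarrow> ('a \<Rightarrow> 'b set) \<Rightarrow> bool"
  where "susc X Y F \<longleftrightarrow> (\<forall>B\<subseteq>Y. openin X {x \<in> topspace X. F x \<subseteq> B})"

definition slsc :: "'a topology \<Rightarrow> 'b set \<Rightarrow> ('a \<Rightarrow> 'b set) \<Rightarrow> bool"
  where "slsc X Y F \<longleftrightarrow> (\<forall>B\<subseteq>Y. openin X {x \<in> topspace X. F x \<inter> B \<noteq> {}})"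

definition acyclic_space :: "'a topology \<Rightarrow> bool"
  where "acyclic_space X \<longleftrightarrow>
    topspace X \<noteq> {} \<and> (\<forall>p. trivial_group (reduced_homology_group p X))"

definition acyclic_values :: "'a topology \<Rightarrow> 'b topology \<Rightarrow> ('a \<Rightarrow> 'b set) \<Rightarrow> bool"
  where "acyclic_values X Y F \<longleftrightarrow> (\<forall>x\<in>topspace X. acyclic_space (subtopology Y (F x)))"

definition graph_space :: "'a topology \<Rightarrow> 'b topology \<Rightarrow> ('a \<Rightarrow> 'b set) \<Rightarrow> ('a \<times> 'b) topology"
  where "graph_space X Y F = subtopology (prod_topology X Y) {(x, y). y \<in> F x}"


section \<open>Induced maps in homology\<close>

definition susc_induced ::
    "int \<Rightarrow> 'a topology \<Rightarrow> 'b topology \<Rightarrow> ('a \<Rightarrow> 'b set) \<Rightarrow> 'a chain set \<Rightarrow> 'b chain set"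
  where "susc_induced p X Y F =
    hom_induced p (graph_space X Y F) {} Y {} snd \<circ>
    inv_into (carrier (homology_group p (graph_space X Y F)))
      (hom_induced p (graph_space X Y F) {} X {} fst)"

text \<open>The composition below uses \<^term>\<open>order_complex (op_space X) = order_complex X\<close>.\<close>
definition slsc_induced ::
    "int \<Rightarrow> 'a topology \<Rightarrow> 'b topology \<Rightarrow> ('a \<Rightarrow> 'b set) \<Rightarrow> 'a chain set \<Rightarrow> 'b chain set"
  where "slsc_induced p X Y F =
    susc_induced p (op_space X) Y F \<circ>
    hom_induced p (order_complex (op_space X)) {} (op_space X) {} (mccord_map (op_space X)) \<circ>
    inv_into (carrier (homology_group p (order_complex X)))
      (hom_induced p (order_complex X) {} X {} (mccord_map X))"


section \<open>Lefschetz number\<close>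

text \<open>Abelian groups are written multiplicatively, as in the homology library.\<close>
definition torsion_subgroup :: "('g, 'm) monoid_scheme \<Rightarrow> 'g set"
  where "torsion_subgroup G = {x \<in> carrier G. \<exists>k::nat. k > 0 \<and> x [^]\<^bsub>G\<^esub> k = \<one>\<^bsub>G\<^esub>}"

text \<open>The endomorphism induced on a quotient by a subgroup \<^term>\<open>T\<close> preserved by
  \<^term>\<open>\<phi>\<close>: the coset of \<^term>\<open>x\<close> goes to the coset of \<^term>\<open>\<phi> x\<close>.\<close>
definition quotient_map_by ::
    "('g, 'm) monoid_scheme \<Rightarrow> 'g set \<Rightarrow> ('g \<Rightarrow> 'g) \<Rightarrow> 'g set \<Rightarrow> 'g set"
  where "quotient_map_by G T \<phi> C = T <#>\<^bsub>G\<^esub> (\<phi> ` C)"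

text \<open>\<^term>\<open>f\<close> is the coordinate isomorphism of the basis
  \<^term>\<open>f (frag_of 0)\<close> to \<^term>\<open>f (frag_of (r - 1))\<close>; the sum is over the
  diagonal entries of the matrix of \<^term>\<open>\<psi>\<close> in this basis.\<close>
definition basis_trace ::
    "('g, 'm) monoid_scheme \<Rightarrow> nat \<Rightarrow> ((nat \<Rightarrow>\<^sub>0 int) \<Rightarrow> 'g) \<Rightarrow> ('g \<Rightarrow> 'g) \<Rightarrow> int"
  where "basis_trace G r f \<psi> =
    (\<Sum>i<r. Poly_Mapping.lookup
       (inv_into (carrier (free_Abelian_group {..<r})) f (\<psi> (f (frag_of i)))) i)"

text \<open>The trace of an endomorphism of a free abelian group of finite rank does not depend on
  the basis, so the choice is immaterial.\<close>
definition free_trace :: "('g, 'm) monoid_scheme \<Rightarrow> ('g \<Rightarrow> 'g) \<Rightarrow> int"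
  where "free_trace G \<psi> =
    (SOME t. \<exists>r f. f \<in> iso (free_Abelian_group {..<r}) G \<and> t = basis_trace G r f \<psi>)"

definition trace_mod_torsion :: "('g, 'm) monoid_scheme \<Rightarrow> ('g \<Rightarrow> 'g) \<Rightarrow> int"
  where "trace_mod_torsion G \<phi> =
    free_trace (G Mod torsion_subgroup G) (quotient_map_by G (torsion_subgroup G) \<phi>)"

text \<open>For a finite space only finitely many homology groups are nonzero, so \<^const>\<open>Sum_any\<close>,
  the sum over the nonzero terms, is the alternating sum over all degrees.\<close>
definition lefschetz_number :: "'a topology \<Rightarrow> (int \<Rightarrow> 'a chain set \<Rightarrow> 'a chain set) \<Rightarrow> int"
  where "lefschetz_number X \<Phi> =
    Sum_any (\<lambda>n::nat. (- 1) ^ n * trace_mod_torsion (homology_group (int n) X) (\<Phi> (int n)))"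

end

theory Submission
  imports Defs
begin

text \<open>Let \<open>C\<close> be the simplicial chain complex of the order complex of \<open>X\<close>. Sending a chain
  \<open>\<sigma>\<close> of \<open>X\<close> to the value of \<open>F\<close> at its largest vertex (smallest vertex in the lower semicontinuous
  case) is an acyclic carrier, so it supports a chain map \<open>\<phi> : C \<rightarrow> C\<close>. If \<open>F\<close> has no fixed point,
  that vertex of \<open>\<sigma>\<close> is not a vertex of any simplex of \<open>\<phi> \<sigma>\<close>; hence all diagonal entries of
  \<open>\<phi>\<close> are zero, and the Hopf trace formula shows that the alternating sum of its traces on homology
  vanishes. It remains to see that \<open>\<phi>\<close> induces \<open>F\<^sub>*\<close>. All spaces involved (\<open>X\<close>, the graph of
  \<open>F\<close>, the order complex) map to a finite poset with acyclic preimages of principal down-sets; a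
  Mayer-Vietoris induction over the poset shows that carried chain maps from \<open>C\<close> to their singular
  complexes are quasi-isomorphisms, and acyclic carriers make the resulting squares commute up to
  homotopy.\<close>

section \<open>Traces on finitely generated abelian groups\<close>

text \<open>The induced maps invert two homomorphisms by \<open>inv_into\<close>. Bijectivity is not
  shown beforehand. Instead, all classes are represented by simplicial cycles: if a carried map
  \<psi> into a space and its composite with a projection are both quasi-isomorphisms, inverting the
  projection merely leads from the class of the composite at \<open>z\<close> back to the class of
  \<open>\<psi> z\<close>. The whole induced map is thus followed on one cycle \<open>z\<close>. The
  values of \<open>F\<close> are acyclic in the singular sense, whereas \<phi> takes values in
  simplicial chains of \<open>F x\<close>; the covering theorem applied to \<open>F x\<close> itself
  bridges this gap. Both semicontinuity cases share the same chains; the opposite order only changes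
  which end of a chain selects the value of \<open>F\<close>. All complexes are augmented, so
  acyclic includes nonempty and carrier constructions start uniformly at the empty chain. Unreduced
  homology returns by ignoring the boundary of points. Homology may have torsion and the trace is
  defined through a chosen basis. Traces are therefore tested against rational functionals, which
  extend from subgroups and kill torsion.\<close>

interpretation frag_module: Modules.module "frag_cmul :: int \<Rightarrow> ('k \<Rightarrow>\<^sub>0 int) \<Rightarrow> ('k \<Rightarrow>\<^sub>0 int)"
  by standard (simp_all add: frag_cmul_distrib frag_cmul_distrib2)

(* This rule and minus_frag_cmul rewrite into each other. *)
declare frag_module.scale_minus_left [simp del]

abbreviation "frag_subgroup \<equiv> frag_module.subspace"
abbreviation "frag_span \<equiv> frag_module.span"

lemma frag_subgroupI:
  assumes "0 \<in> A" "\<And>a b. a \<in> A \<Longrightarrow> b \<in> A \<Longrightarrow> a - b \<in> A"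
  shows "frag_subgroup A"
proof (rule frag_module.subspaceI)
  fix x y c assume "x \<in> A" "y \<in> A"
  then have "x - (0 - y) \<in> A" using assms by metis
  then show "x + y \<in> A" by simp
next
  fix c x assume "x \<in> A"
  then show "frag_cmul c x \<in> A"
    using frag_closure_minus_cmul[of "\<lambda>x. x \<in> A"] assms by blast
qed (rule assms)

text \<open>Rational values serve two purposes: divisibility lets functionals extend from subgroups,
  and the absence of torsion makes a functional that vanishes on \<open>B\<close> vanish on
  everything with a nonzero multiple in \<open>B\<close>.\<close>

definition additive_on :: "('k \<Rightarrow>\<^sub>0 int) set \<Rightarrow> (('k \<Rightarrow>\<^sub>0 int) \<Rightarrow> rat) \<Rightarrow> bool"
  where "additive_on A \<alpha> \<longleftrightarrow> (\<forall>x\<in>A. \<forall>y\<in>A. \<alpha> (x + y) = \<alpha> x + \<alpha> y)"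

lemma additive_on_subset: "additive_on A \<alpha> \<Longrightarrow> B \<subseteq> A \<Longrightarrow> additive_on B \<alpha>"
  by (auto simp: additive_on_def)

lemma additive_on_add: "additive_on A \<alpha> \<Longrightarrow> x \<in> A \<Longrightarrow> y \<in> A \<Longrightarrow> \<alpha> (x + y) = \<alpha> x + \<alpha> y"
  by (auto simp: additive_on_def)

lemma additive_on_0:
  assumes "additive_on A \<alpha>" "frag_subgroup A" shows "\<alpha> 0 = 0"
  using additive_on_add[OF assms(1), of 0 0] frag_module.subspace_0[OF assms(2)] by simp

lemma additive_on_diff:
  assumes "additive_on A \<alpha>" "frag_subgroup A" "x \<in> A" "y \<in> A"
  shows "\<alpha> (x - y) = \<alpha> x - \<alpha> y"
  using additive_on_add[OF assms(1), of "x - y" y] frag_module.subspace_diff[OF assms(2-4)] assms by simp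

lemma additive_on_cmul:
  assumes "additive_on A \<alpha>" "frag_subgroup A" "x \<in> A"
  shows "\<alpha> (frag_cmul k x) = of_int k * \<alpha> x"
proof -
  have mem: "frag_cmul k x \<in> A" for k
    using assms frag_module.subspace_scale by blast
  have nat: "\<alpha> (frag_cmul (int n) x) = of_nat n * \<alpha> x" for n
  proof (induction n)
    case (Suc n)
    have "\<alpha> (frag_cmul (int (Suc n)) x) = \<alpha> (frag_cmul (int n) x + x)"
      by (simp add: frag_cmul_distrib add.commute)
    then show ?case
      using Suc additive_on_add[OF assms(1) mem assms(3), of "int n"] by (simp add: algebra_simps)
  qed (use assms additive_on_0 in auto)
  show ?thesis
  proof (cases "k \<ge> 0")
    case True
    then show ?thesis using nat[of "nat k"] by simp
  next
    case False
    then obtain n where n: "k = - int n" by (metis int_cases4 nle_le of_nat_0_le_iff)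
    have "frag_cmul k x = 0 - frag_cmul (int n) x" by (simp add: n)
    then have "\<alpha> (frag_cmul k x) = \<alpha> 0 - \<alpha> (frag_cmul (int n) x)"
      using additive_on_diff[OF assms(1,2) frag_module.subspace_0[OF assms(2)] mem] by metis
    also have "\<dots> = - (of_nat n * \<alpha> x)"
      unfolding nat additive_on_0[OF assms(1,2)] by simp
    finally show ?thesis unfolding n by simp
  qed
qed

text \<open>An extension is determined by a value \<open>q\<close> at \<open>s\<close>, which has to
  agree with \<alpha> on the multiples of \<open>s\<close> already in \<open>B\<close>; divisibility
  of the rationals provides it.\<close>

lemma additive_on_extend_insert:
  assumes B: "frag_subgroup B" and \<alpha>: "additive_on B \<alpha>"
  shows "\<exists>\<alpha>'. additive_on (frag_span (insert s B)) \<alpha>' \<and> (\<forall>b\<in>B. \<alpha>' b = \<alpha> b)"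
proof -
  \<comment> \<open>If \<open>m s\<close> lies in \<open>B\<close> with \<open>m\<close> nonzero,
    \<open>q\<close> is forced to be \<open>\<alpha> (m s) / m\<close>, and all such multiples give
    the same quotient. Otherwise there is no constraint and \<open>q = 0\<close> is taken.\<close>
  obtain q where q: "\<And>n. frag_cmul n s \<in> B \<Longrightarrow> \<alpha> (frag_cmul n s) = of_int n * q"
  proof (cases "\<exists>m. m \<noteq> 0 \<and> frag_cmul m s \<in> B")
    case True
    then obtain m where m: "m \<noteq> 0" "frag_cmul m s \<in> B" by blast
    show ?thesis
    proof
      fix n assume n: "frag_cmul n s \<in> B"
      have "of_int m * \<alpha> (frag_cmul n s) = of_int n * \<alpha> (frag_cmul m s)"
        using additive_on_cmul[OF \<alpha> B n, of m] additive_on_cmul[OF \<alpha> B m(2), of n]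
        by (simp add: mult.commute)
      then show "\<alpha> (frag_cmul n s) = of_int n * (\<alpha> (frag_cmul m s) / of_int m)"
        using m by (simp add: field_simps)
    qed
  next
    case False
    show ?thesis
    proof
      fix n assume "frag_cmul n s \<in> B"
      with False have "n = 0" by blast
      then show "\<alpha> (frag_cmul n s) = of_int n * 0"
        using additive_on_0[OF \<alpha> B] by simp
    qed
  qed
  have in_span: "x \<in> frag_span (insert s B) \<longleftrightarrow> (\<exists>k. x - frag_cmul k s \<in> B)" for x
    using frag_module.span_breakdown_eq[of x s B] frag_module.span_eq_iff[of B] B by metis
  define \<alpha>' where "\<alpha>' x = (let k = (SOME k. x - frag_cmul k s \<in> B) in \<alpha> (x - frag_cmul k s) +
      of_int k * q)" for x
  \<comment> \<open>Two admissible coefficients differ by one whose multiple of \<open>s\<close>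
    lies in \<open>B\<close>, where \<open>q\<close> is consistent with \<alpha>; so the choice made
    in \<alpha>' does not matter.\<close>
  have eq: "\<alpha>' x = \<alpha> (x - frag_cmul k s) + of_int k * q" if k: "x - frag_cmul k s \<in> B" for x k
  proof -
    define l where "l = (SOME k. x - frag_cmul k s \<in> B)"
    have l: "x - frag_cmul l s \<in> B" unfolding l_def using k by (rule someI)
    have e: "(x - frag_cmul k s) - (x - frag_cmul l s) = frag_cmul (l - k) s"
      by (simp add: frag_cmul_diff_distrib del: minus_frag_cmul)
    have "frag_cmul (l - k) s \<in> B"
      using frag_module.subspace_diff[OF B k l] e by simp
    then have "\<alpha> (x - frag_cmul k s) - \<alpha> (x - frag_cmul l s) = of_int (l - k) * q"
      using additive_on_diff[OF \<alpha> B k l] q e by simp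
    then show ?thesis by (simp add: \<alpha>'_def l_def[symmetric] algebra_simps)
  qed
  have "additive_on (frag_span (insert s B)) \<alpha>'"
    unfolding additive_on_def
  proof (intro ballI)
    fix x y assume "x \<in> frag_span (insert s B)" "y \<in> frag_span (insert s B)"
    then obtain k l where k: "x - frag_cmul k s \<in> B" and l: "y - frag_cmul l s \<in> B"
      using in_span by auto
    have e: "x + y - frag_cmul (k + l) s = (x - frag_cmul k s) + (y - frag_cmul l s)"
      by (simp add: frag_cmul_distrib)
    have "x + y - frag_cmul (k + l) s \<in> B"
      unfolding e by (rule frag_module.subspace_add[OF B k l])
    from eq[OF this] show "\<alpha>' (x + y) = \<alpha>' x + \<alpha>' y"
      unfolding eq[OF k] eq[OF l] e using additive_on_add[OF \<alpha> k l] by (simp add: algebra_simps)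
  qed
  moreover have "\<alpha>' b = \<alpha> b" if "b \<in> B" for b
    using eq[of b 0] that by simp
  ultimately show ?thesis by blast
qed

lemma additive_on_extend:
  assumes B: "frag_subgroup B" and "finite S" and \<alpha>: "additive_on B \<alpha>"
  shows "\<exists>\<alpha>'. additive_on (frag_span (B \<union> S)) \<alpha>' \<and> (\<forall>b\<in>B. \<alpha>' b = \<alpha> b)"
  using assms(2)
proof (induction S)
  case empty
  then show ?case using B \<alpha> by (auto simp: frag_module.span_eq_iff[THEN iffD2])
next
  case (insert s S)
  then obtain \<alpha>1 where a1: "additive_on (frag_span (B \<union> S)) \<alpha>1" "\<forall>b\<in>B. \<alpha>1 b = \<alpha> b" by blast
  obtain \<alpha>2 where a2: "additive_on (frag_span (insert s (frag_span (B \<union> S)))) \<alpha>2"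
      "\<forall>b\<in>frag_span (B \<union> S). \<alpha>2 b = \<alpha>1 b"
    using additive_on_extend_insert[OF frag_module.subspace_span a1(1), of s] by blast
  have "frag_span (B \<union> insert s S) \<subseteq> frag_span (insert s (frag_span (B \<union> S)))"
    by (intro frag_module.span_mono) (auto intro: frag_module.span_base)
  moreover have "\<alpha>2 b = \<alpha> b" if "b \<in> B" for b
    using a1(2) a2(2) that frag_module.span_base[of b "B \<union> S"] by auto
  ultimately show ?case using a2(1) additive_on_subset by blast
qed

subsection \<open>Dual systems and traces\<close>

text \<open>A dual system plays the role of a basis of \<open>Z / B\<close> modulo torsion together with its dual basis:
  the elements \<open>x\<close> and functionals \<open>\<xi>\<close> need only reproduce all rational functionals, so torsion
  is invisible and no basis has to be chosen. The resulting trace is the Hattori-Stallings trace.\<close>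
definition dual_system ::
    "('k \<Rightarrow>\<^sub>0 int) set \<Rightarrow> ('k \<Rightarrow>\<^sub>0 int) set \<Rightarrow> (('k \<Rightarrow>\<^sub>0 int) \<times> (('k \<Rightarrow>\<^sub>0 int) \<Rightarrow> rat)) list \<Rightarrow> bool"
  where "dual_system Z B ps \<longleftrightarrow>
    (\<forall>(x, \<xi>)\<in>set ps. x \<in> Z \<and> additive_on Z \<xi> \<and> (\<forall>b\<in>B. \<xi> b = 0)) \<and>
    (\<forall>\<nu>. additive_on Z \<nu> \<longrightarrow> (\<forall>b\<in>B. \<nu> b = 0) \<longrightarrow> (\<forall>z\<in>Z. \<nu> z = (\<Sum>(x, \<xi>)\<leftarrow>ps. \<xi> z * \<nu> x)))"

definition system_trace ::
    "(('k \<Rightarrow>\<^sub>0 int) \<times> (('k \<Rightarrow>\<^sub>0 int) \<Rightarrow> rat)) list \<Rightarrow> (('k \<Rightarrow>\<^sub>0 int) \<Rightarrow> ('k \<Rightarrow>\<^sub>0 int)) \<Rightarrow> rat"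
  where "system_trace ps \<phi> = (\<Sum>(x, \<xi>)\<leftarrow>ps. \<xi> (\<phi> x))"

text \<open>Additivity modulo \<open>B\<close> is what makes \<phi> induce an endomorphism of
  \<open>Z / B\<close>; for \<open>B = {0}\<close> it is plain additivity.\<close>

definition quotient_endo ::
    "('k \<Rightarrow>\<^sub>0 int) set \<Rightarrow> ('k \<Rightarrow>\<^sub>0 int) set \<Rightarrow> (('k \<Rightarrow>\<^sub>0 int) \<Rightarrow> ('k \<Rightarrow>\<^sub>0 int)) \<Rightarrow> bool"
  where "quotient_endo Z B \<phi> \<longleftrightarrow> (\<forall>z\<in>Z. \<phi> z \<in> Z) \<and> (\<forall>b\<in>B. \<phi> b \<in> B) \<and> (\<forall>x\<in>Z. \<forall>y\<in>Z. \<phi> (x + y) - (\<phi> x + \<phi> y) \<in> B)"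

lemma dual_systemD:
  assumes "dual_system Z B ps"
  shows "(x, \<xi>) \<in> set ps \<Longrightarrow> x \<in> Z" "(x, \<xi>) \<in> set ps \<Longrightarrow> additive_on Z \<xi>"
    "(x, \<xi>) \<in> set ps \<Longrightarrow> b \<in> B \<Longrightarrow> \<xi> b = 0"
    "additive_on Z \<nu> \<Longrightarrow> (\<And>b. b \<in> B \<Longrightarrow> \<nu> b = 0) \<Longrightarrow> z \<in> Z \<Longrightarrow> \<nu> z = (\<Sum>(x, \<xi>)\<leftarrow>ps. \<xi> z * \<nu> x)"
  using assms unfolding dual_system_def by blast+

lemma sum_list_swap_pairs:
  "(\<Sum>p\<leftarrow>ps. \<Sum>q\<leftarrow>qs. f p q) = (\<Sum>q\<leftarrow>qs. \<Sum>p\<leftarrow>ps. (f p q :: rat))"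
  by (induction ps) (simp_all add: sum_list_addf)

lemma quotient_endo_additive:
  assumes Z: "frag_subgroup Z" and B: "B \<subseteq> Z" and \<phi>: "quotient_endo Z B \<phi>" and \<xi>: "additive_on
      Z \<xi>" "\<forall>b\<in>B. \<xi> b = 0"
  shows "additive_on Z (\<lambda>z. \<xi> (\<phi> z))" "\<forall>b\<in>B. \<xi> (\<phi> b) = 0"
proof -
  show "\<forall>b\<in>B. \<xi> (\<phi> b) = 0" using \<phi> \<xi> by (auto simp: quotient_endo_def)
  show "additive_on Z (\<lambda>z. \<xi> (\<phi> z))"
    unfolding additive_on_def
  proof (intro ballI)
    fix x y assume xy: "x \<in> Z" "y \<in> Z"
    then have m: "\<phi> x \<in> Z" "\<phi> y \<in> Z" "\<phi> (x + y) - (\<phi> x + \<phi> y) \<in> B" "\<phi> x + \<phi> y \<in> Z"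
      using \<phi> Z by (auto simp: quotient_endo_def frag_module.subspace_add)
    have "\<xi> (\<phi> (x + y)) = \<xi> (\<phi> (x + y) - (\<phi> x + \<phi> y)) + \<xi> (\<phi> x + \<phi> y)"
      using additive_on_add[OF \<xi>(1), of "\<phi> (x + y) - (\<phi> x + \<phi> y)" "\<phi> x + \<phi> y"] m B by auto
    then show "\<xi> (\<phi> (x + y)) = \<xi> (\<phi> x) + \<xi> (\<phi> y)"
      using m \<xi> additive_on_add[OF \<xi>(1) m(1,2)] by simp
  qed
qed

text \<open>One double sum of \<open>\<xi> y * \<eta> (\<phi> x)\<close> is reached from both sides:
  expand \<xi> in the second system at \<open>\<phi> x\<close>, or expand \<eta> composed with
  \<phi> in the first system at \<open>y\<close>. This is the cyclic invariance of the
  trace.\<close>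

lemma system_trace_unique:
  assumes "frag_subgroup Z" "B \<subseteq> Z" "quotient_endo Z B \<phi>" and ps: "dual_system Z B ps"
      and qs: "dual_system Z B qs"
  shows "system_trace ps \<phi> = system_trace qs \<phi>"
proof -
  have "system_trace ps \<phi> = (\<Sum>(x, \<xi>)\<leftarrow>ps. \<Sum>(y, \<eta>)\<leftarrow>qs. \<eta> (\<phi> x) * \<xi> y)"
    unfolding system_trace_def
  proof (intro arg_cong[where f=sum_list] map_cong refl, clarify)
    fix x \<xi> assume x: "(x, \<xi>) \<in> set ps"
    have "\<phi> x \<in> Z" using assms(3) dual_systemD(1)[OF ps x] by (auto simp: quotient_endo_def)
    then show "\<xi> (\<phi> x) = (\<Sum>(y, \<eta>)\<leftarrow>qs. \<eta> (\<phi> x) * \<xi> y)"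
      using dual_systemD(4)[OF qs dual_systemD(2)[OF ps x]] dual_systemD(3)[OF ps x] by blast
  qed
  also have "\<dots> = (\<Sum>p\<leftarrow>ps. \<Sum>q\<leftarrow>qs. snd q (\<phi> (fst p)) * snd p (fst q))"
    by (simp add: case_prod_unfold)
  also have "\<dots> = (\<Sum>q\<leftarrow>qs. \<Sum>p\<leftarrow>ps. snd q (\<phi> (fst p)) * snd p (fst q))"
    by (rule sum_list_swap_pairs)
  also have "\<dots> = (\<Sum>(y, \<eta>)\<leftarrow>qs. \<Sum>(x, \<xi>)\<leftarrow>ps. \<xi> y * \<eta> (\<phi> x))"
    by (simp add: case_prod_unfold mult.commute)
  also have "\<dots> = system_trace qs \<phi>"
    unfolding system_trace_def
  proof (intro arg_cong[where f=sum_list] map_cong refl, clarify)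
    fix y \<eta> assume y: "(y, \<eta>) \<in> set qs"
    have "additive_on Z \<eta>" "\<forall>b\<in>B. \<eta> b = 0"
      using dual_systemD(2,3)[OF qs y] by auto
    from quotient_endo_additive[OF assms(1-3) this]
    show "(\<Sum>(x, \<xi>)\<leftarrow>ps. \<xi> y * \<eta> (\<phi> x)) = \<eta> (\<phi> y)"
      using dual_systemD(4)[OF ps, of "\<lambda>z. \<eta> (\<phi> z)" y] dual_systemD(1)[OF qs y] by simp
  qed
  finally show ?thesis .
qed

lemma additive_on_sum_list_diff:
  assumes "additive_on C \<alpha>" "\<forall>(y, \<eta>)\<in>set qs. additive_on C \<eta>"
  shows "additive_on C (\<lambda>c. \<alpha> c - (\<Sum>(y, \<eta>)\<leftarrow>qs. \<eta> c * f y))"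
  using assms(2)
proof (induction qs)
  case Nil
  then show ?case using assms(1) by (simp)
next
  case (Cons q qs)
  obtain y \<eta> where q: "q = (y, \<eta>)" by force
  then have "additive_on C \<eta>" "additive_on C (\<lambda>c. \<alpha> c - (\<Sum>(y, \<eta>)\<leftarrow>qs. \<eta> c * f y))"
    using Cons by auto
  then show ?case by (simp add: q additive_on_def algebra_simps)
qed

text \<open>Additivity of the trace along a filtration. The functionals of the first system are
  extended to \<open>C\<close> and corrected so that together with the second system they reproduce
  all functionals. The correction vanishes on \<open>B\<close>, where \<phi> sends the vectors of
  the first system, so the traces simply add.\<close>

lemma dual_system_extension:
  assumes A: "frag_subgroup A" and B: "frag_subgroup B" and C: "frag_subgroup C" and sub: "A \<subseteq> B" "B \<subseteq> C"
    and gen: "C \<subseteq> frag_span (B \<union> S)" "finite S"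
    and ps: "dual_system B A ps" and qs: "dual_system C B qs"
  obtains rs where "dual_system C A rs"
    "\<And>\<phi>. quotient_endo B A \<phi> \<Longrightarrow> quotient_endo C B \<phi> \<Longrightarrow>
        system_trace rs \<phi> = system_trace ps \<phi> + system_trace qs \<phi>"
proof -
  have "\<exists>\<alpha>'. additive_on C \<alpha>' \<and> (\<forall>b\<in>B. \<alpha>' b = \<alpha> b)" if "additive_on B \<alpha>" for \<alpha>
    using additive_on_extend[OF B gen(2) that] additive_on_subset[OF _ gen(1)] by blast
  then obtain e where e: "\<And>\<alpha>. additive_on B \<alpha> \<Longrightarrow> additive_on C (e \<alpha>)"
      "\<And>\<alpha> b. additive_on B \<alpha> \<Longrightarrow> b \<in> B \<Longrightarrow> e \<alpha> b = \<alpha> b"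
    by metis
  \<comment> \<open>The extension minus its own expansion along \<open>qs\<close>. Every functional
    in \<open>qs\<close> vanishes on \<open>B\<close>, so \<open>m \<xi>\<close> still agrees with
    \<xi> there.\<close>
  define m where "m \<xi> c = e \<xi> c - (\<Sum>(y, \<eta>)\<leftarrow>qs. \<eta> c * e \<xi> y)" for \<xi> c
  define rs where "rs = map (\<lambda>(x, \<xi>). (x, m \<xi>)) ps @ qs"
  have q0: "(\<Sum>(y, \<eta>)\<leftarrow>qs. \<eta> b * f y) = 0" if "b \<in> B" for b f
  proof -
    have "(\<Sum>(y, \<eta>)\<leftarrow>qs. \<eta> b * f y) = (\<Sum>q\<leftarrow>qs. 0)"
      by (intro arg_cong[where f=sum_list] map_cong refl) (use dual_systemD(3)[OF qs _ that] in auto)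
    then show ?thesis by simp
  qed
  have mB: "m \<xi> b = \<xi> b" if "additive_on B \<xi>" "b \<in> B" for \<xi> b
    using that q0[OF that(2)] e(2) by (simp add: m_def)
  have mC: "additive_on C (m \<xi>)" if "additive_on B \<xi>" for \<xi>
    unfolding m_def using e(1)[OF that] dual_systemD(2)[OF qs]
    by (intro additive_on_sum_list_diff) auto
  have dual: "\<nu> z = (\<Sum>(x, \<xi>)\<leftarrow>rs. \<xi> z * \<nu> x)"
    if \<nu>: "additive_on C \<nu>" "\<And>a. a \<in> A \<Longrightarrow> \<nu> a = 0" and z: "z \<in> C" for \<nu> z
  proof -
    \<comment> \<open>The part of \<nu> not reproduced by the extended functionals vanishes on
      \<open>B\<close>, so \<open>qs\<close> reproduces it; collecting the coefficients of
      \<open>\<nu> x\<close> yields exactly \<open>m\<close>.\<close>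
    define \<mu> where "\<mu> c = \<nu> c - (\<Sum>(x, \<xi>)\<leftarrow>ps. e \<xi> c * \<nu> x)" for c
    have "additive_on C (\<lambda>c. \<nu> c - (\<Sum>(x, \<xi>)\<leftarrow>map (\<lambda>(x, \<xi>). (x, e \<xi>)) ps. \<xi> c * \<nu> x))"
      using \<nu>(1) e(1) dual_systemD(2)[OF ps] by (intro additive_on_sum_list_diff) auto
    then have "additive_on C \<mu>"
      by (simp add: \<mu>_def[abs_def] case_prod_unfold comp_def)
    moreover have "\<mu> b = 0" if b: "b \<in> B" for b
    proof -
      have "(\<Sum>(x, \<xi>)\<leftarrow>ps. e \<xi> b * \<nu> x) = (\<Sum>(x, \<xi>)\<leftarrow>ps. \<xi> b * \<nu> x)"
        by (intro arg_cong[where f=sum_list] map_cong refl) (use e(2) b dual_systemD(2)[OF ps] in auto)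
      then show ?thesis
        using dual_systemD(4)[OF ps additive_on_subset[OF \<nu>(1) sub(2)] \<nu>(2) b] by (simp add: \<mu>_def)
    qed
    ultimately have "\<mu> z = (\<Sum>(y, \<eta>)\<leftarrow>qs. \<eta> z * \<mu> y)"
      using dual_systemD(4)[OF qs] z by blast
    also have "\<dots> = (\<Sum>(y, \<eta>)\<leftarrow>qs. \<eta> z * \<nu> y) - (\<Sum>(y, \<eta>)\<leftarrow>qs. \<Sum>(x, \<xi>)\<leftarrow>ps. \<eta> z * (e \<xi> y * \<nu> x))"
      by (simp add: \<mu>_def case_prod_unfold right_diff_distrib sum_list_subtractf sum_list_const_mult)
    also have "(\<Sum>(y, \<eta>)\<leftarrow>qs. \<Sum>(x, \<xi>)\<leftarrow>ps. \<eta> z * (e \<xi> y * \<nu> x)) = (\<Sum>(x, \<xi>)\<leftarrow>ps. (\<Sum>(y, \<eta>)\<leftarrow>qs. \<eta> z * e \<xi> y) * \<nu> x)"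
      using sum_list_swap_pairs[of "\<lambda>q p. snd q z * (e (snd p) (fst q) * \<nu> (fst p))" ps qs]
      by (simp add: case_prod_unfold sum_list_mult_const[symmetric] mult.assoc)
    finally show ?thesis
      by (simp add: rs_def m_def \<mu>_def case_prod_unfold comp_def left_diff_distrib
          sum_list_subtractf algebra_simps)
  qed
  show ?thesis
  proof
    show "dual_system C A rs"
      unfolding dual_system_def
    proof (intro conjI allI impI ballI dual)
      fix p assume "p \<in> set rs"
      then consider (1) x \<xi> where "(x, \<xi>) \<in> set ps" "p = (x, m \<xi>)" | (2) "p \<in> set qs"
        by (auto simp: rs_def)
      then show "case p of (x, \<xi>) \<Rightarrow> x \<in> C \<and> additive_on C \<xi> \<and> (\<forall>b\<in>A. \<xi> b = 0)"
      proof cases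
        case 1
        then show ?thesis
          using dual_systemD(1-3)[OF ps 1(1)] mC mB sub by auto
      next
        case 2
        obtain y \<eta> where "p = (y, \<eta>)" by force
        then show ?thesis using 2 dual_systemD(1-3)[OF qs] sub by auto
      qed
    qed auto
    fix \<phi> assume \<phi>: "quotient_endo B A \<phi>"
    have "(\<Sum>(x, \<xi>)\<leftarrow>ps. m \<xi> (\<phi> x)) = (\<Sum>(x, \<xi>)\<leftarrow>ps. \<xi> (\<phi> x))"
      by (intro arg_cong[where f=sum_list] map_cong refl)
        (use \<phi> mB dual_systemD(1,2)[OF ps] in \<open>auto simp: quotient_endo_def\<close>)
    then show "system_trace rs \<phi> = system_trace ps \<phi> + system_trace qs \<phi>"
      by (simp add: rs_def system_trace_def case_prod_unfold comp_def)
  qed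
qed


text \<open>The quotient is cyclic. If it is finite, only the zero functional vanishes on
  \<open>B\<close> and the empty system works; if it is infinite, the class of \<open>s\<close> is a
  basis and the coefficient of \<open>s\<close> is the dual functional.\<close>

lemma dual_system_cyclic:
  assumes B: "frag_subgroup B"
  shows "\<exists>qs. dual_system (frag_span (insert s B)) B qs"
proof -
  let ?C = "frag_span (insert s B)"
  have in_span: "x \<in> ?C \<longleftrightarrow> (\<exists>k. x - frag_cmul k s \<in> B)" for x
    using frag_module.span_breakdown_eq[of x s B] frag_module.span_eq_iff[of B] B by metis
  have sC: "s \<in> ?C" and BC: "B \<subseteq> ?C" and subC: "frag_subgroup ?C"
    by (auto intro: frag_module.span_base)
  have lin: "\<nu> z = of_int k * \<nu> s"
    if \<nu>: "additive_on ?C \<nu>" "\<forall>b\<in>B. \<nu> b = 0" and k: "z - frag_cmul k s \<in> B" and z: "z \<in> ?C" for \<nu> z k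
  proof -
    have "frag_cmul k s \<in> ?C" using sC by (rule frag_module.span_scale)
    then have "\<nu> (z - frag_cmul k s) = \<nu> z - of_int k * \<nu> s"
      using additive_on_diff[OF \<nu>(1) subC z] additive_on_cmul[OF \<nu>(1) subC sC] by simp
    then show ?thesis using \<nu>(2) k by simp
  qed
  show ?thesis
  proof (cases "\<exists>m. m \<noteq> 0 \<and> frag_cmul m s \<in> B")
    case True
    then obtain m where m: "m \<noteq> 0" "frag_cmul m s \<in> B" by blast
    have "\<nu> z = 0" if \<nu>: "additive_on ?C \<nu>" "\<forall>b\<in>B. \<nu> b = 0" and z: "z \<in> ?C" for \<nu> z
    proof -
      have "of_int m * \<nu> s = 0"
        using additive_on_cmul[OF \<nu>(1) subC sC, of m] \<nu>(2) m by simp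
      then show ?thesis using m lin[OF \<nu> _ z] z in_span by auto
    qed
    then have "dual_system ?C B []" by (simp add: dual_system_def)
    then show ?thesis ..
  next
    case False
    \<comment> \<open>The coefficient is unique because no nonzero multiple of \<open>s\<close> lies
      in \<open>B\<close>.\<close>
    define \<kappa> where "\<kappa> z = (THE k. z - frag_cmul k s \<in> B)" for z
    have \<kappa>: "\<kappa> z = k" if k: "z - frag_cmul k s \<in> B" for z k
      unfolding \<kappa>_def
    proof (rule the_equality[where a=k])
      fix l assume l: "z - frag_cmul l s \<in> B"
      have "(z - frag_cmul k s) - (z - frag_cmul l s) = frag_cmul (l - k) s"
        by (simp add: frag_cmul_diff_distrib del: minus_frag_cmul)
      then have "frag_cmul (l - k) s \<in> B" using frag_module.subspace_diff[OF B k l] by (simp only:)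
      then have "l - k = 0" using False by blast
      then show "l = k" by simp
    qed (rule k)
    have "dual_system ?C B [(s, \<lambda>z. of_int (\<kappa> z))]"
      unfolding dual_system_def
    proof (intro conjI allI impI ballI)
      have "additive_on ?C (\<lambda>z. of_int (\<kappa> z))"
        unfolding additive_on_def
      proof (intro ballI)
        fix x y assume "x \<in> ?C" "y \<in> ?C"
        then obtain k l where k: "x - frag_cmul k s \<in> B" and l: "y - frag_cmul l s \<in> B"
          using in_span by auto
        have e: "x + y - frag_cmul (k + l) s = (x - frag_cmul k s) + (y - frag_cmul l s)"
          by (simp add: frag_cmul_distrib)
        have "x + y - frag_cmul (k + l) s \<in> B"
          unfolding e by (rule frag_module.subspace_add[OF B k l])
        then show "rat_of_int (\<kappa> (x + y)) = of_int (\<kappa> x) + of_int (\<kappa> y)"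
          using \<kappa>[OF k] \<kappa>[OF l] \<kappa> by simp
      qed
      moreover have "\<kappa> b = 0" if "b \<in> B" for b using \<kappa>[of b 0] that by simp
      ultimately show "case p of (x, \<xi>) \<Rightarrow> x \<in> ?C \<and> additive_on ?C \<xi> \<and> (\<forall>b\<in>B. \<xi> b = 0)"
        if "p \<in> set [(s, \<lambda>z. of_int (\<kappa> z))]" for p using that sC by auto
    next
      fix \<nu> :: "('a \<Rightarrow>\<^sub>0 int) \<Rightarrow> rat" and z assume \<nu>: "additive_on ?C \<nu>" "\<forall>b\<in>B. \<nu> b = 0" and z: "z \<in> ?C"
      then obtain k where k: "z - frag_cmul k s \<in> B" using in_span by auto
      show "\<nu> z = (\<Sum>(x, \<xi>)\<leftarrow>[(s, \<lambda>z. of_int (\<kappa> z))]. \<xi> z * \<nu> x)"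
        using lin[OF \<nu> k z] \<kappa>[OF k] by simp
    qed
    then show ?thesis ..
  qed
qed

lemma dual_system_exists:
  assumes B: "frag_subgroup B" and "finite S"
  shows "\<exists>ps. dual_system (frag_span (B \<union> S)) B ps"
  using assms(2)
proof (induction S)
  case empty
  have "dual_system B B []" by (auto simp: dual_system_def)
  then have "dual_system (frag_span B) B []"
    using frag_module.span_eq_iff[of B] B by metis
  then show ?case by auto
next
  case (insert s S)
  then obtain ps where ps: "dual_system (frag_span (B \<union> S)) B ps" by blast
  let ?C = "frag_span (B \<union> insert s S)"
  have C: "?C = frag_span (insert s (frag_span (B \<union> S)))"
  proof
    show "?C \<subseteq> frag_span (insert s (frag_span (B \<union> S)))"
      by (intro frag_module.span_mono) (auto intro: frag_module.span_base)
    show "frag_span (insert s (frag_span (B \<union> S))) \<subseteq> ?C"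
      using frag_module.span_mono[of "B \<union> S" "B \<union> insert s S"]
      by (intro frag_module.span_minimal) (auto intro: frag_module.span_base)
  qed
  obtain qs where qs: "dual_system ?C (frag_span (B \<union> S)) qs"
    using dual_system_cyclic[OF frag_module.subspace_span, of s "B \<union> S"] C by auto
  have sub: "frag_span (B \<union> S) \<subseteq> ?C" by (intro frag_module.span_mono) auto
  have gen: "?C \<subseteq> frag_span (frag_span (B \<union> S) \<union> {s})" using C by simp
  show ?case
    using dual_system_extension[OF B frag_module.subspace_span frag_module.subspace_span _ sub gen _ ps qs]
    by (auto intro: frag_module.span_base)
qed

text \<open>Induction on the support. The coordinates at \<open>s\<close> of elements of
  \<open>Z\<close> form an ideal of the integers, generated by the least positive one; division with
  remainder reduces every element to one that does not involve \<open>s\<close>.\<close>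

lemma finitely_generated_subgroup:
  assumes "finite S" "frag_subgroup Z" "\<And>z. z \<in> Z \<Longrightarrow> Poly_Mapping.keys z \<subseteq> S"
  shows "\<exists>G. finite G \<and> Z = frag_span G"
  using assms
proof (induction S arbitrary: Z)
  case empty
  then have "Z \<subseteq> {0}" by auto
  then have "Z = {0}" using frag_module.subspace_0[OF empty.prems(1)] by auto
  then show ?case by (intro exI[of _ "{}"]) simp
next
  case (insert s S)
  note Z = insert.prems(1)
  define Z' where "Z' = {z \<in> Z. Poly_Mapping.lookup z s = 0}"
  have "frag_subgroup Z'"
    using frag_module.subspace_0[OF Z] frag_module.subspace_diff[OF Z]
    by (intro frag_subgroupI) (auto simp: Z'_def lookup_minus)
  moreover have "Poly_Mapping.keys z \<subseteq> S" if "z \<in> Z'" for z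
    using insert.prems(2)[of z] that by (auto simp: Z'_def in_keys_iff)
  ultimately obtain G where G: "finite G" "Z' = frag_span G"
    using insert.IH by blast
  show ?case
  proof (cases "Z' = Z")
    case True
    then show ?thesis using G by auto
  next
    case False
    then obtain w where w: "w \<in> Z" "Poly_Mapping.lookup w s \<noteq> 0" by (auto simp: Z'_def)
    have "\<exists>z. z \<in> Z \<and> Poly_Mapping.lookup z s > 0"
    proof (cases "Poly_Mapping.lookup w s > 0")
      case False
      then have "Poly_Mapping.lookup (- w) s > 0" using w by simp
      then show ?thesis using frag_module.subspace_neg[OF Z w(1)] by blast
    qed (use w in blast)
    then obtain z where z: "z \<in> Z" "Poly_Mapping.lookup z s > 0"
      and least: "\<And>y. y \<in> Z \<and> Poly_Mapping.lookup y s > 0 \<Longrightarrow>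
          nat (Poly_Mapping.lookup z s) \<le> nat (Poly_Mapping.lookup y s)"
      using ex_has_least_nat[of "\<lambda>z. z \<in> Z \<and> Poly_Mapping.lookup z s > 0" _ "\<lambda>z. nat
          (Poly_Mapping.lookup z s)"]
      by blast
    have "y \<in> frag_span (insert z G)" if y: "y \<in> Z" for y
    proof -
      define q where "q = Poly_Mapping.lookup y s div Poly_Mapping.lookup z s"
      have mem: "y - frag_cmul q z \<in> Z"
        using frag_module.subspace_diff[OF Z y] frag_module.subspace_scale[OF Z z(1)] by blast
      have e: "Poly_Mapping.lookup (y - frag_cmul q z) s
          = Poly_Mapping.lookup y s mod Poly_Mapping.lookup z s"
        by (simp add: lookup_minus q_def minus_div_mult_eq_mod)
      have "Poly_Mapping.lookup (y - frag_cmul q z) s = 0"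
      proof (rule ccontr)
        assume "Poly_Mapping.lookup (y - frag_cmul q z) s \<noteq> 0"
        then have "Poly_Mapping.lookup (y - frag_cmul q z) s > 0" using e z(2) by (simp add: order_less_le)
        then have "Poly_Mapping.lookup z s \<le> Poly_Mapping.lookup (y - frag_cmul q z) s"
          using least[of "y - frag_cmul q z"] mem by auto
        then show False using e z(2) by (metis linorder_not_less pos_mod_bound)
      qed
      then have "y - frag_cmul q z \<in> frag_span G" using mem G by (auto simp: Z'_def)
      then show ?thesis by (auto simp: frag_module.span_breakdown_eq)
    qed
    moreover have "frag_span (insert z G) \<subseteq> Z"
      using G z Z by (intro frag_module.span_minimal) (auto simp: Z'_def intro: frag_module.span_base)
    ultimately show ?thesis using G by (intro exI[of _ "insert z G"]) auto
  qed
qed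

subsection \<open>Torsion-free quotients are free\<close>

text \<open>Adding a multiple of one generator to another is compensated by the contragredient
  change of coefficients.\<close>

lemma sum_frag_cmul_shear:
  fixes x :: "nat \<Rightarrow> 'k \<Rightarrow>\<^sub>0 int" and b :: "nat \<Rightarrow> int"
  assumes "i \<noteq> j" "i < r" "j < r"
  shows "(\<Sum>k<r. frag_cmul ((b(i := b i - e * b j)) k) ((x(j := x j + frag_cmul e (x i))) k))
    = (\<Sum>k<r. frag_cmul (b k) (x k))"
proof -
  let ?R = "{..<r} - {i} - {j}"
  have split: "sum f {..<r} = f i + (f j + sum f ?R)" for f :: "nat \<Rightarrow> 'k \<Rightarrow>\<^sub>0 int"
    using assms by (simp add: sum.remove[of "{..<r}" i] sum.remove[of "{..<r} - {i}" j])
  have "(\<Sum>k\<in>?R. frag_cmul ((b(i := b i - e * b j)) k) ((x(j := x j + frag_cmul e (x i))) k))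
     = (\<Sum>k\<in>?R. frag_cmul (b k) (x k))"
    by (rule sum.cong) auto
  then show ?thesis
    using assms
    by (simp add: split frag_cmul_distrib2 frag_cmul_diff_distrib mult.commute)
qed

text \<open>Take a generating tuple of minimal length and, among such tuples, a relation of minimal
  \<open>\<ell>\<^sup>1\<close>-norm. A relation with two nonzero coefficients is shortened by a shear; one with a
  single nonzero coefficient makes a generator redundant, because the quotient is torsion-free.\<close>
lemma torsion_free_quotient_basis:
  fixes Z K :: "('k \<Rightarrow>\<^sub>0 int) set"
  assumes Z: "frag_subgroup Z" and K: "frag_subgroup K" "K \<subseteq> Z"
    and sat: "\<forall>z\<in>Z. \<forall>m. m \<noteq> 0 \<longrightarrow> frag_cmul m z \<in> K \<longrightarrow> z \<in> K"
    and gen: "finite S" "S \<subseteq> Z" "Z \<subseteq> frag_span (K \<union> S)"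
  shows "\<exists>r (x :: nat \<Rightarrow> 'k \<Rightarrow>\<^sub>0 int). (\<forall>i<r. x i \<in> Z) \<and>
    (\<forall>z\<in>Z. \<exists>a. z - (\<Sum>i<r. frag_cmul (a i) (x i)) \<in> K) \<and>
    (\<forall>a. (\<Sum>i<r. frag_cmul (a i) (x i)) \<in> K \<longrightarrow> (\<forall>i<r. a i = 0))"
proof -
  define gens where "gens r x \<longleftrightarrow> (\<forall>i<r. x i \<in> Z) \<and> (\<forall>z\<in>Z. \<exists>a. z - (\<Sum>i<r. frag_cmul (a i) (x i)) \<in> K)"
    for r and x :: "nat \<Rightarrow> 'k \<Rightarrow>\<^sub>0 int"
  have "\<exists>r x. gens r x"
  proof -
    obtain x where x: "bij_betw x {..<card S} S"
      using ex_bij_betw_nat_finite[OF gen(1)] by (auto simp: atLeast0LessThan)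
    have "\<exists>a. z - (\<Sum>i<card S. frag_cmul (a i) (x i)) \<in> K" if z: "z \<in> Z" for z
    proof -
      obtain k s where ks: "z = k + s" "k \<in> frag_span K" "s \<in> frag_span S"
        using subsetD[OF gen(3) z] unfolding frag_module.span_Un by blast
      have kK: "k \<in> K" using ks(2) K(1) frag_module.span_eq_iff by blast
      obtain u where u: "s = (\<Sum>v\<in>S. frag_cmul (u v) v)"
        using ks(3) unfolding frag_module.span_finite[OF gen(1)] by auto
      have "s = (\<Sum>i<card S. frag_cmul (u (x i)) (x i))"
        unfolding u using sum.reindex_bij_betw[OF x, of "\<lambda>v. frag_cmul (u v) v"] by simp
      then show ?thesis using ks kK by (intro exI[of _ "\<lambda>i. u (x i)"]) simp
    qed
    moreover have "\<forall>i<card S. x i \<in> Z" using x gen(2) by (auto simp: bij_betw_def)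
    ultimately show ?thesis unfolding gens_def by blast
  qed
  then obtain r where r: "\<exists>x. gens r x" and least: "\<And>q. q < r \<Longrightarrow> \<nexists>x. gens q x"
    using exists_least_iff[of "\<lambda>r. \<exists>x. gens r x"] by blast
  have zero: "\<forall>i<r. a i = 0"
    if "gens r x" "(\<Sum>i<r. frag_cmul (a i) (x i)) \<in> K" for x a
    using that
  proof (induction "\<Sum>i<r. nat \<bar>a i\<bar>" arbitrary: x a rule: less_induct)
    case less
    show ?case
    proof (rule ccontr)
      assume "\<not> (\<forall>i<r. a i = 0)"
      then obtain i0 where i0: "i0 < r" "a i0 \<noteq> 0" by blast
      show False
      proof (cases "\<exists>j<r. j \<noteq> i0 \<and> a j \<noteq> 0")
        case True
        then obtain i j where ij: "i < r" "j < r" "i \<noteq> j" "a i \<noteq> 0" "a j \<noteq> 0" "\<bar>a j\<bar> \<le> \<bar>a i\<bar>"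
          using i0 by (metis linorder_linear)
        \<comment> \<open>With this sign the new coefficient has absolute value \<bar>a i\<bar> -
          \<bar>a j\<bar>, which is smaller than \<bar>a i\<bar> since \<open>a j\<close> is nonzero
          and the indices were ordered by absolute value.\<close>
        define e where "e = sgn (a i) * sgn (a j)"
        define a' where "a' = a(i := a i - e * a j)"
        define x' where "x' = x(j := x j + frag_cmul e (x i))"
        have sum_eq: "(\<Sum>k<r. frag_cmul ((b(i := b i - e * b j)) k) (x' k))
            = (\<Sum>k<r. frag_cmul (b k) (x k))" for b
          unfolding x'_def by (rule sum_frag_cmul_shear) (use ij in auto)
        have "nat \<bar>a i - e * a j\<bar> < nat \<bar>a i\<bar>"
          using ij unfolding e_def by (auto simp: sgn_if abs_if split: if_splits)
        then have "(\<Sum>k<r. nat \<bar>a' k\<bar>) < (\<Sum>k<r. nat \<bar>a k\<bar>)"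
          using ij by (intro sum_strict_mono_ex1) (auto simp: a'_def intro!: bexI[of _ i])
        moreover have "gens r x'"
          unfolding gens_def
        proof (intro conjI ballI allI impI)
          show "x' k \<in> Z" if "k < r" for k
            using that ij less.prems(1) frag_module.subspace_add[OF Z] frag_module.subspace_scale[OF Z]
            by (auto simp: gens_def x'_def)
          fix z assume "z \<in> Z"
          then obtain b where "z - (\<Sum>k<r. frag_cmul (b k) (x k)) \<in> K"
            using less.prems(1) by (auto simp: gens_def)
          then show "\<exists>b. z - (\<Sum>k<r. frag_cmul (b k) (x' k)) \<in> K"
            using sum_eq by metis
        qed
        moreover have "(\<Sum>k<r. frag_cmul (a' k) (x' k)) \<in> K"
          unfolding a'_def sum_eq using less.prems(2) .
        ultimately have "\<forall>k<r. a' k = 0" using less.hyps by blast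
        then show False using ij by (auto simp: a'_def split: if_splits)
      next
        case False
        have single: "(\<Sum>k<r. frag_cmul (a k) (x k)) = frag_cmul (a i0) (x i0)"
          using i0 False by (subst sum.remove[of _ i0]) (auto intro!: sum.neutral)
        have xK: "x i0 \<in> K"
          using sat less.prems i0 single unfolding gens_def by metis
        \<comment> \<open>The last generator fills the gap, which keeps the tuple indexed by an
          initial segment; for \<open>i0 = r - 1\<close> nothing has to move.\<close>
        define x' where "x' = x(i0 := x (r - 1))"
        have "gens (r - 1) x'"
          unfolding gens_def
        proof (intro conjI ballI allI impI)
          show "x' k \<in> Z" if "k < r - 1" for k
            using that i0 less.prems(1) by (auto simp: gens_def x'_def)
          fix z assume "z \<in> Z"
          then obtain b where b: "z - (\<Sum>k<r. frag_cmul (b k) (x k)) \<in> K"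
            using less.prems(1) by (auto simp: gens_def)
          define b' where "b' = b(i0 := b (r - 1))"
          have "(\<Sum>k<r. frag_cmul (b k) (x k)) = frag_cmul (b i0) (x i0) + (\<Sum>k<r - 1. frag_cmul (b' k) (x' k))"
          proof (cases "i0 = r - 1")
            case True
            have "{..<r} - {i0} = {..<r - 1}" using True i0(1) by auto
            moreover have "(\<Sum>k<r - 1. frag_cmul (b' k) (x' k)) = (\<Sum>k<r - 1. frag_cmul (b k) (x k))"
              by (rule sum.cong) (auto simp: b'_def x'_def True)
            ultimately show ?thesis using i0(1) sum.remove[of "{..<r}" i0] by simp
          next
            case False
            let ?R = "{..<r - 1} - {i0}"
            have "{..<r} - {i0} - {r - 1} = ?R" using i0(1) by auto
            then have "(\<Sum>k<r. frag_cmul (b k) (x k))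
                = frag_cmul (b i0) (x i0) + (frag_cmul (b (r-1)) (x (r-1)) + (\<Sum>k\<in>?R. frag_cmul (b k) (x k)))"
              using i0(1) False sum.remove[of "{..<r}" i0 "\<lambda>k. frag_cmul (b k) (x k)"]
                sum.remove[of "{..<r} - {i0}" "r - 1" "\<lambda>k. frag_cmul (b k) (x k)"] by simp
            moreover have "(\<Sum>k<r - 1. frag_cmul (b' k) (x' k))
                = frag_cmul (b' i0) (x' i0) + (\<Sum>k\<in>?R. frag_cmul (b' k) (x' k))"
              using i0(1) False by (intro sum.remove) auto
            moreover have "(\<Sum>k\<in>?R. frag_cmul (b' k) (x' k)) = (\<Sum>k\<in>?R. frag_cmul (b k) (x k))"
              by (rule sum.cong) (auto simp: b'_def x'_def)
            ultimately show ?thesis by (simp add: b'_def x'_def)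
          qed
          then have "z - (\<Sum>k<r - 1. frag_cmul (b' k) (x' k))
              = (z - (\<Sum>k<r. frag_cmul (b k) (x k))) + frag_cmul (b i0) (x i0)"
            by simp
          then show "\<exists>a. z - (\<Sum>k<r - 1. frag_cmul (a k) (x' k)) \<in> K"
            using frag_module.subspace_add[OF K(1) b frag_module.subspace_scale[OF K(1) xK]] by metis
        qed
        then show False using least[of "r - 1"] i0(1) by auto
      qed
    qed
  qed
  from r obtain x where x: "gens r x" ..
  then have 1: "\<forall>i<r. x i \<in> Z" and 2: "\<forall>z\<in>Z. \<exists>a. z - (\<Sum>i<r. frag_cmul (a i) (x i)) \<in> K"
    unfolding gens_def by (rule conjunct1, rule conjunct2)
  have 3: "\<forall>a. (\<Sum>i<r. frag_cmul (a i) (x i)) \<in> K \<longrightarrow> (\<forall>i<r. a i = 0)"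
    by (rule allI, rule impI, rule zero[OF x])
  show ?thesis by (intro exI[of _ r] exI[of _ x] conjI 1 2 3)
qed

subsection \<open>Traces modulo torsion\<close>

lemma additive_hom_rules:
  fixes H :: "('g, 'm) monoid_scheme"
  assumes H: "Group.group H" and Z: "frag_subgroup Z"
    and c: "\<And>z. z \<in> Z \<Longrightarrow> c z \<in> carrier H" "\<And>x y. x \<in> Z \<Longrightarrow> y \<in> Z \<Longrightarrow> c (x + y) = c x \<otimes>\<^bsub>H\<^esub> c y"
  shows "c 0 = \<one>\<^bsub>H\<^esub>" "x \<in> Z \<Longrightarrow> y \<in> Z \<Longrightarrow> c x = c y \<longleftrightarrow> c (x - y) = \<one>\<^bsub>H\<^esub>"
proof -
  interpret H: Group.group H by fact
  have Z0: "0 \<in> Z" using Z by (rule frag_module.subspace_0)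
  show c0: "c 0 = \<one>\<^bsub>H\<^esub>"
    using c(1)[OF Z0] c(2)[OF Z0 Z0] H.l_cancel_one by (metis add.right_neutral)
  assume xy: "x \<in> Z" "y \<in> Z"
  then have d: "x - y \<in> Z" using Z frag_module.subspace_diff by blast
  have "c x = c (x - y) \<otimes>\<^bsub>H\<^esub> c y" using c(2)[OF d xy(2)] by simp
  then show "c x = c y \<longleftrightarrow> c (x - y) = \<one>\<^bsub>H\<^esub>"
    using c(1)[OF d] c(1)[OF xy(2)] by simp
qed

lemma additive_hom_pow:
  fixes H :: "('g, 'm) monoid_scheme"
  assumes H: "Group.group H" and Z: "frag_subgroup Z"
    and c: "\<And>z. z \<in> Z \<Longrightarrow> c z \<in> carrier H" "\<And>x y. x \<in> Z \<Longrightarrow> y \<in> Z \<Longrightarrow> c (x + y) = c x \<otimes>\<^bsub>H\<^esub> c y"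
    and w: "w \<in> Z"
  shows "c (frag_cmul (int n) w) = c w [^]\<^bsub>H\<^esub> n"
proof (induction n)
  case 0
  interpret H: Group.group H by fact
  show ?case using additive_hom_rules(1)[of H Z c] assms by simp
next
  case (Suc n)
  interpret H: Group.group H by fact
  have "frag_cmul (int (Suc n)) w = frag_cmul (int n) w + w"
    by (simp add: frag_cmul_distrib add.commute)
  then show ?case using Suc c(2)[OF frag_module.subspace_scale[OF Z w] w] by simp
qed

text \<open>\<open>free_trace\<close> chooses among the traces in all bases, so a basis must exist
  and every basis must give the same value. The latter holds because a basis of \<open>H\<close>,
  lifted to \<open>Z\<close> and paired with its coordinates, is again a dual system for
  \<open>Z\<close> and \<open>B\<close>.\<close>

lemma free_trace_eq_system_trace:
  fixes H :: "('g, 'm) monoid_scheme" and c :: "('k \<Rightarrow>\<^sub>0 int) \<Rightarrow> 'g"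
  assumes H: "Group.group H" and Z: "frag_subgroup Z" and B: "frag_subgroup B" "B \<subseteq> Z"
    and gen: "finite S" "S \<subseteq> Z" "Z \<subseteq> frag_span (B \<union> S)"
    and \<phi>: "quotient_endo Z B \<phi>" and ps: "dual_system Z B ps"
    and c: "\<And>z. z \<in> Z \<Longrightarrow> c z \<in> carrier H" "\<And>x y. x \<in> Z \<Longrightarrow> y \<in> Z \<Longrightarrow> c (x + y) = c x \<otimes>\<^bsub>H\<^esub> c y"
      "carrier H \<subseteq> c ` Z" "\<And>z. z \<in> Z \<Longrightarrow> c z = \<one>\<^bsub>H\<^esub> \<longleftrightarrow> (\<exists>m. m \<noteq> 0 \<and> frag_cmul m z \<in> B)"
    and \<psi>: "\<And>z. z \<in> Z \<Longrightarrow> \<psi> (c z) = c (\<phi> z)"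
  shows "of_int (free_trace H \<psi>) = system_trace ps \<phi>"
proof -
  interpret H: Group.group H by fact
  have c_rules: "c 0 = \<one>\<^bsub>H\<^esub>" "\<And>x y. x \<in> Z \<Longrightarrow> y \<in> Z \<Longrightarrow> c x = c y \<longleftrightarrow> c (x - y) = \<one>\<^bsub>H\<^esub>"
    using additive_hom_rules[OF H Z, of c] c(1,2) by blast+
  \<comment> \<open>By the hypothesis on the kernel of \<open>c\<close>, this is the saturation of
    \<open>B\<close>: the elements of \<open>Z\<close> with a nonzero multiple in
    \<open>B\<close>.\<close>
  define K where "K = {z \<in> Z. c z = \<one>\<^bsub>H\<^esub>}"
  have K: "frag_subgroup K" "K \<subseteq> Z"
    using frag_module.subspace_0[OF Z] frag_module.subspace_diff[OF Z]
    by (intro frag_subgroupI) (auto simp: K_def c_rules(1) c_rules(2)[symmetric])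
  have BK: "B \<subseteq> K"
    using B c(4) by (force simp: K_def intro: exI[of _ 1])
  have sat: "z \<in> K" if zm: "z \<in> Z" "m \<noteq> 0" "frag_cmul m z \<in> K" for z m
  proof -
    obtain l where "l \<noteq> 0" "frag_cmul l (frag_cmul m z) \<in> B"
      using zm(3) c(4) by (auto simp: K_def)
    then have "l * m \<noteq> 0 \<and> frag_cmul (l * m) z \<in> B" using zm(2) by simp
    then show ?thesis using c(4)[OF zm(1)] zm(1) unfolding K_def by blast
  qed
  then have sat': "\<forall>z\<in>Z. \<forall>m. m \<noteq> 0 \<longrightarrow> frag_cmul m z \<in> K \<longrightarrow> z \<in> K" by blast
  have "frag_span (B \<union> S) \<subseteq> frag_span (K \<union> S)" using BK by (intro frag_module.span_mono) auto
  then have gen': "Z \<subseteq> frag_span (K \<union> S)" using gen(3) by blast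
  have comb: "(\<Sum>i<r. frag_cmul (a i) (x i)) \<in> Z" if "\<And>i. i < r \<Longrightarrow> x i \<in> Z" for r a and x :: "nat \<Rightarrow> 'k \<Rightarrow>\<^sub>0 int"
    using that frag_module.subspace_scale[OF Z] by (intro frag_module.subspace_sum[OF Z]) auto
  \<comment> \<open>Rational functionals cannot distinguish \<open>B\<close> from its
    saturation.\<close>
  have vanish: "\<nu> z = 0" if \<nu>: "additive_on Z \<nu>" "\<And>b. b \<in> B \<Longrightarrow> \<nu> b = 0" "z \<in> K" for \<nu> z
  proof -
    obtain m where m: "m \<noteq> 0" "frag_cmul m z \<in> B" "z \<in> Z" using \<nu>(3) c(4) by (auto simp: K_def)
    then have "of_int m * \<nu> z = 0"
      using additive_on_cmul[OF \<nu>(1) Z m(3), of m] \<nu>(2) by simp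
    then show ?thesis using m(1) by simp
  qed
  have sum_additive: "\<nu> (\<Sum>i<r. frag_cmul (a i) (x i)) = (\<Sum>i<r. of_int (a i) * \<nu> (x i))"
    if \<nu>: "additive_on Z \<nu>" and "\<And>i. i < r \<Longrightarrow> x i \<in> Z" for \<nu> r a and x :: "nat \<Rightarrow> 'k \<Rightarrow>\<^sub>0 int"
    using that(2)
  proof (induction r)
    case (Suc r)
    have "(\<Sum>i<r. frag_cmul (a i) (x i)) \<in> Z" "frag_cmul (a r) (x r) \<in> Z"
      using Suc.prems comb[of r x a] frag_module.subspace_scale[OF Z] by auto
    then show ?case
      using Suc additive_on_add[OF \<nu>] additive_on_cmul[OF \<nu> Z] by simp
  qed (simp add: additive_on_0[OF \<nu> Z])
  have all: "of_int (basis_trace H r f \<psi>) = system_trace ps \<phi>"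
    if f: "f \<in> iso (free_Abelian_group {..<r}) H" for r f
  proof -
    let ?A = "free_Abelian_group {..<r}"
    interpret A: Group.group ?A by simp
    define g where "g = inv_into (carrier ?A) f"
    have fhom: "f \<in> hom ?A H" and fbij: "bij_betw f (carrier ?A) (carrier H)"
      using f by (auto simp: iso_def)
    interpret f: group_hom ?A H f by (simp add: group_hom_def group_hom_axioms_def fhom H)
    have giso: "g \<in> iso H ?A" using A.iso_set_sym[OF f] by (simp add: g_def)
    have g_in: "Poly_Mapping.keys (g h) \<subseteq> {..<r}" if "h \<in> carrier H" for h
      using giso that by (auto simp: iso_def hom_def Pi_iff)
    have g_add: "g (h \<otimes>\<^bsub>H\<^esub> k) = g h + g k" if "h \<in> carrier H" "k \<in> carrier H" for h k
      using giso that by (auto simp: iso_def hom_def)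
    have fg: "f (g h) = h" if "h \<in> carrier H" for h
      using fbij that unfolding g_def by (simp add: bij_betw_inv_into_right)
    have gf: "g (f a) = a" if "a \<in> carrier ?A" for a
      using fbij that unfolding g_def by (simp add: bij_betw_inv_into_left)
    have "\<exists>z\<in>Z. c z = f (frag_of i)" if "i < r" for i
    proof -
      have "f (frag_of i) \<in> carrier H" using that by (intro f.hom_closed) simp
      then have "f (frag_of i) \<in> c ` Z" using c(3) by blast
      then show ?thesis by auto
    qed
    then obtain x where x: "\<And>i. i < r \<Longrightarrow> x i \<in> Z" "\<And>i. i < r \<Longrightarrow> c (x i) = f (frag_of i)"
      by metis
    define qs where "qs = map (\<lambda>i. (x i, \<lambda>z. rat_of_int (Poly_Mapping.lookup (g (c z)) i))) [0..<r]"
    have qs_sum: "(\<Sum>(x, \<xi>)\<leftarrow>qs. F x \<xi>) = (\<Sum>i<r. F (x i) (\<lambda>z. of_int (Poly_Mapping.lookup (g (c z)) i)))"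
      for F :: "('k \<Rightarrow>\<^sub>0 int) \<Rightarrow> (('k \<Rightarrow>\<^sub>0 int) \<Rightarrow> rat) \<Rightarrow> rat"
      by (simp add: qs_def comp_def interv_sum_list_conv_sum_set_nat atLeast0LessThan)
    have "dual_system Z B qs"
      unfolding dual_system_def
    proof (intro conjI allI impI ballI)
      fix p assume "p \<in> set qs"
      then obtain i where i: "i < r" "p = (x i, \<lambda>z. rat_of_int (Poly_Mapping.lookup (g (c z)) i))"
        by (auto simp: qs_def)
      have "additive_on Z (\<lambda>z. rat_of_int (Poly_Mapping.lookup (g (c z)) i))"
        using c g_add by (auto simp: additive_on_def lookup_add)
      moreover have "Poly_Mapping.lookup (g (c b)) i = 0" if "b \<in> B" for b
      proof -
        have "c b = f 0" using that BK f.hom_one by (auto simp: K_def)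
        then show ?thesis using gf[of 0] by simp
      qed
      ultimately show "case p of (x, \<xi>) \<Rightarrow> x \<in> Z \<and> additive_on Z \<xi> \<and> (\<forall>b\<in>B. \<xi> b = 0)"
        using i x by auto
    next
      fix \<nu> z assume \<nu>: "additive_on Z \<nu>" "\<forall>b\<in>B. \<nu> b = 0" and z: "z \<in> Z"
      define a where "a = Poly_Mapping.lookup (g (c z))"
      let ?y = "\<Sum>i<r. frag_cmul (a i) (x i)"
      have y: "?y \<in> Z" using comb x(1) by blast
      \<comment> \<open>Both sides are homomorphic in the coefficients, and the lifts
        \<open>x i\<close> were chosen so that the two maps agree on generators.\<close>
      have csum: "c (\<Sum>i<q. frag_cmul (a i) (x i)) = f (\<Sum>i<q. frag_cmul (a i) (frag_of i))" if "q \<le> r" for q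
        using that
      proof (induction q)
        case 0
        then show ?case using c_rules(1) f.hom_one by simp
      next
        case (Suc q)
        have m: "(\<Sum>i<q. frag_cmul (a i) (x i)) \<in> Z" "frag_cmul (a q) (x q) \<in> Z"
          using Suc.prems x(1) comb[of q x a] frag_module.subspace_scale[OF Z] by auto
        have k: "Poly_Mapping.keys (\<Sum>i<q. frag_cmul (a i) (frag_of i)) \<subseteq> {..<r}"
          using keys_sum[of "\<lambda>i. frag_cmul (a i) (frag_of i)" "{..<q}"] Suc.prems
              by (fastforce split: if_splits)
        have "c (frag_cmul k w) = c w [^]\<^bsub>H\<^esub> k" if w: "w \<in> Z" for w k
        proof -
          have mem: "frag_cmul k w \<in> Z" for k using w frag_module.subspace_scale[OF Z] by blast
          have nat: "c (frag_cmul (int n) w) = c w [^]\<^bsub>H\<^esub> n" for n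
            using additive_hom_pow[OF H Z, of c w n] c(1,2) w by blast
          show ?thesis
          proof (cases k rule: int_cases2)
            case (nonneg n)
            then show ?thesis using nat by (simp add: int_pow_int)
          next
            case (nonpos n)
            have "frag_cmul k w + frag_cmul (int n) w = 0"
              by (simp add: nonpos frag_cmul_distrib[symmetric])
            then have "c (frag_cmul k w) \<otimes>\<^bsub>H\<^esub> c (frag_cmul (int n) w) = \<one>\<^bsub>H\<^esub>"
              using c(2)[OF mem mem, of k "int n"] c_rules by simp
            then show ?thesis
              using nat[of n] c(1) mem w
              by (metis H.int_pow_neg_int H.inv_equality H.inv_inv H.nat_pow_closed nonpos)
          qed
        qed
        moreover have "f (frag_cmul k (frag_of q)) = f (frag_of q) [^]\<^bsub>H\<^esub> k" for k
          using f.hom_int_pow[of "frag_of q" k] Suc.prems by simp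
        ultimately have "c (frag_cmul (a q) (x q)) = f (frag_cmul (a q) (frag_of q))"
          using x Suc.prems by simp
        moreover have "Poly_Mapping.keys (frag_cmul (a q) (frag_of q)) \<subseteq> {..<r}"
          using Suc.prems by (auto dest: subsetD[OF keys_cmul])
        ultimately show ?case
          using Suc c(2)[OF m] f.hom_mult[of "\<Sum>i<q. frag_cmul (a i) (frag_of i)" "frag_cmul
              (a q) (frag_of q)"] k
          by auto
      qed
      have "(\<Sum>i<r. frag_cmul (a i) (frag_of i)) = frag_extend frag_of (g (c z))"
        unfolding frag_extend_def a_def using g_in[OF c(1)[OF z]]
        by (intro sum.mono_neutral_right) (auto simp: in_keys_iff)
      also have "\<dots> = g (c z)" by (rule frag_expansion[symmetric])
      finally have "c ?y = c z" using csum[of r] fg c(1)[OF z] by simp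
      then have "z - ?y \<in> K" using c_rules(2)[OF z y] frag_module.subspace_diff[OF Z z y] by (simp add: K_def)
      then have "\<nu> (z - ?y) = 0" using vanish[OF \<nu>(1)] \<nu>(2) by blast
      then have "\<nu> z = \<nu> ?y" using additive_on_diff[OF \<nu>(1) Z z y] by simp
      also have "\<dots> = (\<Sum>i<r. of_int (a i) * \<nu> (x i))" using sum_additive[OF \<nu>(1)] x(1) by blast
      finally show "\<nu> z = (\<Sum>(x, \<xi>)\<leftarrow>qs. \<xi> z * \<nu> x)"
        unfolding qs_sum a_def .
    qed
    then have "system_trace ps \<phi> = system_trace qs \<phi>"
      using system_trace_unique[OF Z B(2) \<phi> ps] by blast
    also have "\<dots> = (\<Sum>i<r. rat_of_int (Poly_Mapping.lookup (g (c (\<phi> (x i)))) i))"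
      unfolding system_trace_def qs_sum ..
    also have "\<dots> = of_int (basis_trace H r f \<psi>)"
      unfolding basis_trace_def g_def[symmetric] of_int_sum
      by (intro sum.cong refl) (simp add: x(2)[symmetric] x(1) \<psi>)
    finally show ?thesis by simp
  qed
  \<comment> \<open>The quotient by the saturation is finitely generated and torsion-free, hence
    free; its basis is the witness for the choice operator in \<open>free_trace\<close>.\<close>
  obtain r and x :: "nat \<Rightarrow> 'k \<Rightarrow>\<^sub>0 int" where rx: "(\<forall>i<r. x i \<in> Z) \<and>
    (\<forall>z\<in>Z. \<exists>a. z - (\<Sum>i<r. frag_cmul (a i) (x i)) \<in> K) \<and>
    (\<forall>a. (\<Sum>i<r. frag_cmul (a i) (x i)) \<in> K \<longrightarrow> (\<forall>i<r. a i = 0))"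
    using torsion_free_quotient_basis[OF Z K sat' gen(1,2) gen'] by (elim exE) (rule that)
  then have x: "\<And>i. i < r \<Longrightarrow> x i \<in> Z" and x_gen: "\<And>z. z \<in> Z \<Longrightarrow> \<exists>a. z - (\<Sum>i<r. frag_cmul (a i) (x i)) \<in> K"
    by simp_all
  have x_indep: "a i = 0" if a: "(\<Sum>i<r. frag_cmul (a i) (x i)) \<in> K" "i < r" for a i
  proof -
    have "(\<Sum>i<r. frag_cmul (a i) (x i)) \<in> K \<longrightarrow> (\<forall>i<r. a i = 0)"
      by (rule spec[OF conjunct2[OF conjunct2[OF rx]], where x=a])
    then have "\<forall>i<r. a i = 0" using a(1) by (rule mp)
    then show ?thesis using a(2) by simp
  qed
  define f where "f p = c (\<Sum>i<r. frag_cmul (Poly_Mapping.lookup p i) (x i))" for p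
  have pZ: "(\<Sum>i<r. frag_cmul (Poly_Mapping.lookup p i) (x i)) \<in> Z" for p by (rule comb[OF x])
  have f_in: "f p \<in> carrier H" for p unfolding f_def by (rule c(1)[OF pZ])
  have f: "f \<in> iso (free_Abelian_group {..<r}) H"
  proof (rule isoI)
    show "f \<in> hom (free_Abelian_group {..<r}) H"
    proof (rule homI)
      show "f p \<in> carrier H" for p by (rule f_in)
      fix p q
      show "f (p \<otimes>\<^bsub>free_Abelian_group {..<r}\<^esub> q) = f p \<otimes>\<^bsub>H\<^esub> f q"
        unfolding f_def using c(2)[OF pZ pZ]
        by (simp add: lookup_add frag_cmul_distrib sum.distrib)
    qed
    show "bij_betw f (carrier (free_Abelian_group {..<r})) (carrier H)"
      unfolding bij_betw_def
    proof
      show "inj_on f (carrier (free_Abelian_group {..<r}))"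
      proof (rule inj_onI)
        fix p q assume pq: "p \<in> carrier (free_Abelian_group {..<r})" "q \<in> carrier (free_Abelian_group
            {..<r})" "f p = f q"
        have "(\<Sum>i<r. frag_cmul (Poly_Mapping.lookup p i) (x i)) - (\<Sum>i<r. frag_cmul
            (Poly_Mapping.lookup q i) (x i)) \<in> K"
          using pq(3) c_rules(2)[OF pZ pZ] frag_module.subspace_diff[OF Z pZ pZ]
          by (simp add: f_def K_def)
        moreover have "(\<Sum>i<r. frag_cmul (Poly_Mapping.lookup p i) (x i)) - (\<Sum>i<r. frag_cmul
            (Poly_Mapping.lookup q i) (x i))
          = (\<Sum>i<r. frag_cmul (Poly_Mapping.lookup (p - q) i) (x i))"
          by (simp add: lookup_minus frag_cmul_diff_distrib sum_subtractf del: minus_frag_cmul)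
        ultimately have "(\<Sum>i<r. frag_cmul (Poly_Mapping.lookup (p - q) i) (x i)) \<in> K" by (simp only:)
        then have "Poly_Mapping.lookup (p - q) i = 0" if "i < r" for i
          using x_indep[of "Poly_Mapping.lookup (p - q)"] that by blast
        moreover have "Poly_Mapping.lookup (p - q) i = 0" if "\<not> i < r" for i
        proof -
          have "i \<notin> Poly_Mapping.keys p" "i \<notin> Poly_Mapping.keys q" using pq(1,2) that by auto
          then show ?thesis by (simp add: lookup_minus in_keys_iff)
        qed
        ultimately have "p - q = 0" by (metis poly_mapping_eqI lookup_zero)
        then show "p = q" by simp
      qed
      have "h \<in> f ` carrier (free_Abelian_group {..<r})" if hH: "h \<in> carrier H" for h
      proof -
        obtain z where z: "z \<in> Z" "h = c z" using hH c(3) by blast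
        obtain a where a: "z - (\<Sum>i<r. frag_cmul (a i) (x i)) \<in> K" using x_gen[OF z(1)]
            by (elim exE) (rule that)
        define p where "p = (\<Sum>i<r. frag_cmul (a i) (frag_of i))"
        have lp: "Poly_Mapping.lookup p i = a i" if "i < r" for i
        proof -
          have "Poly_Mapping.lookup p i = (\<Sum>j<r. if j = i then a i else 0)"
            unfolding p_def lookup_sum by (rule sum.cong) (auto simp: lookup_single)
          then show ?thesis using that by simp
        qed
        have "Poly_Mapping.keys p \<subseteq> {..<r}"
          using keys_sum[of "\<lambda>i. frag_cmul (a i) (frag_of i)" "{..<r}"] unfolding p_def
              by (fastforce split: if_splits)
        moreover have "f p = h"
        proof -
          have "f p = c (\<Sum>i<r. frag_cmul (a i) (x i))" unfolding f_def using lp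
              by (auto intro: arg_cong[where f=c])
          then show ?thesis using a c_rules(2)[OF z(1) comb[of r x a, OF x]] z(2) by (simp add: K_def)
        qed
        ultimately show ?thesis by (intro image_eqI[of _ _ p]) auto
      qed
      moreover have "f p \<in> carrier H" for p by (rule f_in)
      ultimately show "f ` carrier (free_Abelian_group {..<r}) = carrier H" by blast
    qed
  qed
  have "\<exists>r f. f \<in> iso (free_Abelian_group {..<r}) H \<and> free_trace H \<psi> = basis_trace H r f \<psi>"
    unfolding free_trace_def by (rule someI_ex) (use f in blast)
  then show ?thesis using all by metis
qed


text \<open>Following \<open>h\<close>, whose kernel is \<open>B\<close>, by the projection modulo
  torsion gives a surjection whose kernel is the saturation of \<open>B\<close>, which is the
  situation of the preceding lemma.\<close>

lemma trace_mod_torsion_eq_system_trace: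
  fixes G :: "('g, 'm) monoid_scheme" and h :: "('k \<Rightarrow>\<^sub>0 int) \<Rightarrow> 'g"
  assumes G: "comm_group G" and Z: "frag_subgroup Z" and B: "frag_subgroup B" "B \<subseteq> Z"
    and gen: "finite S" "S \<subseteq> Z" "Z \<subseteq> frag_span (B \<union> S)"
    and \<phi>: "quotient_endo Z B \<phi>" and ps: "dual_system Z B ps"
    and h: "\<And>z. z \<in> Z \<Longrightarrow> h z \<in> carrier G" "\<And>x y. x \<in> Z \<Longrightarrow> y \<in> Z \<Longrightarrow> h (x + y) = h x \<otimes>\<^bsub>G\<^esub> h y"
      "carrier G \<subseteq> h ` Z" "\<And>z. z \<in> Z \<Longrightarrow> h z = \<one>\<^bsub>G\<^esub> \<longleftrightarrow> z \<in> B"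
    and \<Phi>: "\<And>z. z \<in> Z \<Longrightarrow> \<Phi> (h z) = h (\<phi> z)"
  shows "of_int (trace_mod_torsion G \<Phi>) = system_trace ps \<phi>"
proof -
  interpret G: comm_group G by fact
  note G' = G.is_group
  define T where "T = torsion_subgroup G"
  have T: "subgroup T G"
  proof
    show "T \<subseteq> carrier G" by (auto simp: T_def torsion_subgroup_def)
    show "\<one>\<^bsub>G\<^esub> \<in> T" by (auto simp: T_def torsion_subgroup_def intro!: exI[of _ 1])
    fix x assume "x \<in> T"
    then obtain k where x: "x \<in> carrier G" "(k::nat) > 0" "x [^]\<^bsub>G\<^esub> k = \<one>\<^bsub>G\<^esub>"
      by (auto simp: T_def torsion_subgroup_def)
    have "(inv\<^bsub>G\<^esub> x) [^]\<^bsub>G\<^esub> k = \<one>\<^bsub>G\<^esub>" using x by (simp add: G.nat_pow_inv)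
    then show "inv\<^bsub>G\<^esub> x \<in> T" using x by (auto simp: T_def torsion_subgroup_def)
    fix y assume "y \<in> T"
    then obtain l where y: "y \<in> carrier G" "(l::nat) > 0" "y [^]\<^bsub>G\<^esub> l = \<one>\<^bsub>G\<^esub>"
      by (auto simp: T_def torsion_subgroup_def)
    have "(x \<otimes>\<^bsub>G\<^esub> y) [^]\<^bsub>G\<^esub> (k * l) = (x [^]\<^bsub>G\<^esub> k) [^]\<^bsub>G\<^esub> l \<otimes>\<^bsub>G\<^esub> (y [^]\<^bsub>G\<^esub> l) [^]\<^bsub>G\<^esub> k"
      using x(1) y(1) by (simp add: G.pow_mult_distrib G.m_comm G.nat_pow_pow mult.commute)
    also have "\<dots> = \<one>\<^bsub>G\<^esub>" by (simp add: x y)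
    finally have "\<exists>m::nat. m > 0 \<and> (x \<otimes>\<^bsub>G\<^esub> y) [^]\<^bsub>G\<^esub> m = \<one>\<^bsub>G\<^esub>" using x(2) y(2)
        by (intro exI[of _ "k * l"]) auto
    then show "x \<otimes>\<^bsub>G\<^esub> y \<in> T" using x(1) y(1) unfolding T_def torsion_subgroup_def by simp
  qed
  have normal: "normal T G" using T by (rule G.subgroup_imp_normal)
  have h_pow: "h (frag_cmul (int n) z) = h z [^]\<^bsub>G\<^esub> n" if "z \<in> Z" for z n
    using additive_hom_pow[OF G' Z, of h z n] h(1,2) that by blast
  have hT: "h z \<in> T \<longleftrightarrow> (\<exists>m. m \<noteq> 0 \<and> frag_cmul m z \<in> B)" if z: "z \<in> Z" for z
  proof
    assume "h z \<in> T"
    then obtain k :: nat where k: "k > 0" "h z [^]\<^bsub>G\<^esub> k = \<one>\<^bsub>G\<^esub>"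
      by (auto simp: T_def torsion_subgroup_def)
    have "h (frag_cmul (int k) z) = \<one>\<^bsub>G\<^esub>" unfolding h_pow[OF z] by (rule k(2))
    then have "frag_cmul (int k) z \<in> B" using h(4)[OF frag_module.subspace_scale[OF Z z]] by blast
    then show "\<exists>m. m \<noteq> 0 \<and> frag_cmul m z \<in> B" using k(1) by (intro exI[of _ "int k"]) simp
  next
    assume "\<exists>m. m \<noteq> 0 \<and> frag_cmul m z \<in> B"
    then obtain m where m: "m \<noteq> 0" "frag_cmul m z \<in> B" by blast
    \<comment> \<open>The multiplier is made positive, since torsion is defined with natural
      exponents.\<close>
    have "frag_cmul (sgn m) (frag_cmul m z) \<in> B" using m(2) B(1) frag_module.subspace_scale by blast
    moreover have "int (nat \<bar>m\<bar>) = sgn m * m" by (simp add: sgn_if)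
    ultimately have "frag_cmul (int (nat \<bar>m\<bar>)) z \<in> B" by (metis frag_cmul_cmul)
    then have "h z [^]\<^bsub>G\<^esub> (nat \<bar>m\<bar>) = \<one>\<^bsub>G\<^esub>"
      using h(4)[OF frag_module.subspace_scale[OF Z z]] h_pow[OF z, of "nat \<bar>m\<bar>"] by metis
    moreover have "nat \<bar>m\<bar> > 0" using m(1) by simp
    ultimately show "h z \<in> T" using h(1)[OF z] unfolding T_def torsion_subgroup_def by blast
  qed
  have \<phi>Z: "\<phi> z \<in> Z" if "z \<in> Z" for z using \<phi> that by (auto simp: quotient_endo_def)
  have h\<phi>: "h (\<phi> (x + y)) = h (\<phi> x) \<otimes>\<^bsub>G\<^esub> h (\<phi> y)" if "x \<in> Z" "y \<in> Z" for x y
  proof -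
    have m: "\<phi> (x + y) - (\<phi> x + \<phi> y) \<in> B" using \<phi> that by (auto simp: quotient_endo_def)
    have "x + y \<in> Z" "\<phi> x + \<phi> y \<in> Z" using frag_module.subspace_add[OF Z] that \<phi>Z by auto
    then have "h (\<phi> (x + y)) = h (\<phi> x + \<phi> y)"
      using additive_hom_rules(2)[OF G' Z, of h "\<phi> (x + y)" "\<phi> x + \<phi> y"] h(1,2) m h(4) B(2) \<phi>Z by blast
    then show ?thesis using h(2) \<phi>Z that by simp
  qed
  \<comment> \<open>Torsion is preserved because \<open>h\<close> composed with \<phi> is additive
    on \<open>Z\<close>, even though \<phi> itself is additive only modulo \<open>B\<close>.\<close>
  have h\<phi>T: "h (\<phi> z) \<in> T" if z: "z \<in> Z" "h z \<in> T" for z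
  proof -
    obtain k :: nat where k: "k > 0" "h z [^]\<^bsub>G\<^esub> k = \<one>\<^bsub>G\<^esub>"
      using z(2) by (auto simp: T_def torsion_subgroup_def)
    have mem: "frag_cmul (int k) z \<in> Z" using frag_module.subspace_scale[OF Z z(1)] .
    have "h (frag_cmul (int k) z) = \<one>\<^bsub>G\<^esub>" unfolding h_pow[OF z(1)] by (rule k(2))
    then have "frag_cmul (int k) z \<in> B" using h(4)[OF mem] by blast
    then have "\<phi> (frag_cmul (int k) z) \<in> B" using \<phi> by (auto simp: quotient_endo_def)
    then have "h (\<phi> (frag_cmul (int k) z)) = \<one>\<^bsub>G\<^esub>" using h(4)[OF \<phi>Z[OF mem]] by simp
    then have "h (\<phi> z) [^]\<^bsub>G\<^esub> k = \<one>\<^bsub>G\<^esub>"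
      using additive_hom_pow[OF G' Z, of "\<lambda>z. h (\<phi> z)" z k] h(1) \<phi>Z h\<phi> z(1) by simp
    then show ?thesis using k(1) h(1)[OF \<phi>Z[OF z(1)]] unfolding T_def torsion_subgroup_def by blast
  qed
  define c where "c z = T #>\<^bsub>G\<^esub> h z" for z
  show ?thesis
    unfolding trace_mod_torsion_def T_def[symmetric]
  proof (rule free_trace_eq_system_trace[OF normal.factorgroup_is_group[OF normal] Z B gen \<phi> ps])
    show "c z \<in> carrier (G Mod T)" if "z \<in> Z" for z
      using h(1)[OF that] by (auto simp: c_def FactGroup_def RCOSETS_def)
    show "c (x + y) = c x \<otimes>\<^bsub>G Mod T\<^esub> c y" if "x \<in> Z" "y \<in> Z" for x y
      using that h(1,2) by (simp add: c_def FactGroup_def normal.rcos_sum[OF normal])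
    show "carrier (G Mod T) \<subseteq> c ` Z"
      using h(3) by (auto simp: c_def FactGroup_def RCOSETS_def image_iff)
    show "c z = \<one>\<^bsub>G Mod T\<^esub> \<longleftrightarrow> (\<exists>m. m \<noteq> 0 \<and> frag_cmul m z \<in> B)" if "z \<in> Z" for z
      using hT[OF that] G.coset_join1[OF _ _ T] G.coset_join2[OF _ T] subgroup.subset[OF T] h(1)[OF that]
      by (auto simp: c_def FactGroup_def)
    show "quotient_map_by G T \<Phi> (c z) = c (\<phi> z)" if z: "z \<in> Z" for z
    proof -
      \<comment> \<open>Each torsion element is some \<open>h w\<close>, so \<Phi> on the coset is
        governed by \<open>\<phi> (w + z)\<close>. The factor \<open>h (\<phi> w)\<close> is torsion
        again and is absorbed by \<open>T\<close>.\<close>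
      have tr: "\<exists>w\<in>Z. t = h w \<and> \<Phi> (t \<otimes>\<^bsub>G\<^esub> h z) = h (\<phi> w) \<otimes>\<^bsub>G\<^esub> h (\<phi> z)" if tT: "t \<in> T" for t
      proof -
        obtain w where w: "w \<in> Z" "t = h w" using tT h(3) subgroup.subset[OF T] by blast
        have "\<Phi> (t \<otimes>\<^bsub>G\<^esub> h z) = h (\<phi> (w + z))"
          using \<Phi>[OF frag_module.subspace_add[OF Z w(1) z]] h(2)[OF w(1) z] w(2) by simp
        then show ?thesis using w h\<phi>[OF w(1) z] by auto
      qed
      have "T <#>\<^bsub>G\<^esub> (\<Phi> ` (T #>\<^bsub>G\<^esub> h z)) = T #>\<^bsub>G\<^esub> h (\<phi> z)"
      proof
        show "T <#>\<^bsub>G\<^esub> (\<Phi> ` (T #>\<^bsub>G\<^esub> h z)) \<subseteq> T #>\<^bsub>G\<^esub> h (\<phi> z)"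
        proof
          fix y assume "y \<in> T <#>\<^bsub>G\<^esub> (\<Phi> ` (T #>\<^bsub>G\<^esub> h z))"
          then obtain s t where st: "s \<in> T" "t \<in> T" "y = s \<otimes>\<^bsub>G\<^esub> \<Phi> (t \<otimes>\<^bsub>G\<^esub> h z)"
            by (auto simp: set_mult_def r_coset_def)
          obtain w where w: "w \<in> Z" "t = h w" "\<Phi> (t \<otimes>\<^bsub>G\<^esub> h z) = h (\<phi> w) \<otimes>\<^bsub>G\<^esub> h (\<phi> z)"
            using tr[OF st(2)] by blast
          have "h (\<phi> w) \<in> T" using h\<phi>T w st by blast
          then have "s \<otimes>\<^bsub>G\<^esub> h (\<phi> w) \<in> T" using st(1) subgroup.m_closed[OF T] by blast
          moreover have "y = s \<otimes>\<^bsub>G\<^esub> h (\<phi> w) \<otimes>\<^bsub>G\<^esub> h (\<phi> z)"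
            using st(1,3) w \<phi>Z h(1) subgroup.mem_carrier[OF T] z by (simp add: G.m_assoc)
          ultimately show "y \<in> T #>\<^bsub>G\<^esub> h (\<phi> z)" by (auto simp: r_coset_def)
        qed
        show "T #>\<^bsub>G\<^esub> h (\<phi> z) \<subseteq> T <#>\<^bsub>G\<^esub> (\<Phi> ` (T #>\<^bsub>G\<^esub> h z))"
        proof
          fix y assume "y \<in> T #>\<^bsub>G\<^esub> h (\<phi> z)"
          then obtain s where s: "s \<in> T" "y = s \<otimes>\<^bsub>G\<^esub> h (\<phi> z)" by (auto simp: r_coset_def)
          have "h z \<in> T #>\<^bsub>G\<^esub> h z"
            using subgroup.one_closed[OF T] h(1)[OF z] by (force simp: r_coset_def)
          then show "y \<in> T <#>\<^bsub>G\<^esub> (\<Phi> ` (T #>\<^bsub>G\<^esub> h z))"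
            using s \<Phi>[OF z] by (force simp: set_mult_def)
        qed
      qed
      then show ?thesis by (simp add: quotient_map_by_def c_def)
    qed
  qed
qed

subsection \<open>The Hopf trace formula\<close>

lemma quotient_endo_additiveI:
  assumes "\<And>z. z \<in> Z \<Longrightarrow> \<phi> z \<in> Z" "\<And>b. b \<in> B \<Longrightarrow> \<phi> b \<in> B" "frag_subgroup B"
    "\<And>x y. x \<in> Z \<Longrightarrow> y \<in> Z \<Longrightarrow> \<phi> (x + y) = \<phi> x + \<phi> y"
  shows "quotient_endo Z B \<phi>"
  using assms frag_module.subspace_0 by (auto simp: quotient_endo_def)

text \<open>The quotient of \<open>C\<close> by the kernel of \<open>D\<close> is isomorphic to the
  image, and dual systems pull back: lift the vectors and precompose the functionals with
  \<open>D\<close>. In the trace formula this replaces chains modulo cycles by boundaries one degree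
  lower.\<close>

lemma dual_system_image:
  assumes C: "frag_subgroup C" and D: "\<And>x y. x \<in> C \<Longrightarrow> y \<in> C \<Longrightarrow> D (x + y) = D x + D y"
    and ps: "dual_system (D ` C) {0} ps"
  obtains qs where "dual_system C {z \<in> C. D z = 0} qs"
    "\<And>\<phi>. (\<And>c. c \<in> C \<Longrightarrow> \<phi> c \<in> C) \<Longrightarrow> (\<And>c. c \<in> C \<Longrightarrow> D (\<phi> c) = \<phi> (D c)) \<Longrightarrow> system_trace qs \<phi> = system_trace ps \<phi>"
proof -
  define l where "l x = inv_into C D x" for x
  define qs where "qs = map (\<lambda>(x, \<xi>). (l x, \<lambda>c. \<xi> (D c))) ps"
  have l: "l x \<in> C" "D (l x) = x" if "x \<in> D ` C" for x
    using that by (auto simp: l_def inv_into_into f_inv_into_f)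
  show ?thesis
  proof
    show "dual_system C {z \<in> C. D z = 0} qs"
      unfolding dual_system_def
    proof (intro conjI allI impI ballI)
      fix p assume "p \<in> set qs"
      then obtain x \<xi> where p: "(x, \<xi>) \<in> set ps" "p = (l x, \<lambda>c. \<xi> (D c))" by (auto simp: qs_def)
      have \<xi>: "additive_on (D ` C) \<xi>" "\<xi> 0 = 0" using dual_systemD(2,3)[OF ps p(1)] by auto
      have "additive_on C (\<lambda>c. \<xi> (D c))" using \<xi>(1) D by (auto simp: additive_on_def)
      then show "case p of (x, \<xi>) \<Rightarrow> x \<in> C \<and> additive_on C \<xi> \<and> (\<forall>b\<in>{z \<in> C. D z = 0}. \<xi> b = 0)"
        using l(1) dual_systemD(1)[OF ps p(1)] p(2) \<xi>(2) by auto
    next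
      fix \<nu> z assume \<nu>: "additive_on C \<nu>" "\<forall>b\<in>{z \<in> C. D z = 0}. \<nu> b = 0" and z: "z \<in> C"
      \<comment> \<open>A functional that kills the kernel does not see which lift was
        chosen.\<close>
      have eq: "\<nu> x = \<nu> y" if "x \<in> C" "y \<in> C" "D x = D y" for x y
      proof -
        have d: "x - y \<in> C" using frag_module.subspace_diff[OF C that(1,2)] .
        have "D (x - y) = 0" using D[OF d that(2)] that(3) by simp
        then have "\<nu> (x - y) = 0" using \<nu>(2) d by simp
        then show ?thesis using additive_on_diff[OF \<nu>(1) C that(1,2)] by simp
      qed
      have l_add: "additive_on (D ` C) (\<lambda>b. \<nu> (l b))"
        unfolding additive_on_def
      proof (intro ballI)
        fix x y assume xy: "x \<in> D ` C" "y \<in> D ` C"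
        have s: "l x + l y \<in> C" using frag_module.subspace_add[OF C] l xy by blast
        have "D (l x + l y) = x + y" using D l xy by simp
        then have "\<nu> (l (x + y)) = \<nu> (l x + l y)" using s l by (intro eq) force+
        then show "\<nu> (l (x + y)) = \<nu> (l x) + \<nu> (l y)" using additive_on_add[OF \<nu>(1)] l xy by simp
      qed
      have l_0: "\<nu> (l 0) = 0"
      proof -
        have z0: "0 \<in> C" using C frag_module.subspace_0 by blast
        have "D 0 = 0" using D[OF z0 z0] by simp
        then show ?thesis using z0 eq[of "l 0" 0] l[of 0] additive_on_0[OF \<nu>(1) C] by force
      qed
      have "\<nu> (l (D z)) = (\<Sum>(x, \<xi>)\<leftarrow>ps. \<xi> (D z) * \<nu> (l x))"
      proof -
        have "\<nu> (l b) = 0" if "b \<in> {0}" for b using that l_0 by blast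
        then show ?thesis by (rule dual_systemD(4)[OF ps l_add _ imageI[OF z]])
      qed
      moreover have "\<nu> (l (D z)) = \<nu> z" by (rule eq) (simp_all add: l z)
      ultimately show "\<nu> z = (\<Sum>(x, \<xi>)\<leftarrow>qs. \<xi> z * \<nu> x)"
        by (simp add: qs_def case_prod_unfold comp_def)
    qed
    fix \<phi> assume \<phi>: "\<And>c. c \<in> C \<Longrightarrow> \<phi> c \<in> C" "\<And>c. c \<in> C \<Longrightarrow> D (\<phi> c) = \<phi> (D c)"
    have "(\<Sum>(x, \<xi>)\<leftarrow>ps. \<xi> (D (\<phi> (l x)))) = (\<Sum>(x, \<xi>)\<leftarrow>ps. \<xi> (\<phi> x))"
      by (intro arg_cong[where f=sum_list] map_cong refl) (use \<phi> l dual_systemD(1)[OF ps] in auto)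
    then show "system_trace qs \<phi> = system_trace ps \<phi>"
      by (simp add: qs_def system_trace_def case_prod_unfold comp_def)
  qed
qed

text \<open>The standard basis with its coordinates; at this point the trace becomes a sum of
  diagonal entries.\<close>

lemma dual_system_free:
  assumes "finite L"
  obtains ps where "dual_system {c :: 'k \<Rightarrow>\<^sub>0 int. Poly_Mapping.keys c \<subseteq> L} {0} ps"
    "\<And>\<phi>. system_trace ps \<phi> = (\<Sum>l\<in>L. of_int (Poly_Mapping.lookup (\<phi> (frag_of l)) l))"
proof -
  obtain ls where ls: "set ls = L" "distinct ls" using finite_distinct_list[OF assms] by blast
  define C where "C = {c :: 'k \<Rightarrow>\<^sub>0 int. Poly_Mapping.keys c \<subseteq> L}"
  have C: "frag_subgroup C"
    using keys_diff by (intro frag_subgroupI) (fastforce simp: C_def)+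
  define ps :: "(('k \<Rightarrow>\<^sub>0 int) \<times> (('k \<Rightarrow>\<^sub>0 int) \<Rightarrow> rat)) list"
    where "ps = map (\<lambda>l. (frag_of l, \<lambda>c. of_int (Poly_Mapping.lookup c l))) ls"
  have sum: "(\<Sum>(x, \<xi>)\<leftarrow>ps. F x \<xi>) = (\<Sum>l\<in>L. F (frag_of l) (\<lambda>c. of_int (Poly_Mapping.lookup c l)))"
    for F :: "('k \<Rightarrow>\<^sub>0 int) \<Rightarrow> (('k \<Rightarrow>\<^sub>0 int) \<Rightarrow> rat) \<Rightarrow> rat"
    using ls by (simp add: ps_def comp_def sum_list_distinct_conv_sum_set)
  have "\<nu> z = (\<Sum>l\<in>L. of_int (Poly_Mapping.lookup z l) * \<nu> (frag_of l))"
    if \<nu>: "additive_on C \<nu>" and z: "z \<in> C" for \<nu> z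
  proof -
    have "Poly_Mapping.keys z \<subseteq> L" using z by (simp add: C_def)
    then have "z \<in> C \<and> \<nu> z = (\<Sum>l\<in>L. of_int (Poly_Mapping.lookup z l) * \<nu> (frag_of l))"
    proof (induction z rule: frag_induction)
      case zero
      then show ?case using additive_on_0[OF \<nu> C] by (simp add: C_def)
    next
      case (one x)
      have "(\<Sum>l\<in>L. of_int (Poly_Mapping.lookup (frag_of x) l) * \<nu> (frag_of l)) = (\<Sum>l\<in>L. if l
          = x then \<nu> (frag_of x) else 0)"
        by (rule sum.cong) (auto simp: lookup_single)
      then show ?case using one assms by (simp add: C_def)
    next
      case (diff a b)
      then show ?case
        using additive_on_diff[OF \<nu> C, of a b] frag_module.subspace_diff[OF C, of a b]
        by (simp add: lookup_minus left_diff_distrib sum_subtractf)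
    qed
    then show ?thesis ..
  qed
  then have "dual_system C {0} ps"
    unfolding dual_system_def sum by (auto simp: ps_def ls C_def additive_on_def lookup_add)
  then show ?thesis using that[of ps] by (simp add: C_def system_trace_def sum)
qed

text \<open>Along {0} \<subseteq> \<open>B n\<close> \<subseteq> \<open>Z n\<close> \<subseteq>
  \<open>C n\<close> the trace on \<open>C n\<close>, zero by \<open>diag\<close>, splits into the
  trace on boundaries, the trace on homology, and the trace on \<open>C n / Z n\<close>. The last
  one is the trace on the boundaries one degree lower, so the alternating sum telescopes.\<close>

lemma hopf_trace:
  fixes L :: "nat \<Rightarrow> 'k set" and D :: "nat \<Rightarrow> ('k \<Rightarrow>\<^sub>0 int) \<Rightarrow> ('k \<Rightarrow>\<^sub>0 int)"
  defines "C \<equiv> \<lambda>n. {c. Poly_Mapping.keys c \<subseteq> L n}"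
  defines "Z \<equiv> \<lambda>n. {c \<in> C n. D n c = 0}" and "B \<equiv> \<lambda>n. D (Suc n) ` C (Suc n)"
  assumes fin: "\<And>n. finite (L n)" and top: "\<And>n. n \<ge> N \<Longrightarrow> L n = {}"
    and D_add: "\<And>n x y. D n (x + y) = D n x + D n y" and D_in: "\<And>n c. c \<in> C (Suc n) \<Longrightarrow> D (Suc n) c \<in> C n"
    and D0: "\<And>c. D 0 c = 0" and DD: "\<And>n c. c \<in> C (Suc n) \<Longrightarrow> D n (D (Suc n) c) = 0"
    and \<phi>_add: "\<And>x y. \<phi> (x + y) = \<phi> x + \<phi> y" and \<phi>_in: "\<And>n c. c \<in> C n \<Longrightarrow> \<phi> c \<in> C n"
    and \<phi>_D: "\<And>n c. c \<in> C n \<Longrightarrow> D n (\<phi> c) = \<phi> (D n c)"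
    and diag: "\<And>n l. l \<in> L n \<Longrightarrow> Poly_Mapping.lookup (\<phi> (frag_of l)) l = 0"
  obtains ps where "\<And>n. dual_system (Z n) (B n) (ps n)" "\<And>n. n \<ge> N \<Longrightarrow> system_trace (ps n) \<phi> = 0"
    "(\<Sum>n\<le>N. (- 1) ^ n * system_trace (ps n) \<phi>) = 0"
proof -
  have C: "frag_subgroup (C n)" for n
    using keys_diff by (intro frag_subgroupI) (fastforce simp: C_def)+
  have D_0: "D n 0 = 0" for n using D_add[of n 0 0] by simp
  have D_diff: "D n (x - y) = D n x - D n y" for n x y using D_add[of n "x - y" y] by simp
  have \<phi>_0: "\<phi> 0 = 0" using \<phi>_add[of 0 0] by simp
  have Z: "frag_subgroup (Z n)" for n
    using frag_module.subspace_0[OF C] frag_module.subspace_diff[OF C] D_diff D_0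
    by (intro frag_subgroupI) (auto simp: Z_def)
  have B: "frag_subgroup (B n)" for n
  proof (rule frag_subgroupI)
    show "0 \<in> B n" using frag_module.subspace_0[OF C, of "Suc n"] D_0[of "Suc n"] unfolding B_def by force
    show "a - b \<in> B n" if "a \<in> B n" "b \<in> B n" for a b
      using that frag_module.subspace_diff[OF C, of _ "Suc n"] D_diff[of "Suc n"] unfolding B_def
          by (force simp flip: D_diff)
  qed
  have BZ: "B n \<subseteq> Z n" for n using D_in DD by (auto simp: B_def Z_def)
  have ZC: "Z n \<subseteq> C n" for n by (auto simp: Z_def)
  have fg: "\<exists>G. finite G \<and> A = frag_span G" if "frag_subgroup A" "A \<subseteq> C n" for A n
    using finitely_generated_subgroup[OF fin[of n] that(1)] that(2) by (auto simp: C_def)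
  have ex: "\<exists>ps. dual_system A A' ps" if A: "frag_subgroup A" "A \<subseteq> C n" and A': "frag_subgroup A'"
      "A' \<subseteq> A" for A A' n
  proof -
    obtain G where G: "finite G" "A = frag_span G" using fg[OF A] by blast
    have "frag_span (A' \<union> G) = A"
    proof
      show "frag_span (A' \<union> G) \<subseteq> A" using A' G
          by (intro frag_module.span_minimal) (auto intro: frag_module.span_base)
      show "A \<subseteq> frag_span (A' \<union> G)" unfolding G(2) by (intro frag_module.span_mono) auto
    qed
    then show ?thesis using dual_system_exists[OF A'(1) G(1)] by simp
  qed
  have zero: "frag_subgroup {0}" by (rule frag_module.subspace_single_0)
  have BC: "B n \<subseteq> C n" for n using BZ ZC by blast
  obtain ps where ps: "\<And>n. dual_system (Z n) (B n) (ps n)"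
    using ex[OF Z ZC B BZ] by metis
  obtain bs where bs: "\<And>n. dual_system (B n) {0} (bs n)"
    using ex[OF B BC zero] frag_module.subspace_0[OF B] by (metis singletonD subsetI)
  define h where "h n = system_trace (ps n) \<phi>" for n
  define b where "b n = system_trace (bs n) \<phi>" for n
  have \<phi>Z: "\<phi> z \<in> Z n" if "z \<in> Z n" for z n
    using that \<phi>_in \<phi>_D \<phi>_0 by (auto simp: Z_def)
  have \<phi>B: "\<phi> z \<in> B n" if "z \<in> B n" for z n
    using that \<phi>_in \<phi>_D by (force simp: B_def)
  have triv: "system_trace qs \<phi> = 0" if qs: "dual_system A A' qs" "A \<subseteq> C n" "n \<ge> N"
      "frag_subgroup A" for qs A A' n
  proof -
    have "C n = {0}" using top[OF qs(3)] by (auto simp: C_def)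
    then have A: "A \<subseteq> {0}" using qs(2) by simp
    have "\<xi> (\<phi> x) = 0" if x: "(x, \<xi>) \<in> set qs" for x \<xi>
    proof -
      have "x = 0" using A dual_systemD(1)[OF qs(1) x] by auto
      then show ?thesis using \<phi>_0 additive_on_0[OF dual_systemD(2)[OF qs(1) x] qs(4)] by simp
    qed
    then have "system_trace qs \<phi> = (\<Sum>q\<leftarrow>qs. 0)"
      unfolding system_trace_def by (intro arg_cong[where f=sum_list] map_cong refl) auto
    then show ?thesis by simp
  qed
  have endo: "quotient_endo (Z n) (B n) \<phi>" "quotient_endo (B n) {0} \<phi>" "quotient_endo (C n) (Z n) \<phi>"
    "quotient_endo (Z n) {0} \<phi>" "quotient_endo (C n) {0} \<phi>" for n
    using \<phi>Z \<phi>B \<phi>_in \<phi>_add \<phi>_0 Z B C zero by (auto intro!: quotient_endo_additiveI)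
  have total: "h n + b n + system_trace qs \<phi> = 0" if qs: "dual_system (C n) (Z n) qs" for n qs
  proof -
    obtain G where G: "finite G" "Z n = frag_span G" using fg[OF Z ZC] by blast
    obtain G' where G': "finite G'" "C n = frag_span G'" using fg[OF C] by blast
    have zB: "{0} \<subseteq> B n" and zZ: "{0} \<subseteq> Z n" using frag_module.subspace_0 B Z by auto
    have gZ: "Z n \<subseteq> frag_span (B n \<union> G)" unfolding G(2) by (intro frag_module.span_mono) auto
    obtain zs where zs: "dual_system (Z n) {0} zs"
      "\<And>\<phi>. quotient_endo (B n) {0} \<phi> \<Longrightarrow> quotient_endo (Z n) (B n) \<phi> \<Longrightarrow>
        system_trace zs \<phi> = system_trace (bs n) \<phi> + system_trace (ps n) \<phi>"
      by (rule dual_system_extension[OF zero B Z zB BZ gZ G(1) bs ps], rule that, assumption, blast)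
    have gC: "C n \<subseteq> frag_span (Z n \<union> G')" unfolding G'(2) by (intro frag_module.span_mono) auto
    obtain cs where cs: "dual_system (C n) {0} cs"
      "\<And>\<phi>. quotient_endo (Z n) {0} \<phi> \<Longrightarrow> quotient_endo (C n) (Z n) \<phi> \<Longrightarrow>
        system_trace cs \<phi> = system_trace zs \<phi> + system_trace qs \<phi>"
      by (rule dual_system_extension[OF zero Z C zZ ZC gC G'(1) zs(1) qs], rule that, assumption, blast)
    obtain ds where ds: "dual_system {c. Poly_Mapping.keys c \<subseteq> L n} {0} ds"
      "\<And>\<phi>. system_trace ds \<phi> = (\<Sum>l\<in>L n. of_int (Poly_Mapping.lookup (\<phi> (frag_of l)) l))"
      by (rule dual_system_free[OF fin[of n]], rule that, assumption, blast)
    have ds': "dual_system (C n) {0} ds" using ds(1) unfolding C_def .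
    have "system_trace ds \<phi> = 0" using ds(2) diag by simp
    moreover have "system_trace cs \<phi> = system_trace ds \<phi>"
      using system_trace_unique[OF C _ endo(5) cs(1) ds'] frag_module.subspace_0[OF C] by simp
    ultimately show ?thesis using cs(2)[OF endo(4,3)] zs(2)[OF endo(2,1)] by (simp add: h_def b_def)
  qed
  \<comment> \<open>In degree \<open>0\<close> every chain is a cycle; the trivial quotient
    \<open>C 0 / Z 0\<close> has the empty dual system.\<close>
  have h0: "h 0 = - b 0"
  proof -
    have "Z 0 = C 0" using D0 by (auto simp: Z_def)
    then have "dual_system (C 0) (Z 0) []" by (auto simp: dual_system_def)
    then show ?thesis using total[of 0 "[]"] by (simp add: system_trace_def)
  qed
  have hSuc: "h (Suc n) = - b (Suc n) - b n" for n
  proof -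
    obtain qs where qs: "dual_system (C (Suc n)) {z \<in> C (Suc n). D (Suc n) z = 0} qs"
      "\<And>\<phi>. (\<And>c. c \<in> C (Suc n) \<Longrightarrow> \<phi> c \<in> C (Suc n)) \<Longrightarrow> (\<And>c. c \<in> C (Suc n) \<Longrightarrow> D (Suc n) (\<phi> c) = \<phi> (D (Suc n) c))
        \<Longrightarrow> system_trace qs \<phi> = system_trace (bs n) \<phi>"
      by (rule dual_system_image[OF C D_add bs[of n, unfolded B_def]], rule that, assumption, blast)
    have "system_trace qs \<phi> = b n" unfolding b_def by (rule qs(2)) (fact \<phi>_in \<phi>_D)+
    then show ?thesis using total[of "Suc n" qs] qs(1) unfolding Z_def by simp
  qed
  \<comment> \<open>Only the last boundary term survives the telescoping, and it is zero for
    \<open>m = N\<close> because there are no simplices in that degree.\<close>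
  have "(\<Sum>n\<le>m. (- 1) ^ n * h n) = - ((- 1) ^ m * b m)" for m
    by (induction m) (simp_all add: h0 hSuc algebra_simps)
  moreover have "b N = 0" unfolding b_def using triv[OF bs BC _ B] by blast
  ultimately have "(\<Sum>n\<le>N. (- 1) ^ n * system_trace (ps n) \<phi>) = 0" by (simp add: h_def)
  moreover have "system_trace (ps n) \<phi> = 0" if "n \<ge> N" for n using triv[OF ps ZC that Z] .
  ultimately show ?thesis using that ps by blast
qed

section \<open>Simplicial chains and acyclic carriers\<close>

lemma frag_extend_additive:
  assumes "\<And>x y. D (x - y) = D x - D y"
  shows "D (frag_extend f c) = frag_extend (\<lambda>l. D (f l)) c"
proof -
  have "D 0 = 0" using assms[of 0 0] by simp
  moreover have "Poly_Mapping.keys c \<subseteq> UNIV" by simp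
  then show ?thesis
    by (induction c rule: frag_induction) (use calculation in \<open>auto simp: frag_extend_diff assms\<close>)
qed

lemma frag_cmul_additive:
  assumes "\<And>x y. D (x - y) = D x - D y"
  shows "D (frag_cmul k x) = frag_cmul k (D x)"
  using frag_extend_additive[of D "\<lambda>_. x" "frag_cmul k (frag_of ())", OF assms]
  by (simp add: frag_extend_cmul)

lemma frag_extend_in_subgroup:
  assumes "frag_subgroup A" "\<And>l. l \<in> Poly_Mapping.keys c \<Longrightarrow> f l \<in> A"
  shows "frag_extend f c \<in> A"
  unfolding frag_extend_def
  using assms frag_module.subspace_scale by (intro frag_module.subspace_sum) blast+

lemma frag_subgroup_keys: "frag_subgroup {c. Poly_Mapping.keys c \<subseteq> S}"
  using keys_diff by (intro frag_subgroupI) fastforce+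

lemma frag_extend_minus_fun:
  "frag_extend (\<lambda>l. f l - g l) c = frag_extend f c - frag_extend g c"
  using subset_UNIV by (induction c rule: frag_induction) (auto simp: frag_extend_diff)

text \<open>The usual alternating sum of faces, in the recursive form that makes cone arguments
  immediate. The face of a one-element list is the empty list, so the complex is augmented and a
  list of length \<open>n\<close> has dimension \<open>n - 1\<close>.\<close>

fun face_sum :: "'a list \<Rightarrow> 'a list \<Rightarrow>\<^sub>0 int" where
  "face_sum [] = 0"
| "face_sum (x # xs) = frag_of xs - frag_extend (\<lambda>l. frag_of (x # l)) (face_sum xs)"

definition list_boundary :: "('a list \<Rightarrow>\<^sub>0 int) \<Rightarrow> ('a list \<Rightarrow>\<^sub>0 int)"
  where "list_boundary = frag_extend face_sum"

lemma list_boundary_simps [simp]: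
  "list_boundary 0 = 0" "list_boundary (frag_of l) = face_sum l"
  "list_boundary (a + b) = list_boundary a + list_boundary b"
  "list_boundary (a - b) = list_boundary a - list_boundary b"
  "list_boundary (- a) = - list_boundary a"
  "list_boundary (frag_cmul k a) = frag_cmul k (list_boundary a)"
  by (simp_all add: list_boundary_def frag_extend_add frag_extend_diff frag_extend_cmul frag_extend_minus)

text \<open>Coning with \<open>x\<close> contracts the complex of all lists; that the boundary
  squares to zero follows from this by induction.\<close>

lemma list_boundary_cons:
  "list_boundary (frag_extend (\<lambda>l. frag_of (x # l)) c)
      = c - frag_extend (\<lambda>l. frag_of (x # l)) (list_boundary c)"
  using subset_UNIV by (induction c rule: frag_induction) (auto simp: frag_extend_diff)

lemma list_boundary_face_sum [simp]: "list_boundary (face_sum l) = 0"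
  by (induction l) (auto simp: list_boundary_cons)

lemma list_boundary_list_boundary [simp]: "list_boundary (list_boundary c) = 0"
  using subset_UNIV by (induction c rule: frag_induction) auto

lemma keys_face_sum:
  assumes "l' \<in> Poly_Mapping.keys (face_sum l)"
  shows "Suc (length l') = length l" "set l' \<subseteq> set l" "sorted_wrt R l \<Longrightarrow> sorted_wrt R l'"
proof -
  have "Suc (length l') = length l \<and> set l' \<subseteq> set l \<and> (sorted_wrt R l \<longrightarrow> sorted_wrt R l')"
    using assms
  proof (induction l arbitrary: l')
    case (Cons x xs)
    have "l' = xs \<or> (\<exists>k\<in>Poly_Mapping.keys (face_sum xs). l' = x # k)"
      using Cons.prems keys_diff[of "frag_of xs" "frag_extend (\<lambda>l. frag_of (x # l)) (face_sum xs)"]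
        keys_frag_extend[of "\<lambda>l. frag_of (x # l)" "face_sum xs"] by auto
    then show ?case using Cons.IH by fastforce
  qed simp
  then show "Suc (length l') = length l" "set l' \<subseteq> set l" "sorted_wrt R l \<Longrightarrow> sorted_wrt R l'" by auto
qed

text \<open>The cone formula with the apex at the end: deleting the last vertex carries the sign of
  its position.\<close>

lemma face_sum_snoc:
  "face_sum (l @ [x]) = frag_extend (\<lambda>l. frag_of (l @ [x])) (face_sum l) + frag_cmul ((- 1) ^
      length l) (frag_of l)"
proof (induction l)
  case (Cons y l)
  have "frag_extend (\<lambda>l. frag_of (y # l)) (frag_extend (\<lambda>l. frag_of (l @ [x])) (face_sum l))
      = frag_extend (\<lambda>l. frag_of (l @ [x])) (frag_extend (\<lambda>l. frag_of (y # l)) (face_sum l))"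
    by (simp add: frag_extend_compose[unfolded comp_def])
  then show ?case
    by (simp add: Cons.IH frag_extend_add frag_extend_diff frag_extend_cmul algebra_simps
        flip: frag_cmul_distrib)
qed simp

text \<open>For a strict order each finite chain has exactly one such list, so no orientations have
  to be chosen. The length, not the dimension, is the degree.\<close>

definition chain_lists :: "('a \<Rightarrow> 'a \<Rightarrow> bool) \<Rightarrow> 'a set \<Rightarrow> nat \<Rightarrow> 'a list set"
  where "chain_lists R A n = {l. sorted_wrt R l \<and> set l \<subseteq> A \<and> length l = n}"

definition list_chains :: "('a \<Rightarrow> 'a \<Rightarrow> bool) \<Rightarrow> 'a set \<Rightarrow> nat \<Rightarrow> ('a list \<Rightarrow>\<^sub>0 int) set"
  where "list_chains R A n = {c. Poly_Mapping.keys c \<subseteq> chain_lists R A n}"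

lemma frag_subgroup_list_chains: "frag_subgroup (list_chains R A n)"
  unfolding list_chains_def by (rule frag_subgroup_keys)

lemma frag_of_in_list_chains [simp]: "frag_of l \<in> list_chains R A n \<longleftrightarrow> l \<in> chain_lists R A n"
  by (simp add: list_chains_def)

lemma list_chains_mono: "A \<subseteq> B \<Longrightarrow> list_chains R A n \<subseteq> list_chains R B n"
  by (auto simp: list_chains_def chain_lists_def)

lemma face_sum_in_list_chains: "l \<in> chain_lists R A (Suc n) \<Longrightarrow> face_sum l \<in> list_chains R A n"
  using keys_face_sum(1)[of _ l] keys_face_sum(2)[of _ l] keys_face_sum(3)[of _ l R]
      by (fastforce simp: list_chains_def chain_lists_def)

lemma list_boundary_in_list_chains:
  "c \<in> list_chains R A (Suc n) \<Longrightarrow> list_boundary c \<in> list_chains R A n"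
  unfolding list_boundary_def
  by (rule frag_extend_in_subgroup[OF frag_subgroup_list_chains face_sum_in_list_chains]) (auto
      simp: list_chains_def)

lemma list_chains_0: "c \<in> list_chains R A 0 \<Longrightarrow> c = frag_cmul (Poly_Mapping.lookup c []) (frag_of [])"
  by (intro poly_mapping_eqI) (auto simp: list_chains_def chain_lists_def lookup_single in_keys_iff when_def)

lemma list_boundary_0_degree: "c \<in> list_chains R A 0 \<Longrightarrow> list_boundary c = 0"
  by (subst list_chains_0) auto

text \<open>Degree \<open>0\<close> is included: the empty list has to bound, which forces
  \<open>A\<close> to be nonempty.\<close>

definition list_acyclic :: "('a \<Rightarrow> 'a \<Rightarrow> bool) \<Rightarrow> 'a set \<Rightarrow> bool"
  where "list_acyclic R A \<longleftrightarrow>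
    (\<forall>n. \<forall>c\<in>list_chains R A n. list_boundary c = 0 \<longrightarrow> (\<exists>d\<in>list_chains R A (Suc n). list_boundary d = c))"

text \<open>The complex is a cone with apex \<open>x\<close>: prepending \<open>x\<close> where it
  is missing, and zero otherwise, is a contracting homotopy.\<close>

lemma list_acyclic_top:
  assumes x: "x \<in> A" and top: "\<And>y. y \<in> A \<Longrightarrow> y \<noteq> x \<Longrightarrow> R x y" and asym: "\<And>y z. y \<in> A \<Longrightarrow> z \<in> A \<Longrightarrow> R y z \<Longrightarrow> \<not> R z y"
  shows "list_acyclic R A"
  unfolding list_acyclic_def
proof (intro allI ballI impI)
  fix n c assume c: "c \<in> list_chains R A n" "list_boundary c = 0"
  define h where "h l = (if x \<in> set l then 0 else frag_of (x # l))" for l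
  have h_in: "h l \<in> list_chains R A (Suc n)" if "l \<in> chain_lists R A n" for l
    using that x top frag_module.subspace_0[OF frag_subgroup_list_chains]
    by (auto simp: h_def chain_lists_def intro!: top)
  \<comment> \<open>If \<open>x\<close> occurs in \<open>l\<close> it is the head. Then
    \<open>h l = 0\<close>, and the only face without \<open>x\<close> is the tail, which
    \<open>h\<close> sends back to \<open>l\<close>.\<close>
  have homotopy: "list_boundary (h l) + frag_extend h (face_sum l) = frag_of l"
      if l: "l \<in> chain_lists R A n" for l
  proof (cases "x \<in> set l")
    case True
    then obtain xs where xs: "l = x # xs"
    proof (cases l)
      case (Cons y ys)
      have "y = x"
      proof (rule ccontr)
        assume "y \<noteq> x"
        then have "x \<in> set ys" using True Cons by auto
        then have "R y x" using l Cons by (auto simp: chain_lists_def)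
        moreover have "R x y" using l Cons top \<open>y \<noteq> x\<close> by (auto simp: chain_lists_def)
        ultimately show False using asym[of y x] l Cons x by (auto simp: chain_lists_def)
      qed
      then show ?thesis using that Cons by blast
    qed (use True in simp)
    have nx: "x \<notin> set xs"
    proof
      assume "x \<in> set xs"
      then have "R x x" using l xs by (auto simp: chain_lists_def)
      then show False using asym[OF x x] by blast
    qed
    have "frag_extend h (frag_extend (\<lambda>l. frag_of (x # l)) (face_sum xs))
        = frag_extend (\<lambda>l. h (x # l)) (face_sum xs)"
      by (subst frag_extend_additive[of "frag_extend h"]) (simp_all add: frag_extend_diff)
    also have "\<dots> = 0" by (rule frag_extend_eq_0) (simp add: h_def)
    finally show ?thesis using nx by (simp add: xs h_def frag_extend_diff)
  next
    case False
    have "frag_extend h (face_sum l) = frag_extend (\<lambda>l. frag_of (x # l)) (face_sum l)"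
      using keys_face_sum(2)[of _ l] False by (intro frag_extend_eq) (auto simp: h_def)
    then show ?thesis using False by (simp add: h_def)
  qed
  have keys: "l \<in> chain_lists R A n" if "l \<in> Poly_Mapping.keys c" for l using that c
      by (auto simp: list_chains_def)
  show "\<exists>d\<in>list_chains R A (Suc n). list_boundary d = c"
  proof
    show "frag_extend h c \<in> list_chains R A (Suc n)"
      by (rule frag_extend_in_subgroup[OF frag_subgroup_list_chains h_in[OF keys]])
    have "list_boundary (frag_extend h c) = frag_extend (\<lambda>l. list_boundary (h l)) c"
      by (rule frag_extend_additive) simp
    also have "\<dots> = frag_extend (\<lambda>l. frag_of l - frag_extend h (face_sum l)) c"
      using homotopy keys by (intro frag_extend_eq) (simp add: eq_diff_eq)
    also have "\<dots> = c - frag_extend h (list_boundary c)"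
      using frag_extend_additive[of "frag_extend h" face_sum c]
      by (simp add: frag_extend_minus_fun frag_extend_diff list_boundary_def flip: frag_expansion)
    finally show "list_boundary (frag_extend h c) = c" using c(2) by simp
  qed
qed

text \<open>Here the apex is appended. The sign attached to the last vertex makes the homotopy a
  contraction only up to \<open>(-1)^n\<close>.\<close>

lemma list_acyclic_bottom:
  assumes x: "x \<in> A" and bot: "\<And>y. y \<in> A \<Longrightarrow> y \<noteq> x \<Longrightarrow> R y x" and asym: "\<And>y z. y \<in> A \<Longrightarrow> z \<in> A \<Longrightarrow> R y z \<Longrightarrow> \<not> R z y"
  shows "list_acyclic R A"
  unfolding list_acyclic_def
proof (intro allI ballI impI)
  fix n c assume c: "c \<in> list_chains R A n" "list_boundary c = 0"
  define h where "h l = (if x \<in> set l then 0 else frag_of (l @ [x]))" for l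
  have h_in: "h l \<in> list_chains R A (Suc n)" if "l \<in> chain_lists R A n" for l
    using that x frag_module.subspace_0[OF frag_subgroup_list_chains]
    by (auto simp: h_def chain_lists_def sorted_wrt_append intro!: bot)
  have homotopy: "list_boundary (h l) - frag_extend h (face_sum l) = frag_cmul ((- 1) ^ n) (frag_of l)"
    if l: "l \<in> chain_lists R A n" for l
  proof (cases "x \<in> set l")
    case True
    then obtain xs where xs: "l = xs @ [x]"
    proof (cases l rule: rev_cases)
      case (snoc ys y)
      have "y = x"
      proof (rule ccontr)
        assume "y \<noteq> x"
        then have "x \<in> set ys" using True snoc by auto
        then have "R x y" using l snoc by (auto simp: chain_lists_def sorted_wrt_append)
        moreover have "R y x" using l snoc bot \<open>y \<noteq> x\<close> by (auto simp: chain_lists_def)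
        ultimately show False using asym[of y x] l snoc x by (auto simp: chain_lists_def)
      qed
      then show ?thesis using that snoc by blast
    qed (use True in simp)
    have nx: "x \<notin> set xs"
    proof
      assume "x \<in> set xs"
      then have "R x x" using l xs by (auto simp: chain_lists_def sorted_wrt_append)
      then show False using asym[OF x x] by blast
    qed
    have "frag_extend h (frag_extend (\<lambda>l. frag_of (l @ [x])) (face_sum xs))
        = frag_extend (\<lambda>l. h (l @ [x])) (face_sum xs)"
      by (subst frag_extend_additive[of "frag_extend h"]) (simp_all add: frag_extend_diff)
    also have "\<dots> = 0" by (rule frag_extend_eq_0) (simp add: h_def)
    finally have "frag_extend h (face_sum l) = frag_cmul ((- 1) ^ length xs) (frag_of l)"
      using nx by (simp add: xs face_sum_snoc frag_extend_add frag_extend_cmul h_def)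
    moreover have "n = Suc (length xs)" using l xs by (simp add: chain_lists_def)
    ultimately show ?thesis using True by (simp add: h_def)
  next
    case False
    have "frag_extend h (face_sum l) = frag_extend (\<lambda>l. frag_of (l @ [x])) (face_sum l)"
      using keys_face_sum(2)[of _ l] False by (intro frag_extend_eq) (auto simp: h_def)
    then show ?thesis using False l by (simp add: h_def face_sum_snoc chain_lists_def)
  qed
  have keys: "l \<in> chain_lists R A n" if "l \<in> Poly_Mapping.keys c" for l using that c
      by (auto simp: list_chains_def)
  show "\<exists>d\<in>list_chains R A (Suc n). list_boundary d = c"
  proof
    \<comment> \<open>Multiplying the filler by the same sign removes it, since its square is
      \<open>1\<close>.\<close>
    show "frag_cmul ((- 1) ^ n) (frag_extend h c) \<in> list_chains R A (Suc n)"
      by (rule frag_module.subspace_scale[OF frag_subgroup_list_chains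
            frag_extend_in_subgroup[OF frag_subgroup_list_chains h_in[OF keys]]])
    have "list_boundary (frag_extend h c) = frag_extend (\<lambda>l. list_boundary (h l)) c"
      by (rule frag_extend_additive) simp
    also have "\<dots> = frag_extend (\<lambda>l. frag_cmul ((- 1) ^ n) (frag_of l) - (0 - frag_extend h (face_sum l))) c"
      using homotopy keys by (intro frag_extend_eq) (simp add: diff_eq_eq)
    also have "\<dots> = frag_extend (\<lambda>l. frag_cmul ((- 1) ^ n) (frag_of l)) c - frag_extend (\<lambda>l. 0 -
        frag_extend h (face_sum l)) c"
      by (rule frag_extend_minus_fun)
    also have "frag_extend (\<lambda>l. 0 - frag_extend h (face_sum l)) c = 0 - frag_extend h (list_boundary c)"
      using frag_extend_additive[of "\<lambda>c. 0 - frag_extend h c" face_sum c]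
      by (simp add: frag_extend_diff list_boundary_def)
    also have "frag_extend (\<lambda>l. frag_cmul ((- 1) ^ n) (frag_of l)) c = frag_cmul ((- 1) ^ n) c"
      using frag_extend_additive[of "frag_cmul ((- 1) ^ n)" frag_of c]
      by (simp add: frag_module.scale_right_diff_distrib flip: frag_expansion)
    finally show "list_boundary (frag_cmul ((- 1) ^ n) (frag_extend h c)) = c"
      using c(2) by (simp flip: power_mult_distrib)
  qed
qed

text \<open>Chain maps are the case \<open>k = 0\<close>, \<open>g = 0\<close>, \<open>s = -1\<close>; chain homotopies are the case
  \<open>k = 1\<close>, \<open>s = 1\<close>, with \<open>g\<close> the difference of two chain maps.\<close>
lemma acyclic_carrier_lift:
  fixes S :: "'a list \<Rightarrow> nat \<Rightarrow> ('k \<Rightarrow>\<^sub>0 int) set" and D :: "nat \<Rightarrow> ('k \<Rightarrow>\<^sub>0 int) \<Rightarrow> ('k \<Rightarrow>\<^sub>0 int)"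
  assumes sub: "\<And>l n. frag_subgroup (S l n)" and D: "\<And>n x y. D n (x - y) = D n x - D n y"
    and mono: "\<And>l l' n. l \<in> L \<Longrightarrow> l' \<in> Poly_Mapping.keys (face_sum l) \<Longrightarrow> S l' n \<subseteq> S l n"
    and closed: "\<And>l. l \<in> L \<Longrightarrow> Poly_Mapping.keys (face_sum l) \<subseteq> L"
    and acyclic: "\<And>l n c. l \<in> L \<Longrightarrow> l \<noteq> [] \<Longrightarrow> c \<in> S l n \<Longrightarrow> D n c = 0 \<Longrightarrow> \<exists>t\<in>S l (Suc n). D (Suc n) t = c"
    and h0: "h0 \<in> S [] k" "D k h0 = g []"
    and g: "\<And>l m. l \<in> L \<Longrightarrow> length l = Suc m \<Longrightarrow> g l \<in> S l (m + k) \<and>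
        D (m + k) (g l) = frag_cmul s (frag_extend g (face_sum l))"
  obtains H where "H [] = h0" "\<And>l. l \<in> L \<Longrightarrow> H l \<in> S l (length l + k)"
    "\<And>l. l \<in> L \<Longrightarrow> D (length l + k) (H l) = g l - frag_cmul s (frag_extend H (face_sum l))"
proof -
  \<comment> \<open>Recursion on the length: the values on the faces are known, and each new value
    is some filler of the cycle that they prescribe.\<close>
  define HH where "HH = rec_nat (\<lambda>_. h0) (\<lambda>m f l. SOME t. t \<in> S l (Suc m + k) \<and>
    D (Suc m + k) t = g l - frag_cmul s (frag_extend f (face_sum l)))"
  define H where "H l = HH (length l) l" for l
  have HH: "frag_extend H (face_sum l) = frag_extend (HH m) (face_sum l)" if "length l = Suc m" for l m
    using keys_face_sum(1)[of _ l] that by (intro frag_extend_eq) (auto simp: H_def)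
  have "H l \<in> S l (length l + k) \<and> D (length l + k) (H l) = g l - frag_cmul s (frag_extend H (face_sum l))"
    if "l \<in> L" "length l = m" for l m
    using that
  proof (induction m arbitrary: l)
    case 0
    then show ?case using h0 by (simp add: H_def HH_def)
  next
    case (Suc m)
    have face: "l' \<in> L" "length l' = m" "S l' n \<subseteq> S l n" if "l' \<in> Poly_Mapping.keys (face_sum l)" for l' n
      using that closed[OF Suc.prems(1)] keys_face_sum(1)[OF that] Suc.prems mono by auto
    let ?w = "g l - frag_cmul s (frag_extend H (face_sum l))"
    have g_l: "g l \<in> S l (m + k)" "D (m + k) (g l) = frag_cmul s (frag_extend g (face_sum l))"
      using g[OF Suc.prems] by auto
    have "frag_extend H (face_sum l) \<in> S l (m + k)"
      using Suc.IH[OF face(1,2)] face(2,3) by (intro frag_extend_in_subgroup[OF sub]) blast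
    then have w: "?w \<in> S l (m + k)"
      using g_l(1) frag_module.subspace_scale[OF sub] frag_module.subspace_diff[OF sub] by blast
    have "D (m + k) (frag_extend H (face_sum l)) = frag_extend (\<lambda>l. D (m + k) (H l)) (face_sum l)"
      by (rule frag_extend_additive) (rule D)
    also have "\<dots> = frag_extend (\<lambda>l'. g l' - frag_cmul s (frag_extend H (face_sum l'))) (face_sum l)"
      using Suc.IH[OF face(1,2)] face(2) by (intro frag_extend_eq) force
    also have "\<dots> = frag_extend g (face_sum l) - frag_extend (\<lambda>l'. frag_cmul s (frag_extend H (face_sum
        l'))) (face_sum l)"
      by (rule frag_extend_minus_fun)
    also have "frag_extend (\<lambda>l'. frag_cmul s (frag_extend H (face_sum l'))) (face_sum l)
        = frag_cmul s (frag_extend H (list_boundary (face_sum l)))"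
      unfolding list_boundary_def
      by (rule frag_extend_additive[symmetric]) (simp add: frag_extend_diff list_boundary_def[symmetric]
          frag_module.scale_right_diff_distrib)
    finally have DH: "D (m + k) (frag_extend H (face_sum l)) = frag_extend g (face_sum l)" by simp
    note D_cmul = frag_cmul_additive[of "D _", OF D]
    \<comment> \<open>Both terms of \<open>?w\<close> have boundary \<open>s\<close> times
      \<open>g\<close> of the faces of \<open>l\<close>; the correction in the boundary of
      \<open>H\<close> drops out because the boundary squares to zero.\<close>
    have "D (m + k) ?w = 0" by (simp add: D D_cmul g_l(2) DH)
    then have ex: "\<exists>t. t \<in> S l (Suc m + k) \<and> D (Suc m + k) t = ?w"
      using acyclic[OF Suc.prems(1) _ w] Suc.prems(2) by (cases "l = []") auto
    have "H l = (SOME t. t \<in> S l (Suc m + k) \<and> D (Suc m + k) t = ?w)"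
      unfolding HH[OF Suc.prems(2)] by (simp add: H_def HH_def Suc.prems(2))
    then show ?case using someI_ex[OF ex] Suc.prems(2) by simp
  qed
  moreover have "H [] = h0" by (simp add: H_def HH_def)
  ultimately show ?thesis using that by blast
qed

section \<open>The augmented singular complex\<close>

text \<open>Degrees are shifted by one: degree \<open>0\<close> is the augmentation module, freely generated by
  \<open>aug_unit\<close>, and degree \<open>Suc n\<close> consists of the singular \<open>n\<close>-chains.\<close>
definition aug_unit :: "'a chain"
  where "aug_unit = frag_of undefined"

definition aug_chains :: "'a topology \<Rightarrow> nat \<Rightarrow> 'a chain set"
  where "aug_chains X n = (case n of 0 \<Rightarrow> range (\<lambda>k. frag_cmul k aug_unit) | Suc m \<Rightarrow> singular_chain_set m X)"

definition aug_boundary :: "nat \<Rightarrow> 'a chain \<Rightarrow> 'a chain"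
  where "aug_boundary n c =
    (case n of 0 \<Rightarrow> 0 | Suc m \<Rightarrow> if m = 0 then frag_extend (\<lambda>_. aug_unit) c else chain_boundary m c)"

text \<open>Degree \<open>0\<close> needs its own clause: the units of the two spaces are generated
  by \<open>undefined\<close> at different types.\<close>

definition aug_map :: "nat \<Rightarrow> ('a \<Rightarrow> 'b) \<Rightarrow> 'a chain \<Rightarrow> 'b chain"
  where "aug_map n f c = (case n of 0 \<Rightarrow> frag_extend (\<lambda>_. aug_unit) c | Suc m \<Rightarrow> chain_map m f c)"

lemma aug_chains_simps [simp]:
  "aug_chains X 0 = range (\<lambda>k. frag_cmul k aug_unit)" "aug_chains X (Suc m) = singular_chain_set m X"
  by (simp_all add: aug_chains_def)

lemma aug_unit_in [simp]: "aug_unit \<in> aug_chains X 0"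
  by (auto intro: range_eqI[of _ _ 1])

lemma frag_subgroup_aug_chains: "frag_subgroup (aug_chains X n)"
proof (cases n)
  case 0
  show ?thesis unfolding 0 aug_chains_simps
  proof (rule frag_subgroupI)
    show "0 \<in> range (\<lambda>k. frag_cmul k aug_unit)" by (rule range_eqI[of _ _ 0]) simp
    fix a b :: "'a chain" assume "a \<in> range (\<lambda>k. frag_cmul k aug_unit)" "b \<in> range (\<lambda>k. frag_cmul k aug_unit)"
    then obtain k l where "a = frag_cmul k aug_unit" "b = frag_cmul l aug_unit" by blast
    then have "a - b = frag_cmul (k - l) aug_unit" by (simp only: frag_cmul_diff_distrib)
    then show "a - b \<in> range (\<lambda>k. frag_cmul k aug_unit)" by blast
  qed
next
  case (Suc m)
  then show ?thesis by (auto intro!: frag_subgroupI singular_chain_diff)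
qed

lemma aug_chains_mono: "S \<subseteq> T \<Longrightarrow> aug_chains (subtopology X S) n \<subseteq> aug_chains (subtopology X T) n"
  by (cases n) (auto intro: singular_chain_mono)

lemma aug_chains_subtopology: "aug_chains (subtopology X S) n \<subseteq> aug_chains X n"
  by (cases n) (auto simp: singular_chain_subtopology)

lemma aug_boundary_0 [simp]: "aug_boundary 0 c = 0"
  by (simp add: aug_boundary_def)

lemma aug_boundary_zero [simp]: "aug_boundary n 0 = 0"
  by (auto simp: aug_boundary_def split: nat.split)

lemma aug_boundary_diff: "aug_boundary n (a - b) = aug_boundary n a - aug_boundary n b"
  by (auto simp: aug_boundary_def frag_extend_diff chain_boundary_diff split: nat.split)

lemma aug_boundary_add: "aug_boundary n (a + b) = aug_boundary n a + aug_boundary n b"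
  by (auto simp: aug_boundary_def frag_extend_add chain_boundary_add split: nat.split)

lemma aug_boundary_Suc_Suc [simp]: "aug_boundary (Suc (Suc n)) c = chain_boundary (Suc n) c"
  by (simp add: aug_boundary_def)

lemma aug_boundary_in: "c \<in> aug_chains X (Suc n) \<Longrightarrow> aug_boundary (Suc n) c \<in> aug_chains X n"
proof (cases n)
  case 0
  show ?thesis
    unfolding 0 aug_boundary_def nat.case(2) if_P[OF refl]
    by (rule frag_extend_in_subgroup[OF frag_subgroup_aug_chains aug_unit_in])
next
  case (Suc m)
  assume "c \<in> aug_chains X (Suc n)"
  then show ?thesis using Suc singular_chain_boundary_alt[of m X c] by simp
qed

lemma augmentation_boundary: "frag_extend (\<lambda>_. aug_unit) (chain_boundary (Suc 0) c) = 0"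
proof -
  have "Poly_Mapping.keys c \<subseteq> UNIV" by simp
  then show ?thesis
    by (induction c rule: frag_induction)
      (auto simp: frag_extend_diff frag_extend_add frag_extend_cmul chain_boundary_diff chain_boundary_of)
qed

lemma aug_boundary_boundary:
  assumes "c \<in> aug_chains X (Suc n)"
  shows "aug_boundary n (aug_boundary (Suc n) c) = 0"
proof (cases n)
  case (Suc m)
  then show ?thesis
  proof (cases m)
    case 0
    then show ?thesis using Suc augmentation_boundary[of c] by (simp add: aug_boundary_def)
  next
    case (Suc k)
    then show ?thesis using assms \<open>n = Suc m\<close> chain_boundary_boundary_alt[of "Suc k" X c] by simp
  qed
qed simp

lemma aug_map_diff: "aug_map n f (a - b) = aug_map n f a - aug_map n f b"
  by (auto simp: aug_map_def frag_extend_diff chain_map_diff split: nat.split)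

lemma aug_map_unit [simp]: "aug_map 0 f aug_unit = aug_unit"
  by (simp add: aug_map_def aug_unit_def)

lemma aug_map_Suc [simp]: "aug_map (Suc n) f c = chain_map n f c"
  by (simp add: aug_map_def)

lemma aug_map_in:
  assumes "c \<in> aug_chains X n" "continuous_map X Y f"
  shows "aug_map n f c \<in> aug_chains Y n"
proof (cases n)
  case 0
  show ?thesis
    unfolding 0 aug_map_def nat.case(1)
    by (rule frag_extend_in_subgroup[OF frag_subgroup_aug_chains aug_unit_in])
next
  case (Suc m)
  then show ?thesis using assms singular_chain_chain_map by auto
qed

lemma aug_boundary_map:
  assumes "c \<in> aug_chains X n"
  shows "aug_boundary n (aug_map n f c) = aug_map (n - 1) f (aug_boundary n c)"
proof (cases n)
  case 0
  then show ?thesis by (simp add: aug_map_def)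
next
  case (Suc m)
  show ?thesis
  proof (cases m)
    case 0
    have "Poly_Mapping.keys c \<subseteq> UNIV" by simp
    then have "frag_extend (\<lambda>_. aug_unit) (chain_map 0 f c)
        = frag_extend (\<lambda>_. aug_unit) (frag_extend (\<lambda>_. aug_unit) c)"
      by (induction c rule: frag_induction) (auto simp: frag_extend_diff chain_map_diff aug_unit_def)
    then show ?thesis by (simp add: Suc 0 aug_boundary_def aug_map_def)
  next
    case (Suc k)
    then show ?thesis using assms \<open>n = Suc m\<close> chain_boundary_chain_map[of m X c f] by simp
  qed
qed

text \<open>As for lists, degree \<open>0\<close> encodes nonemptiness.\<close>

definition aug_acyclic :: "'a topology \<Rightarrow> bool"
  where "aug_acyclic X \<longleftrightarrow>
    (\<forall>n. \<forall>c\<in>aug_chains X n. aug_boundary n c = 0 \<longrightarrow> (\<exists>t\<in>aug_chains X (Suc n). aug_boundary (Suc n) t = c))"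

lemma aug_acyclicD:
  "aug_acyclic X \<Longrightarrow> c \<in> aug_chains X n \<Longrightarrow> aug_boundary n c = 0 \<Longrightarrow>
      \<exists>t\<in>aug_chains X (Suc n). aug_boundary (Suc n) t = c"
  by (auto simp: aug_acyclic_def)

text \<open>A point fills the unit. For singular 0-chains, zero augmentation means vanishing in the
  homology of a point, which is how reduced homology is cut out; above that, reduced and unreduced
  homology agree.\<close>

lemma aug_acyclic_if_acyclic_space:
  assumes "acyclic_space X"
  shows "aug_acyclic X"
  unfolding aug_acyclic_def
proof (intro allI ballI impI)
  fix n c assume c: "c \<in> aug_chains X n" "aug_boundary n c = 0"
  from assms have ne: "topspace X \<noteq> {}" and triv: "\<And>p. trivial_group (reduced_homology_group p X)"
    by (auto simp: acyclic_space_def)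
  have boundary: "\<exists>t\<in>aug_chains X (Suc (Suc m)). aug_boundary (Suc (Suc m)) t = c"
    if "singular_relboundary m X {} c" for m
    using that by (auto simp: singular_boundary)
  show "\<exists>t\<in>aug_chains X (Suc n). aug_boundary (Suc n) t = c"
  proof (cases n)
    case 0
    obtain a where a: "a \<in> topspace X" using ne by blast
    obtain k where k: "c = frag_cmul k aug_unit" using c(1) 0 by auto
    define s where "s = restrict (\<lambda>_. a) (standard_simplex 0)"
    have "singular_simplex 0 X s"
      using a by (simp add: singular_simplex_def s_def)
    then have "frag_cmul k (frag_of s) \<in> aug_chains X (Suc 0)"
      by (simp add: singular_chain_cmul singular_chain_of)
    moreover have "aug_boundary (Suc 0) (frag_cmul k (frag_of s)) = c"
      by (simp add: aug_boundary_def frag_extend_cmul k)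
    ultimately show ?thesis using 0 by blast
  next
    case (Suc m)
    have cyc: "singular_relcycle m X {} c"
    proof (cases m)
      case 0
      then show ?thesis using c Suc by (simp add: singular_cycle chain_boundary_def)
    next
      case (Suc k)
      then show ?thesis using c \<open>n = Suc m\<close> by (simp add: singular_cycle)
    qed
    let ?q = "homologous_rel_set m X {} c"
    have q: "?q \<in> carrier (homology_group (int m) X)"
      using cyc by (auto simp: carrier_relative_homology_group)
    have red: "?q \<in> carrier (reduced_homology_group (int m) X)"
    proof (cases m)
      case (Suc k)
      then show ?thesis using q by (simp add: un_reduced_homology_group)
    next
      case 0
      \<comment> \<open>The push-forward to a point and the augmentation are both the coefficient
        sum of \<open>c\<close> times a fixed generator.\<close>
      have *: "chain_map 0 (\<lambda>x. ()) c = frag_cmul k (frag_of (restrict (\<lambda>x. ()) (standard_simplex 0)))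
          \<and> frag_extend (\<lambda>_. aug_unit) c = frag_cmul k (aug_unit :: 'a chain)"
        if "k = (\<Sum>i\<in>Poly_Mapping.keys c. Poly_Mapping.lookup c i)" for k
        unfolding chain_map_def frag_extend_def that
        by (auto simp: simplex_map_def comp_def frag_module.scale_sum_left)
      have "frag_extend (\<lambda>_. aug_unit) c = (0 :: 'a chain)"
        using c(2) \<open>n = Suc m\<close> 0 by (simp add: aug_boundary_def)
      then have "chain_map 0 (\<lambda>x. ()) c = 0"
        using * by (simp add: aug_unit_def)
      moreover have "hom_induced 0 X {} (discrete_topology {()}) {} (\<lambda>x. ()) (homologous_rel_set 0 X {} c)
          = homologous_rel_set 0 (discrete_topology {()}) {} (chain_map 0 (\<lambda>x. ()) c)"
        using hom_induced_chain_map[of X "discrete_topology {()}" "\<lambda>x. ()" "{}" "{}" 0 c] cyc 0 by simp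
      ultimately have "hom_induced 0 X {} (discrete_topology {()}) {} (\<lambda>x. ()) (homologous_rel_set 0 X {} c)
          = \<one>\<^bsub>homology_group 0 (discrete_topology {()})\<^esub>"
        using one_relative_homology_group[of 0 "discrete_topology {()}" "{}"]
        by (simp add: homologous_rel_set_eq_relboundary)
      then show ?thesis using q 0 by (simp add: carrier_reduced_homology_group kernel_def)
    qed
    have "?q = \<one>\<^bsub>homology_group (int m) X\<^esub>"
      using red triv[of "int m"] by (simp add: trivial_group_def one_reduced_homology_group)
    then have "singular_relboundary m X {} c"
      by (simp add: homologous_rel_set_eq_relboundary)
    then show ?thesis using boundary Suc by blast
  qed
qed

text \<open>Subdivide until every simplex lies in \<open>V1\<close> or \<open>V2\<close>. The
  homotopy \<open>h\<close> between subdivision and identity adds a term at the boundary of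
  \<open>c\<close>, which can be split because the boundary is split and \<open>h\<close> preserves
  chains of every subspace.\<close>

lemma small_chains:
  assumes V: "openin X V1" "openin X V2" "topspace X \<subseteq> V1 \<union> V2"
    and c: "c \<in> aug_chains X (Suc m)"
    and d: "d1 \<in> aug_chains (subtopology X V1) m" "d2 \<in> aug_chains (subtopology X V2) m" "aug_boundary
        (Suc m) c = d1 + d2"
  obtains c1 c2 t where "c1 \<in> aug_chains (subtopology X V1) (Suc m)" "c2 \<in> aug_chains
      (subtopology X V2) (Suc m)"
    "t \<in> aug_chains X (Suc (Suc m))" "c - (c1 + c2) = aug_boundary (Suc (Suc m)) t"
proof -
  have sc: "singular_chain m X c" using c by simp
  obtain n where n: "\<And>f. f \<in> Poly_Mapping.keys ((singular_subdivision m ^^ n) c) \<Longrightarrow>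
      \<exists>V\<in>{V1, V2}. f \<in> standard_simplex m \<rightarrow> V"
    using sufficient_iterated_singular_subdivision_exists[of "{V1, V2}" X m c] V sc
    by (metis Union_insert Sup_empty sup_bot.right_neutral insertE order_refl singletonD)
  obtain h where h: "\<And>p. h p 0 = (0 :: 'a chain)" "\<And>p c1 c2. h p (c1 - c2) = h p c1 - h p c2"
      "\<And>p X c. singular_chain p X c \<Longrightarrow> singular_chain (Suc p) X (h p c)"
      "\<And>p X c. singular_chain p X c \<Longrightarrow>
         chain_boundary (Suc p) (h p c) + h (p - Suc 0) (chain_boundary p c)
             = (singular_subdivision p ^^ n) c - c"
    by (rule chain_homotopic_iterated_singular_subdivision[where n=n]) blast
  let ?sd = "(singular_subdivision m ^^ n) c"
  have "?sd = chain_boundary (Suc m) (h m c) + h (m - Suc 0) (chain_boundary m c) + c"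
    using h(4)[OF sc] by simp
  then have sd: "singular_chain m X ?sd"
  proof -
    have "singular_chain m X (chain_boundary (Suc m) (h m c))"
      using h(3)[OF sc] singular_chain_boundary_alt by blast
    moreover have "singular_chain m X (h (m - Suc 0) (chain_boundary m c))"
    proof (cases m)
      case (Suc k)
      then show ?thesis using h(3)[OF singular_chain_boundary[OF sc]] by simp
    qed (simp add: h(1) chain_boundary_def)
    ultimately show ?thesis
      using \<open>?sd = _\<close> sc by (simp add: singular_chain_add)
  qed
  have "Poly_Mapping.keys ?sd \<subseteq> {f. singular_simplex m (subtopology X V1) f} \<union> {f. singular_simplex m
      (subtopology X V2) f}"
  proof
    fix f assume f: "f \<in> Poly_Mapping.keys ?sd"
    then have "singular_simplex m X f" using sd by (auto simp: singular_chain_def)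
    then show "f \<in> {f. singular_simplex m (subtopology X V1) f} \<union> {f. singular_simplex m
        (subtopology X V2) f}"
      using n[OF f] by (auto simp: singular_simplex_subtopology)
  qed
  then obtain e1 e2 where e: "Poly_Mapping.keys e1 \<subseteq> {f. singular_simplex m (subtopology X V1) f}"
      "Poly_Mapping.keys e2 \<subseteq> {f. singular_simplex m (subtopology X V2) f}" "e1 + e2 = ?sd"
    by (rule frag_split)
  have e': "singular_chain m (subtopology X V1) e1" "singular_chain m (subtopology X V2) e2"
    using e by (auto simp: singular_chain_def)
  \<comment> \<open>For \<open>m = 0\<close> the term is \<open>h\<close> of zero:
    \<open>chain_boundary 0\<close> vanishes, while the boundary split by the hypothesis is the
    augmentation.\<close>
  have "\<exists>k1 k2. singular_chain m (subtopology X V1) k1 \<and> singular_chain m (subtopology X V2) k2 \<and>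
      h (m - Suc 0) (chain_boundary m c) = k1 + k2"
  proof (cases m)
    case 0
    then show ?thesis by (intro exI[of _ 0]) (simp add: h(1) chain_boundary_def)
  next
    case (Suc k)
    have h_add: "h p (a + b) = h p a + h p b" for p a b
      using h(2)[of p "a + b" b] by (simp add: algebra_simps)
    have "singular_chain k (subtopology X V1) d1" "singular_chain k (subtopology X V2) d2"
        "chain_boundary m c = d1 + d2"
      using d Suc by simp_all
    then show ?thesis
      using Suc h(3) h_add by (intro exI[of _ "h k d1"] exI[of _ "h k d2"]) simp
  qed
  then obtain k1 k2 where k: "singular_chain m (subtopology X V1) k1" "singular_chain m (subtopology X V2) k2"
      "h (m - Suc 0) (chain_boundary m c) = k1 + k2" by blast
  show ?thesis
  proof
    show "e1 - k1 \<in> aug_chains (subtopology X V1) (Suc m)" "e2 - k2 \<in> aug_chains (subtopology X V2) (Suc m)"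
      using e' k by (simp_all add: singular_chain_diff)
    show "- h m c \<in> aug_chains X (Suc (Suc m))"
      using h(3)[OF sc] by (simp add: singular_chain_minus)
    have "e1 - k1 + (e2 - k2) = (e1 + e2) - (k1 + k2)" by simp
    also have "\<dots> = chain_boundary (Suc m) (h m c) + c"
      using h(4)[OF sc] e(3) k(3) by (simp add: algebra_simps)
    finally show "c - (e1 - k1 + (e2 - k2)) = aug_boundary (Suc (Suc m)) (- h m c)"
      by (simp add: chain_boundary_minus)
  qed
qed

section \<open>The acyclic covering theorem\<close>

text \<open>Exactness of the mapping cone of the linear extension of \<open>\<psi>\<close>, i.e. \<open>\<psi>\<close> is a
  quasi-isomorphism.\<close>
definition cone_exact :: "('a \<Rightarrow> 'a \<Rightarrow> bool) \<Rightarrow> ('a list \<Rightarrow> 'e chain) \<Rightarrow> 'a set \<Rightarrow> 'e topology \<Rightarrow> bool"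
  where "cone_exact R \<psi> W E \<longleftrightarrow>
    (\<forall>n. \<forall>c\<in>list_chains R W n. \<forall>s\<in>aug_chains E (Suc n).
      list_boundary c = 0 \<longrightarrow> aug_boundary (Suc n) s = frag_extend \<psi> c \<longrightarrow>
      (\<exists>c'\<in>list_chains R W (Suc n). \<exists>s'\<in>aug_chains E (Suc (Suc n)).
        list_boundary c' = c \<and> frag_extend \<psi> c' - s = aug_boundary (Suc (Suc n)) s'))"

lemma cone_exactD:
  assumes "cone_exact R \<psi> W E" "c \<in> list_chains R W n" "s \<in> aug_chains E (Suc n)"
    "list_boundary c = 0" "aug_boundary (Suc n) s = frag_extend \<psi> c"
  obtains c' s' where "c' \<in> list_chains R W (Suc n)" "s' \<in> aug_chains E (Suc (Suc n))"
    "list_boundary c' = c" "frag_extend \<psi> c' - s = aug_boundary (Suc (Suc n)) s'"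
  using assms unfolding cone_exact_def by blast

lemma chain_map_frag_extend:
  assumes \<psi>: "\<And>l. l \<in> chain_lists R W n \<Longrightarrow> aug_boundary n (\<psi> l) = frag_extend \<psi> (face_sum l)"
    and c: "c \<in> list_chains R W n"
  shows "aug_boundary n (frag_extend \<psi> c) = frag_extend \<psi> (list_boundary c)"
proof -
  have "aug_boundary n (frag_extend \<psi> c) = frag_extend (\<lambda>l. aug_boundary n (\<psi> l)) c"
    by (rule frag_extend_additive) (rule aug_boundary_diff)
  also have "\<dots> = frag_extend (\<lambda>l. frag_extend \<psi> (face_sum l)) c"
    using c by (intro frag_extend_eq \<psi>) (auto simp: list_chains_def)
  also have "\<dots> = frag_extend \<psi> (list_boundary c)"
    unfolding list_boundary_def by (rule frag_extend_additive[symmetric]) (rule frag_extend_diff)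
  finally show ?thesis .
qed

text \<open>Fill \<open>c\<close> on the simplicial side by some \<open>d\<close>; then
  \<open>\<psi> d - s\<close> is a cycle and can be filled on the singular side.\<close>

lemma cone_exact_acyclic:
  assumes "list_acyclic R W" "aug_acyclic E"
    and \<psi>: "\<And>l n. l \<in> chain_lists R W n \<Longrightarrow> \<psi> l \<in> aug_chains E n \<and>
        aug_boundary n (\<psi> l) = frag_extend \<psi> (face_sum l)"
  shows "cone_exact R \<psi> W E"
  unfolding cone_exact_def
proof (intro allI ballI impI)
  fix n c s assume c: "c \<in> list_chains R W n" and s: "s \<in> aug_chains E (Suc n)"
    and bd: "list_boundary c = 0" "aug_boundary (Suc n) s = frag_extend \<psi> c"
  obtain d where d: "d \<in> list_chains R W (Suc n)" "list_boundary d = c"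
    using assms(1) c bd(1) unfolding list_acyclic_def by blast
  have "frag_extend \<psi> d \<in> aug_chains E (Suc n)"
    using d(1) \<psi> by (intro frag_extend_in_subgroup[OF frag_subgroup_aug_chains]) (auto simp: list_chains_def
        simp del: aug_chains_simps)
  then have "frag_extend \<psi> d - s \<in> aug_chains E (Suc n)"
    using s frag_module.subspace_diff[OF frag_subgroup_aug_chains] by blast
  moreover have "aug_boundary (Suc n) (frag_extend \<psi> d - s) = 0"
    using chain_map_frag_extend[OF _ d(1), of \<psi>] \<psi> d(2) bd(2) by (simp add: aug_boundary_diff)
  ultimately obtain t where "t \<in> aug_chains E (Suc (Suc n))" "aug_boundary (Suc (Suc n)) t
      = frag_extend \<psi> d - s"
    using aug_acyclicD[OF assms(2)] by blast
  then show "\<exists>c'\<in>list_chains R W (Suc n). \<exists>s'\<in>aug_chains E (Suc (Suc n)).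
        list_boundary c' = c \<and> frag_extend \<psi> c' - s = aug_boundary (Suc (Suc n)) s'"
    using d by metis
qed

text \<open>A cone cycle \<open>(c, s)\<close> is split over the two pieces. The halves fail to be
  cycles by a chain on the overlap, which is a cone cycle there one degree lower; filling it closes
  up both halves.\<close>

lemma cone_exact_Mayer_Vietoris:
  assumes V: "openin E V1" "openin E V2" "topspace E \<subseteq> V1 \<union> V2"
    and lists: "\<And>n. chain_lists R W n \<subseteq> chain_lists R W1 n \<union> chain_lists R W2 n"
    and W: "W1 \<subseteq> W" "W2 \<subseteq> W" "W0 = W1 \<inter> W2"
    and unit: "\<psi> [] = aug_unit"
    and \<psi>: "\<And>l n. l \<in> chain_lists R W n \<Longrightarrow> aug_boundary n (\<psi> l) = frag_extend \<psi> (face_sum l)"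
    and \<psi>1: "\<And>l n. l \<in> chain_lists R W1 n \<Longrightarrow> \<psi> l \<in> aug_chains (subtopology E V1) n"
    and \<psi>2: "\<And>l n. l \<in> chain_lists R W2 n \<Longrightarrow> \<psi> l \<in> aug_chains (subtopology E V2) n"
    and ex1: "cone_exact R \<psi> W1 (subtopology E V1)" and ex2: "cone_exact R \<psi> W2 (subtopology E V2)"
    and ex0: "cone_exact R \<psi> W0 (subtopology E (V1 \<inter> V2))"
  shows "cone_exact R \<psi> W E"
  unfolding cone_exact_def
proof (intro allI ballI impI)
  fix n c s assume c: "c \<in> list_chains R W n" and s: "s \<in> aug_chains E (Suc n)"
    and bd: "list_boundary c = 0" "aug_boundary (Suc n) s = frag_extend \<psi> c"
  note diff_in = frag_module.subspace_diff[OF frag_subgroup_aug_chains]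
    and add_in = frag_module.subspace_add[OF frag_subgroup_aug_chains]
    and diff_in' = frag_module.subspace_diff[OF frag_subgroup_list_chains]
    and add_in' = frag_module.subspace_add[OF frag_subgroup_list_chains]
  have ext1: "frag_extend \<psi> d \<in> aug_chains (subtopology E V1) m" if "d \<in> list_chains R W1 m" for d m
    using that \<psi>1 by (intro frag_extend_in_subgroup[OF frag_subgroup_aug_chains]) (auto simp: list_chains_def)
  have ext2: "frag_extend \<psi> d \<in> aug_chains (subtopology E V2) m" if "d \<in> list_chains R W2 m" for d m
    using that \<psi>2 by (intro frag_extend_in_subgroup[OF frag_subgroup_aug_chains]) (auto simp: list_chains_def)
  have cm: "aug_boundary m (frag_extend \<psi> d) = frag_extend \<psi> (list_boundary d)"
      if "d \<in> list_chains R W m" for d m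
    using chain_map_frag_extend[OF \<psi> that] by blast
  have up1: "d \<in> list_chains R W m" if "d \<in> list_chains R W1 m" for d m
      using that list_chains_mono[OF W(1)] by blast
  have up2: "d \<in> list_chains R W m" if "d \<in> list_chains R W2 m" for d m
      using that list_chains_mono[OF W(2)] by blast
  have "Poly_Mapping.keys c \<subseteq> chain_lists R W1 n \<union> chain_lists R W2 n"
    using c lists[of n] by (auto simp: list_chains_def)
  then obtain c1 c2 where "Poly_Mapping.keys c1 \<subseteq> chain_lists R W1 n" "Poly_Mapping.keys c2 \<subseteq> chain_lists R W2
      n" and c12: "c1 + c2 = c"
    by (rule frag_split)
  then have c1: "c1 \<in> list_chains R W1 n" and c2: "c2 \<in> list_chains R W2 n" by (auto simp: list_chains_def)
  have bd': "aug_boundary (Suc n) s = frag_extend \<psi> c1 + frag_extend \<psi> c2"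
    using bd(2) c12 by (simp add: frag_extend_add[symmetric])
  obtain s1 s2 t where s1: "s1 \<in> aug_chains (subtopology E V1) (Suc n)"
      and s2: "s2 \<in> aug_chains (subtopology E V2) (Suc n)"
    and t: "t \<in> aug_chains E (Suc (Suc n))" "s - (s1 + s2) = aug_boundary (Suc (Suc n)) t"
    by (rule small_chains[OF V s ext1[OF c1] ext2[OF c2] bd'])
  have "aug_boundary (Suc n) (s - (s1 + s2)) = 0"
    unfolding t(2) using aug_boundary_boundary[OF t(1)] by simp
  then have bd12: "aug_boundary (Suc n) s1 + aug_boundary (Suc n) s2 = frag_extend \<psi> c1 + frag_extend \<psi> c2"
    using bd' by (simp add: aug_boundary_diff aug_boundary_add)
  have lb12: "list_boundary c2 = - list_boundary c1"
    using bd(1) unfolding c12[symmetric] list_boundary_simps by (rule minus_unique[symmetric])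
  \<comment> \<open>The defect of the first half is the negative of that of the second, so it lives
    in both pieces and hence in the overlap.\<close>
  define v where "v = frag_extend \<psi> c1 - aug_boundary (Suc n) s1"
  have v2: "v = aug_boundary (Suc n) s2 - frag_extend \<psi> c2"
    using bd12 unfolding v_def by (simp add: diff_eq_eq eq_diff_eq algebra_simps)
  have v_in: "v \<in> aug_chains (subtopology E (V1 \<inter> V2)) n"
  proof -
    have "v \<in> aug_chains (subtopology E V1) n"
      unfolding v_def by (rule diff_in[OF ext1[OF c1] aug_boundary_in[OF s1]])
    moreover have "v \<in> aug_chains (subtopology E V2) n"
      unfolding v2 by (rule diff_in[OF aug_boundary_in[OF s2] ext2[OF c2]])
    ultimately show ?thesis by (cases n) (auto simp: singular_chain_subtopology)
  qed
  \<comment> \<open>The cone cycle on the overlap is the boundary of \<open>c1\<close> together with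
    \<open>v\<close>. For \<open>n = 0\<close> no lower degree exists; there \<open>v\<close> is a
    multiple of the unit and thus \<psi> of a multiple of the empty list.\<close>
  obtain a b where a: "a \<in> list_chains R W0 n" and b: "b \<in> aug_chains (subtopology E (V1 \<inter> V2)) (Suc n)"
    and ab: "list_boundary a = list_boundary c1" "frag_extend \<psi> a - v = aug_boundary (Suc n) b"
  proof (cases n)
    case 0
    then obtain k where k: "v = frag_cmul k aug_unit" using v_in by auto
    have "list_boundary c1 = 0" using list_boundary_0_degree c1 0 by blast
    then show ?thesis
      using that[of "frag_cmul k (frag_of [])" 0] 0 frag_module.subspace_scale[OF frag_subgroup_list_chains,
          of "frag_of []" R W0 0]
      by (simp add: k frag_extend_cmul unit chain_lists_def)
  next
    case (Suc m)
    have "list_boundary c1 \<in> list_chains R W1 m" "list_boundary c1 \<in> list_chains R W2 m"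
      using list_boundary_in_list_chains[of c1 R W1 m] list_boundary_in_list_chains[of c2 R
          W2 m] c1 c2 Suc lb12
        frag_module.subspace_neg[OF frag_subgroup_list_chains, of "list_boundary c2"] by auto
    then have l0: "list_boundary c1 \<in> list_chains R W0 m"
      by (auto simp: list_chains_def chain_lists_def W(3) subset_iff)
    have "aug_boundary (Suc m) v = frag_extend \<psi> (list_boundary c1)"
      using cm[OF up1[OF c1]] aug_boundary_boundary[OF s1] Suc by (simp add: v_def aug_boundary_diff)
    then obtain a b where "a \<in> list_chains R W0 (Suc m)" "b \<in> aug_chains (subtopology E (V1 \<inter>
        V2)) (Suc (Suc m))"
      "list_boundary a = list_boundary c1" "frag_extend \<psi> a - v = aug_boundary (Suc (Suc m)) b"
      by (rule cone_exactD[OF ex0 l0 v_in[unfolded Suc] list_boundary_list_boundary])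
    then show ?thesis unfolding Suc[symmetric] by (rule that)
  qed
  have a1: "a \<in> list_chains R W1 n" and a2: "a \<in> list_chains R W2 n"
    using a list_chains_mono[of W0 W1] list_chains_mono[of W0 W2] W(3) by blast+
  have b1: "b \<in> aug_chains (subtopology E V1) (Suc n)" and b2: "b \<in> aug_chains (subtopology E V2) (Suc n)"
    using b aug_chains_mono[of "V1 \<inter> V2" V1] aug_chains_mono[of "V1 \<inter> V2" V2] by blast+
  \<comment> \<open>The filler \<open>(a, b)\<close> is subtracted on the first piece and added on
    the second, so the total is unchanged while both halves become cycles.\<close>
  have e1: "aug_boundary (Suc n) (s1 - b) = frag_extend \<psi> (c1 - a)"
    unfolding aug_boundary_diff ab(2)[symmetric] frag_extend_diff v_def by simp
  have z1: "list_boundary (c1 - a) = 0" using ab(1) by simp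
  obtain p1 q1 where p1: "p1 \<in> list_chains R W1 (Suc n)"
      and q1: "q1 \<in> aug_chains (subtopology E V1) (Suc (Suc n))"
    and p1': "list_boundary p1 = c1 - a" and q1': "frag_extend \<psi> p1 - (s1 - b)
        = aug_boundary (Suc (Suc n)) q1"
    by (rule cone_exactD[OF ex1 diff_in'[OF c1 a1] diff_in[OF s1 b1] z1 e1])
  have e2: "aug_boundary (Suc n) (s2 + b) = frag_extend \<psi> (c2 + a)"
    unfolding aug_boundary_add ab(2)[symmetric] frag_extend_add v2 by simp
  have z2: "list_boundary (c2 + a) = 0" using ab(1) lb12 by simp
  obtain p2 q2 where p2: "p2 \<in> list_chains R W2 (Suc n)"
      and q2: "q2 \<in> aug_chains (subtopology E V2) (Suc (Suc n))"
    and p2': "list_boundary p2 = c2 + a" and q2': "frag_extend \<psi> p2 - (s2 + b)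
        = aug_boundary (Suc (Suc n)) q2"
    by (rule cone_exactD[OF ex2 add_in'[OF c2 a2] add_in[OF s2 b2] z2 e2])
  show "\<exists>c'\<in>list_chains R W (Suc n). \<exists>s'\<in>aug_chains E (Suc (Suc n)).
        list_boundary c' = c \<and> frag_extend \<psi> c' - s = aug_boundary (Suc (Suc n)) s'"
  proof (intro bexI conjI)
    show "list_boundary (p1 + p2) = c" using p1' p2' c12 by simp
    have "frag_extend \<psi> (p1 + p2) - s = (frag_extend \<psi> p1 - (s1 - b)) + (frag_extend \<psi> p2 - (s2 +
        b)) - (s - (s1 + s2))"
      by (simp add: frag_extend_add)
    then show "frag_extend \<psi> (p1 + p2) - s = aug_boundary (Suc (Suc n)) (q1 + q2 - t)"
      unfolding q1' q2' t(2) aug_boundary_diff aug_boundary_add .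
    show "p1 + p2 \<in> list_chains R W (Suc n)" using up1[OF p1] up2[OF p2] by (rule add_in')
    show "q1 + q2 - t \<in> aug_chains E (Suc (Suc n))"
      by (intro diff_in add_in subsetD[OF aug_chains_subtopology q1] subsetD[OF
          aug_chains_subtopology q2] t(1))
  qed
qed

definition down_closed :: "'a set \<Rightarrow> ('a \<Rightarrow> 'a \<Rightarrow> bool) \<Rightarrow> 'a set \<Rightarrow> bool"
  where "down_closed A r W \<longleftrightarrow> W \<subseteq> A \<and> (\<forall>y\<in>W. \<forall>x\<in>A. r x y \<longrightarrow> x \<in> W)"

text \<open>Induction on the size of \<open>W\<close>. A maximal \<open>x\<close> gives a cover of
  \<open>W\<close> by \<open>W - {x}\<close> and the principal down-set of \<open>x\<close>. Over
  the down-set both complexes are acyclic by hypothesis; \<open>W - {x}\<close> and the overlap are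
  smaller than \<open>W\<close>.\<close>

lemma acyclic_cover_cone_exact:
  fixes E :: "'e topology" and p :: "'e \<Rightarrow> 'a" and r :: "'a \<Rightarrow> 'a \<Rightarrow> bool"
  defines "P \<equiv> \<lambda>W. {e \<in> topspace E. p e \<in> W}"
  assumes A: "finite A"
    and r: "\<And>x. x \<in> A \<Longrightarrow> r x x" "\<And>x y z. r x y \<Longrightarrow> r y z \<Longrightarrow> r x z"
      "\<And>x y. x \<in> A \<Longrightarrow> y \<in> A \<Longrightarrow> r x y \<Longrightarrow> r y x \<Longrightarrow> x = y"
    and R: "\<And>x y. x \<in> A \<Longrightarrow> y \<in> A \<Longrightarrow> R x y \<Longrightarrow> r x y \<or> r y x"
    and opn: "\<And>W. down_closed A r W \<Longrightarrow> openin E (P W)"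
    and list_ac: "\<And>x. x \<in> A \<Longrightarrow> list_acyclic R {y \<in> A. r y x}"
    and aug_ac: "\<And>x. x \<in> A \<Longrightarrow> aug_acyclic (subtopology E (P {y \<in> A. r y x}))"
    and unit: "\<psi> [] = aug_unit"
    and \<psi>: "\<And>l n. l \<in> chain_lists R A n \<Longrightarrow> aug_boundary n (\<psi> l) = frag_extend \<psi> (face_sum l)"
    and carrier: "\<And>l n W. l \<in> chain_lists R A n \<Longrightarrow> down_closed A r W \<Longrightarrow> set l \<subseteq> W \<Longrightarrow>
        \<psi> l \<in> aug_chains (subtopology E (P W)) n"
    and W: "down_closed A r W"
  shows "cone_exact R \<psi> W (subtopology E (P W))"
  using W
proof (induction "card W" arbitrary: W rule: less_induct)
  case less
  have down: "W \<subseteq> A" "\<forall>y\<in>W. \<forall>x\<in>A. r x y \<longrightarrow> x \<in> W" using less.prems by (auto simp: down_closed_def)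
  have finW: "finite W" using A down(1) finite_subset by blast
  have lists_sub: "l \<in> chain_lists R A n" if "l \<in> chain_lists R V n" "V \<subseteq> A" for l n V
    using that by (auto simp: chain_lists_def)
  have carr: "\<psi> l \<in> aug_chains (subtopology E (P V)) n"
    if l: "l \<in> chain_lists R V n" and V: "down_closed A r V" for l n V
  proof -
    have "V \<subseteq> A" using V by (simp add: down_closed_def)
    moreover have "set l \<subseteq> V" using l by (simp add: chain_lists_def)
    ultimately show ?thesis using carrier[OF lists_sub[OF l] V] by blast
  qed
  show ?case
  proof (cases "W = {}")
    case True
    have P0: "P {} = {}" by (simp add: P_def)
    show ?thesis
      unfolding cone_exact_def True P0
    proof (intro allI ballI impI)
      fix n c and s :: "'e chain" assume c: "c \<in> list_chains R {} n"
          and s: "s \<in> aug_chains (subtopology E {}) (Suc n)"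
        and bd: "aug_boundary (Suc n) s = frag_extend \<psi> c"
      have s0: "s = 0" using s by (simp add: singular_chain_empty)
      \<comment> \<open>Over the empty set only the augmentation modules survive. Since \<psi>
        matches their generators, \<open>s = 0\<close> forces \<open>c = 0\<close>.\<close>
      have "c = 0"
      proof (cases n)
        case 0
        then obtain k where k: "c = frag_cmul k (frag_of [])" using list_chains_0 c by blast
        then have "frag_cmul k (aug_unit :: 'e chain) = 0"
          using bd s0 by (simp add: frag_extend_cmul unit)
        then show ?thesis using k by (simp add: aug_unit_def)
      next
        case (Suc m)
        then have "Poly_Mapping.keys c = {}" using c unfolding list_chains_def chain_lists_def by fastforce
        then show ?thesis by simp
      qed
      then show "\<exists>c'\<in>list_chains R {} (Suc n). \<exists>s'\<in>aug_chains (subtopology E {}) (Suc (Suc n)).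
        list_boundary c' = c \<and> frag_extend \<psi> c' - s = aug_boundary (Suc (Suc n)) s'"
        using s0 frag_module.subspace_0[OF frag_subgroup_list_chains] by (intro bexI[of _ 0]) auto
    qed
  next
    case False
    obtain x where x: "x \<in> W" "\<And>y. y \<in> W \<Longrightarrow> r x y \<Longrightarrow> y = x"
    proof -
      \<comment> \<open>An element with the largest number of predecessors is maximal.\<close>
      define f where "f x = card {y \<in> W. r y x}" for x
      obtain x where x: "x \<in> W" "\<And>y. y \<in> W \<Longrightarrow> f y \<le> f x"
        using finite_has_maximal[of "f ` W"] finW False
            by (smt (verit) finite_imageI image_iff image_is_empty nle_le)
      have "y = x" if y: "y \<in> W" "r x y" for y
      proof (rule ccontr)
        assume "y \<noteq> x"
        then have "\<not> r y x" using r(3) y x(1) down(1) by blast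
        then have "{z \<in> W. r z x} \<subset> {z \<in> W. r z y}"
          using y r(1,2) down(1) by blast
        then have "f x < f y" unfolding f_def using finW by (intro psubset_card_mono) auto
        then show False using x(2)[OF y(1)] by simp
      qed
      then show ?thesis using that x(1) by blast
    qed
    define U where "U = {y \<in> A. r y x}"
    have xA: "x \<in> A" using x(1) down(1) by blast
    have U: "U \<subseteq> A" "U \<subseteq> W" "down_closed A r U" "x \<in> U"
      using down x(1) xA r(1) unfolding U_def down_closed_def by (auto intro: r(2))
    have exU: "cone_exact R \<psi> U (subtopology E (P U))"
    proof (rule cone_exact_acyclic)
      show "list_acyclic R U" "aug_acyclic (subtopology E (P U))"
        unfolding U_def by (rule list_ac[OF xA], rule aug_ac[OF xA])
      show "\<psi> l \<in> aug_chains (subtopology E (P U)) n \<and> aug_boundary n (\<psi> l) = frag_extend \<psi> (face_sum l)"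
        if "l \<in> chain_lists R U n" for l n
        using carr[OF that U(3)] \<psi>[OF lists_sub[OF that U(1)]] by blast
    qed
    show ?thesis
    proof (cases "U = W")
      case True
      then show ?thesis using exU by simp
    next
      case False
      define V where "V = W - {x}"
      have V: "V \<subseteq> A" "V \<subseteq> W" "down_closed A r V"
        using down x by (auto simp: V_def down_closed_def)
      have VU: "down_closed A r (V \<inter> U)"
        using V(3) U(3) by (auto simp: down_closed_def)
      have "V \<subset> W" "V \<inter> U \<subset> W" using x(1) V_def by auto
      then have card: "card V < card W" "card (V \<inter> U) < card W" using finW by (auto intro: psubset_card_mono)
      have sub: "subtopology (subtopology E (P W)) (P V') = subtopology E (P V')" if "V' \<subseteq> W" for V'
      proof -
        have "P W \<inter> P V' = P V'" using that by (auto simp: P_def)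
        then show ?thesis by (simp add: subtopology_subtopology)
      qed
      have opn': "openin (subtopology E (P W)) (P V')" if "V' \<subseteq> W" "openin E (P V')" for V'
      proof -
        have "P V' = P V' \<inter> P W" using that(1) by (auto simp: P_def)
        then show ?thesis using that(2) unfolding openin_subtopology by blast
      qed
      have Pint: "P V \<inter> P U = P (V \<inter> U)" by (auto simp: P_def)
      show ?thesis
      proof (rule cone_exact_Mayer_Vietoris[where ?V1.0="P V" and ?V2.0="P U" and ?W1.0=V and ?W2.0=U
          and ?W0.0="V \<inter> U"])
        show "openin (subtopology E (P W)) (P V)" "openin (subtopology E (P W)) (P U)"
          by (rule opn'[OF V(2) opn[OF V(3)]], rule opn'[OF U(2) opn[OF U(3)]])
        show "topspace (subtopology E (P W)) \<subseteq> P V \<union> P U" using U by (auto simp: P_def V_def)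
        \<comment> \<open>All vertices of a chain through \<open>x\<close> are comparable with
          \<open>x\<close>, hence below it by maximality; such a chain lies in
          \<open>U\<close>.\<close>
        show "chain_lists R W n \<subseteq> chain_lists R V n \<union> chain_lists R U n" for n
        proof
          fix l assume l: "l \<in> chain_lists R W n"
          show "l \<in> chain_lists R V n \<union> chain_lists R U n"
          proof (cases "x \<in> set l")
            case True
            have "r y x" if y: "y \<in> set l" for y
            proof (cases "y = x")
              case False
              have "R x y \<or> R y x"
                using l True y False unfolding chain_lists_def
                by (auto simp: in_set_conv_nth sorted_wrt_iff_nth_less) (metis linorder_neqE_nat)
              then have "r x y \<or> r y x" using R l y True down(1) by (auto simp: chain_lists_def)
              moreover have "\<not> r x y" using x(2)[of y] False l y by (auto simp: chain_lists_def)
              ultimately show ?thesis by blast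
            qed (use x(1) down(1) r(1) in blast)
            then have "set l \<subseteq> U" using l down(1) by (auto simp: U_def chain_lists_def)
            then show ?thesis using l by (auto simp: chain_lists_def)
          next
            case False
            then show ?thesis using l by (auto simp: chain_lists_def V_def)
          qed
        qed
        show "aug_boundary n (\<psi> l) = frag_extend \<psi> (face_sum l)" if "l \<in> chain_lists R W n" for l n
          using \<psi> lists_sub[OF that down(1)] by blast
        show "\<psi> l \<in> aug_chains (subtopology (subtopology E (P W)) (P V)) n" if "l \<in> chain_lists R V n" for l n
          unfolding sub[OF V(2)] by (rule carr[OF that V(3)])
        show "\<psi> l \<in> aug_chains (subtopology (subtopology E (P W)) (P U)) n" if "l \<in> chain_lists R U n" for l n
          unfolding sub[OF U(2)] by (rule carr[OF that U(3)])
        show "cone_exact R \<psi> V (subtopology (subtopology E (P W)) (P V))"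
          unfolding sub[OF V(2)] by (rule less.hyps[OF card(1) V(3)])
        show "cone_exact R \<psi> U (subtopology (subtopology E (P W)) (P U))"
          unfolding sub[OF U(2)] by (rule exU)
        have VUW: "V \<inter> U \<subseteq> W" using V by blast
        show "cone_exact R \<psi> (V \<inter> U) (subtopology (subtopology E (P W)) (P V \<inter> P U))"
          unfolding Pint sub[OF VUW] by (rule less.hyps[OF card(2) VU])
      qed (use V U unit in auto)
    qed
  qed
qed

section \<open>Acyclic spaces\<close>

lemma space_le_iff: "space_le X x y \<longleftrightarrow> y \<in> topspace X \<and> (\<forall>U. openin X U \<longrightarrow> y \<in> U \<longrightarrow> x \<in> U)"
  by (auto simp: space_le_def min_open_def)

text \<open>The homotopy is \<open>f\<close> for times below \<open>1\<close> and jumps to \<open>g\<close> at time \<open>1\<close>.\<close>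
lemma homotopic_with_specialization:
  assumes f: "continuous_map X Y f" and g: "continuous_map X Y g"
    and le: "\<And>x V. x \<in> topspace X \<Longrightarrow> openin Y V \<Longrightarrow> g x \<in> V \<Longrightarrow> f x \<in> V"
  shows "homotopic_with (\<lambda>_. True) X Y f g"
  unfolding homotopic_with_def
proof (intro exI conjI ballI allI)
  define h where "h = (\<lambda>(t::real, x). if t < 1 then f x else g x)"
  let ?I = "top_of_set {0..1::real}"
  show "continuous_map (prod_topology ?I X) Y h"
    unfolding continuous_map
  proof (intro conjI allI impI)
    show "h ` topspace (prod_topology ?I X) \<subseteq> topspace Y"
      using continuous_map_image_subset_topspace[OF f] continuous_map_image_subset_topspace[OF g]
      by (auto simp: h_def image_subset_iff)
    fix V assume V: "openin Y V"
    \<comment> \<open>The slice at time \<open>1\<close> is the preimage of \<open>V\<close> under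
      \<open>g\<close>. It is contained in the preimage under \<open>f\<close>, so it may be
      thickened to the whole interval, which exhibits the set as open.\<close>
    have "{p \<in> topspace (prod_topology ?I X). h p \<in> V}
        = ({0..1} \<inter> {..<1}) \<times> {x \<in> topspace X. f x \<in> V} \<union> {0..1} \<times> {x \<in> topspace X. g x \<in> V}"
      using le[OF _ V] by (auto simp: h_def split: if_splits)
    moreover have "openin ?I ({0..1} \<inter> {..<1})" by (rule openin_open_Int) simp
    moreover have "openin ?I {0..1}" by (metis openin_subtopology_self)
    moreover have "openin X {x \<in> topspace X. f x \<in> V}" "openin X {x \<in> topspace X. g x \<in> V}"
      using f g V by (auto simp: continuous_map)
    ultimately show "openin (prod_topology ?I X) {p \<in> topspace (prod_topology ?I X). h p \<in> V}"
      by (auto intro!: openin_Un simp: openin_prod_Times_iff)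
  qed
  show "h (0, x) = f x" "h (1, x) = g x" for x by (simp_all add: h_def)
qed auto

lemma aug_acyclic_contractible:
  assumes "contractible_space X" "topspace X \<noteq> {}"
  shows "aug_acyclic X"
  using assms trivial_reduced_homology_group_contractible_space
  by (intro aug_acyclic_if_acyclic_space) (auto simp: acyclic_space_def)

lemma contractible_space_homotopic_constI:
  "homotopic_with (\<lambda>_. True) X X id (\<lambda>_. a) \<Longrightarrow> contractible_space X"
  unfolding contractible_space_def by blast

text \<open>An open set of the subspace that contains the maximum is everything, so the identity
  specializes to the constant map at \<open>x\<close> and the subspace is contractible.\<close>

lemma aug_acyclic_with_maximum:
  assumes A: "A \<subseteq> topspace X" "x \<in> A" "\<And>y. y \<in> A \<Longrightarrow> space_le X y x"
  shows "aug_acyclic (subtopology X A)"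
proof (rule aug_acyclic_contractible)
  have top: "topspace (subtopology X A) = A" using A(1) by auto
  show "topspace (subtopology X A) \<noteq> {}" unfolding top using A(2) by blast
  show "contractible_space (subtopology X A)"
  proof (rule contractible_space_homotopic_constI[of _ x], rule homotopic_with_specialization)
    fix y V assume "y \<in> topspace (subtopology X A)" "openin (subtopology X A) V" "x \<in> V"
    then obtain W where W: "openin X W" "V = W \<inter> A" and y: "y \<in> A"
      unfolding openin_subtopology by auto
    have "y \<in> W" using A(3)[OF y] W \<open>x \<in> V\<close> by (auto simp: space_le_iff)
    then show "id y \<in> V" using W y by simp
  qed (use A in auto)
qed

lemma acyclic_space_homotopy_equivalent:
  assumes "X homotopy_equivalent_space Y" "acyclic_space Y" "topspace X \<noteq> {}"
  shows "acyclic_space X"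
proof -
  have "trivial_group (reduced_homology_group p X)" for p
  proof -
    have "trivial_group (reduced_homology_group p Y)" using assms(2) by (simp add: acyclic_space_def)
    then show ?thesis
      using isomorphic_group_triviality[OF homotopy_equivalent_space_imp_isomorphic_reduced_homology_groups[OF assms(1)]
        group_reduced_homology_group group_reduced_homology_group] by simp
  qed
  then show ?thesis using assms(3) by (simp add: acyclic_space_def)
qed

text \<open>The graph over the down-set of \<open>x\<close> deforms onto the slice over
  \<open>x\<close>: by monotonicity \<open>(x', y)\<close> can be moved to \<open>(x, y)\<close>,
  and raising the first coordinate is a homotopy by specialization.\<close>

lemma acyclic_graph_fiber:
  assumes F: "F x \<subseteq> topspace Y" and mono: "\<And>x'. space_le X x' x \<Longrightarrow> F x' \<subseteq> F x"
    and x: "x \<in> topspace X" and ac: "acyclic_space (subtopology Y (F x))"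
  shows "acyclic_space (subtopology (graph_space X Y F) {e \<in> topspace (graph_space X Y F).
      space_le X (fst e) x})"
proof -
  let ?S = "{e \<in> topspace (graph_space X Y F). space_le X (fst e) x}"
  let ?G = "subtopology (graph_space X Y F) ?S"
  have top: "topspace ?G = ?S" by auto
  have S: "?S = {(x', y). space_le X x' x \<and> y \<in> F x' \<and> y \<in> topspace Y}"
    using space_le_in_topspace by (auto simp: graph_space_def)
  have G: "?G = subtopology (prod_topology X Y) ?S"
  proof -
    have "{(x, y). y \<in> F x} \<inter> ?S = ?S" unfolding S by auto
    then show ?thesis by (simp add: graph_space_def subtopology_subtopology)
  qed
  have topY: "topspace (subtopology Y (F x)) = F x" using F by auto
  have fx: "(x, y) \<in> ?S" if "y \<in> F x" for y unfolding S using that x F space_le_refl by auto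
  have c1: "continuous_map ?G (subtopology Y (F x)) snd"
  proof -
    have "continuous_map ?G Y snd" unfolding G by (intro continuous_map_from_subtopology continuous_map_snd)
    moreover have "snd ` topspace ?G \<subseteq> F x" unfolding top S using mono by fastforce
    ultimately show ?thesis unfolding continuous_map_in_subtopology by auto
  qed
  have c2: "continuous_map (subtopology Y (F x)) ?G (\<lambda>y. (x, y))"
  proof -
    have "continuous_map (subtopology Y (F x)) (prod_topology X Y) (\<lambda>y. (x, y))"
      using x by (simp add: continuous_map_pairedI continuous_map_from_subtopology)
    moreover have "(\<lambda>y. (x, y)) ` topspace (subtopology Y (F x)) \<subseteq> ?S" unfolding topY using fx by blast
    ultimately show ?thesis unfolding G continuous_map_in_subtopology by auto
  qed
  have "homotopic_with (\<lambda>_. True) ?G ?G id ((\<lambda>y. (x, y)) \<circ> snd)"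
  proof (rule homotopic_with_specialization)
    show "continuous_map ?G ?G ((\<lambda>y. (x, y)) \<circ> snd)" using c1 c2 continuous_map_compose by blast
    fix e V assume e: "e \<in> topspace ?G" and V: "openin ?G V" "((\<lambda>y. (x, y)) \<circ> snd) e \<in> V"
    obtain x' y where e': "e = (x', y)" "space_le X x' x" using e unfolding top S by auto
    obtain W where W: "openin (prod_topology X Y) W" "V = W \<inter> ?S" using V(1)
        unfolding G openin_subtopology by blast
    have "(x, y) \<in> W" using V(2) W(2) e'(1) by auto
    then obtain A B where AB: "openin X A" "openin Y B" "x \<in> A" "y \<in> B" "A \<times> B \<subseteq> W"
      using W(1) unfolding openin_prod_topology_alt by metis
    have "x' \<in> A" using e'(2) AB(1,3) by (auto simp: space_le_iff)
    then show "id e \<in> V" using AB e e'(1) W(2) unfolding top by auto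
  qed auto
  then have h1: "homotopic_with (\<lambda>_. True) ?G ?G ((\<lambda>y. (x, y)) \<circ> snd) id"
    by (rule homotopic_with_symD)
  have h2: "homotopic_with (\<lambda>_. True) (subtopology Y (F x)) (subtopology Y (F x)) (snd \<circ> (\<lambda>y. (x, y))) id"
  proof -
    have e: "snd \<circ> (\<lambda>y. (x, y)) = id" by auto
    show ?thesis unfolding e by simp
  qed
  have "?G homotopy_equivalent_space subtopology Y (F x)"
    unfolding homotopy_equivalent_space_def using c1 c2 h1 h2 by blast
  moreover have "topspace ?G \<noteq> {}"
  proof -
    obtain y where "y \<in> F x" using ac topY by (auto simp: acyclic_space_def)
    then show ?thesis unfolding top using fx by blast
  qed
  ultimately show ?thesis using ac acyclic_space_homotopy_equivalent by blast
qed

section \<open>The McCord map\<close>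

lemma t0_op_space:
  assumes "t0_space X"
  shows "t0_space (op_space X)"
  unfolding t0_space_def
proof (intro ballI impI)
  fix x y assume xy: "x \<in> topspace (op_space X)" "y \<in> topspace (op_space X)" "x \<noteq> y"
  have opn: "openin (op_space X) {z. space_le X w z}" for w
    unfolding openin_op_space by (auto dest: space_le_in_topspace space_le_trans)
  have "\<not> space_le X x y \<or> \<not> space_le X y x" using space_le_antisym[OF assms] xy(3) by blast
  then show "\<exists>U. openin (op_space X) U \<and> (x \<notin> U) = (y \<in> U)"
    using opn[of x] opn[of y] xy(1,2) space_le_refl[of x X] space_le_refl[of y X]
        by (metis mem_Collect_eq topspace_op_space)
qed

definition realization :: "'a topology \<Rightarrow> ('a \<Rightarrow> real) set"
  where "realization X =
    {t. (\<forall>x. 0 \<le> t x) \<and> {x. t x \<noteq> 0} \<in> order_chains X \<and> (\<Sum>x | t x \<noteq> 0. t x) = 1}"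

lemma order_complex_realization: "order_complex X = subtopology (powertop_real UNIV) (realization X)"
  by (simp add: order_complex_def realization_def)

lemma topspace_order_complex: "topspace (order_complex X) = realization X"
  by (simp add: order_complex_realization)

lemma realization_support: "t \<in> realization X \<Longrightarrow> {x. t x \<noteq> 0} \<subseteq> topspace X" "t \<in> realization X \<Longrightarrow> 0 \<le> t x"
  by (auto simp: realization_def order_chains_def)

lemma order_chains_minimum:
  assumes "C \<in> order_chains X"
  shows "\<exists>x\<in>C. \<forall>y\<in>C. space_le X x y"
proof -
  have C: "finite C" "C \<noteq> {}" "C \<subseteq> topspace X" "\<forall>x\<in>C. \<forall>y\<in>C. space_le X x y \<or> space_le X y x"
    using assms by (auto simp: order_chains_def)
  show ?thesis using C
  proof (induction C rule: finite_ne_induct)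
    case (singleton x)
    then show ?case using space_le_refl by auto
  next
    case (insert x C)
    then obtain m where m: "m \<in> C" "\<forall>y\<in>C. space_le X m y" by auto
    show ?case
    proof (cases "space_le X m x")
      case True
      then show ?thesis using m by auto
    next
      case False
      then have "space_le X x m" using insert.prems m by auto
      then have "\<forall>y\<in>insert x C. space_le X x y" using m insert.prems space_le_refl space_le_trans
          by (metis insertE insert_subset)
      then show ?thesis by blast
    qed
  qed
qed

lemma mccord_map:
  assumes X: "t0_space X" and t: "t \<in> realization X"
  shows "t (mccord_map X t) \<noteq> 0" "t y \<noteq> 0 \<Longrightarrow> space_le X (mccord_map X t) y"
proof -
  obtain x where x: "t x \<noteq> 0" "\<forall>y. t y \<noteq> 0 \<longrightarrow> space_le X x y"
    using order_chains_minimum[of "{x. t x \<noteq> 0}" X] t by (auto simp: realization_def)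
  have "t (mccord_map X t) \<noteq> 0 \<and> (\<forall>y. t y \<noteq> 0 \<longrightarrow> space_le X (mccord_map X t) y)"
    unfolding mccord_map_def
    by (rule theI[of _ x]) (use x space_le_antisym[OF X] in blast)+
  then show "t (mccord_map X t) \<noteq> 0" "t y \<noteq> 0 \<Longrightarrow> space_le X (mccord_map X t) y" by auto
qed

text \<open>The minimum of the support lies in a down-set as soon as any vertex of the support does.
  Preimages of open sets thereby become open conditions on coordinates.\<close>

lemma mccord_map_in_down_set:
  assumes X: "t0_space X" and t: "t \<in> realization X" and W: "\<And>x y. y \<in> W \<Longrightarrow> space_le X x y \<Longrightarrow> x \<in> W"
  shows "mccord_map X t \<in> W \<longleftrightarrow> (\<exists>y\<in>W. t y \<noteq> 0)"
  using mccord_map[OF X t] W by blast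

lemma openin_order_complex_support:
  "openin (order_complex X) {t \<in> realization X. \<exists>y\<in>W. t y \<noteq> 0}"
proof -
  have "openin (powertop_real UNIV) {t. t y \<noteq> 0}" for y :: 'a
  proof -
    have c: "continuous_map (powertop_real UNIV) euclideanreal (\<lambda>t. t y)"
      by (rule continuous_map_product_projection) simp
    have "openin euclideanreal (- {0::real})" by (simp add: open_Compl)
    from openin_continuous_map_preimage[OF c this] show ?thesis by simp
  qed
  then have "openin (powertop_real UNIV) (\<Union>y\<in>W. {t. t y \<noteq> 0})" by blast
  moreover have "{t \<in> realization X. \<exists>y\<in>W. t y \<noteq> 0} = (\<Union>y\<in>W. {t. t y \<noteq> 0}) \<inter> realization X" by auto
  ultimately show ?thesis unfolding order_complex_realization openin_subtopology by blast
qed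

lemma continuous_mccord_map:
  assumes fin: "finite (topspace X)" and X: "t0_space X"
  shows "continuous_map (order_complex X) X (mccord_map X)"
  unfolding continuous_map topspace_order_complex
proof (intro conjI allI impI)
  show "mccord_map X ` realization X \<subseteq> topspace X"
    using mccord_map(1)[OF X] realization_support(1) by fastforce
  fix U assume "openin X U"
  then have U: "\<forall>y\<in>U. \<forall>x. space_le X x y \<longrightarrow> x \<in> U" using openin_iff_down_set[OF fin] by blast
  have "mccord_map X t \<in> U \<longleftrightarrow> (\<exists>y\<in>U. t y \<noteq> 0)" if "t \<in> realization X" for t
    by (rule mccord_map_in_down_set[OF X that]) (use U in auto)
  then have eq: "{t \<in> realization X. mccord_map X t \<in> U} = {t \<in> realization X. \<exists>y\<in>U. t y \<noteq> 0}" by blast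
  show "openin (order_complex X) {t \<in> realization X. mccord_map X t \<in> U}"
    unfolding eq by (rule openin_order_complex_support)
qed

section \<open>Straight-line homotopies in the geometric realization\<close>

lemma homotopic_with_linear:
  fixes f g :: "('a \<Rightarrow> real) \<Rightarrow> 'b \<Rightarrow> real" and S S'
  defines "T \<equiv> subtopology (powertop_real UNIV) S"
  assumes f: "\<And>i. continuous_map T euclideanreal (\<lambda>t. f t i)"
      and g: "\<And>i. continuous_map T euclideanreal (\<lambda>t. g t i)"
    and in_S: "\<And>s t. t \<in> S \<Longrightarrow> 0 \<le> s \<Longrightarrow> s \<le> 1 \<Longrightarrow> (\<lambda>i. (1 - s) * f t i + s * g t i) \<in> S'"
  shows "homotopic_with (\<lambda>_. True) T (subtopology (powertop_real UNIV) S') f g"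
  unfolding homotopic_with_def
proof (intro exI conjI ballI allI)
  let ?I = "top_of_set {0..1::real}"
  define h where "h = (\<lambda>(s::real, t). \<lambda>i. (1 - s) * f t i + s * g t i)"
  have "continuous_map (prod_topology ?I T) euclideanreal (\<lambda>p. h p i)" for i
  proof -
    have s: "continuous_map (prod_topology ?I T) euclideanreal fst"
      using continuous_map_fst continuous_map_in_subtopology by blast
    have "continuous_map (prod_topology ?I T) euclideanreal ((\<lambda>t. f t i) \<circ> snd)" "continuous_map
        (prod_topology ?I T) euclideanreal ((\<lambda>t. g t i) \<circ> snd)"
      using continuous_map_compose[OF continuous_map_snd f] continuous_map_compose[OF
          continuous_map_snd g] by blast+
    then have "continuous_map (prod_topology ?I T) euclideanreal (\<lambda>p. (1 - fst p) * f (snd p) i +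
        fst p * g (snd p) i)"
      using s by (intro continuous_map_add continuous_map_real_mult continuous_map_diff) (auto simp: comp_def)
    then show ?thesis by (simp add: h_def case_prod_unfold)
  qed
  then have "continuous_map (prod_topology ?I T) (powertop_real UNIV) h"
    by (simp add: continuous_map_componentwise_UNIV)
  moreover have "h ` topspace (prod_topology ?I T) \<subseteq> S'"
    using in_S by (auto simp: h_def T_def)
  ultimately show "continuous_map (prod_topology ?I T) (subtopology (powertop_real UNIV) S') h"
    by (auto simp: continuous_map_in_subtopology)
  show "h (0, x) = f x" "h (1, x) = g x" for x by (auto simp: h_def)
qed auto

lemma continuous_map_coordinate:
  "continuous_map (subtopology (powertop_real UNIV) S) euclideanreal (\<lambda>t. t i)"
  by (intro continuous_map_from_subtopology continuous_map_product_projection) simp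

text \<open>Over a fixed finite set the coordinate sum is linear in \<open>t\<close>, unlike the sum
  over the varying support.\<close>

lemma realization_iff:
  assumes "finite A" "{x. t x \<noteq> 0} \<subseteq> A"
  shows "t \<in> realization X \<longleftrightarrow> (\<forall>x. 0 \<le> t x) \<and> {x. t x \<noteq> 0} \<in> order_chains X \<and> sum t A = 1"
proof -
  have "(\<Sum>x | t x \<noteq> 0. t x) = sum t A"
    using assms by (intro sum.mono_neutral_left) auto
  then show ?thesis by (simp add: realization_def)
qed

lemma realization_convex:
  assumes fin: "finite (topspace X)" and t: "t \<in> realization X" and u: "u \<in> realization X"
    and chain: "{x. t x \<noteq> 0 \<or> u x \<noteq> 0} \<in> order_chains X" and s: "0 \<le> s" "s \<le> 1"
  shows "(\<lambda>i. (1 - s) * t i + s * u i) \<in> realization X"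
proof -
  let ?w = "\<lambda>i. (1 - s) * t i + s * u i"
  note t' = realization_support[OF t] and u' = realization_support[OF u]
  have nn: "0 \<le> ?w i" for i using s t'(2) u'(2) by simp
  have supp: "{x. ?w x \<noteq> 0} \<subseteq> {x. t x \<noteq> 0 \<or> u x \<noteq> 0}" by auto
  have sum: "sum ?w (topspace X) = 1"
    using realization_iff[OF fin t'(1)] realization_iff[OF fin u'(1)] t u
    by (simp add: sum.distrib sum_distrib_left[symmetric])
  have sub: "{x. ?w x \<noteq> 0} \<subseteq> topspace X" using supp t'(1) u'(1) by blast
  have "{x. ?w x \<noteq> 0} \<noteq> {}"
  proof
    assume "{x. ?w x \<noteq> 0} = {}"
    then have "\<And>i. ?w i = 0" by blast
    then show False using sum by simp
  qed
  then have "{x. ?w x \<noteq> 0} \<in> order_chains X"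
    using chain supp finite_subset[OF supp] unfolding order_chains_def by blast
  then show ?thesis using realization_iff[OF fin sub] nn sum by blast
qed

lemma vertex_in_realization:
  assumes "x \<in> topspace X"
  shows "(\<lambda>i. if i = x then 1 else 0) \<in> realization X"
proof -
  have "{i. (if i = x then 1 else (0::real)) \<noteq> 0} = {x}" by auto
  then show ?thesis using assms space_le_refl by (auto simp: realization_def order_chains_def)
qed

text \<open>A closed simplex is star-shaped about each of its vertices.\<close>

lemma aug_acyclic_closed_simplex:
  assumes fin: "finite (topspace X)" and C: "C \<in> order_chains X"
  shows "aug_acyclic (subtopology (order_complex X) {t. {x. t x \<noteq> 0} \<subseteq> C})"
proof -
  obtain x where x: "x \<in> C" using C by (auto simp: order_chains_def)
  have xt: "x \<in> topspace X" using C x by (auto simp: order_chains_def)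
  define S where "S = realization X \<inter> {t. {x. t x \<noteq> 0} \<subseteq> C}"
  define v where "v = (\<lambda>i. if i = x then 1 else (0::real))"
  have v: "v \<in> S" using vertex_in_realization[OF xt] x by (auto simp: S_def v_def)
  have eq: "subtopology (order_complex X) {t. {x. t x \<noteq> 0} \<subseteq> C} = subtopology (powertop_real UNIV) S"
    by (simp add: order_complex_realization subtopology_subtopology S_def)
  have "homotopic_with (\<lambda>_. True) (subtopology (powertop_real UNIV) S) (subtopology (powertop_real
      UNIV) S) id (\<lambda>_. v)"
  proof (rule homotopic_with_linear)
    fix s :: real and t assume t: "t \<in> S" and s: "0 \<le> s" "s \<le> 1"
    have sub: "{x. t x \<noteq> 0 \<or> v x \<noteq> 0} \<subseteq> C" using t v by (auto simp: S_def)
    moreover have "v x \<noteq> 0" by (simp add: v_def)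
    ultimately have "{x. t x \<noteq> 0 \<or> v x \<noteq> 0} \<in> order_chains X"
      using C finite_subset[OF sub] unfolding order_chains_def by blast
    then have "(\<lambda>i. (1 - s) * t i + s * v i) \<in> realization X"
      using realization_convex[OF fin _ _ _ s] t v by (auto simp: S_def)
    then show "(\<lambda>i. (1 - s) * id t i + s * v i) \<in> S" using sub by (auto simp: S_def)
  qed (auto simp: continuous_map_coordinate)
  then show ?thesis unfolding eq using v
    by (intro aug_acyclic_contractible contractible_space_homotopic_constI[of _ v]) auto
qed

text \<open>The fiber consists of the points whose support meets the down-set \<open>U\<close> of
  \<open>x\<close>. It is contracted in two straight moves: fade out the coordinates outside
  \<open>U\<close>, then pull to the vertex \<open>x\<close>. A single move could leave the complex,
  because vertices outside \<open>U\<close> need not be comparable with \<open>x\<close>.\<close>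

lemma aug_acyclic_mccord_fiber:
  assumes fin: "finite (topspace X)" and X: "t0_space X" and x: "x \<in> topspace X"
  shows "aug_acyclic (subtopology (order_complex X) {t \<in> realization X. mccord_map X t \<in> {y \<in> topspace
      X. space_le X y x}})"
proof -
  define U where "U = {y \<in> topspace X. space_le X y x}"
  have U: "finite U" "x \<in> U" "U \<subseteq> topspace X" using fin x space_le_refl by (auto simp: U_def)
  define S where "S = {t \<in> realization X. \<exists>y\<in>U. t y \<noteq> 0}"
  have S: "{t \<in> realization X. mccord_map X t \<in> U} = S"
    unfolding S_def
  proof (intro Collect_cong conj_cong refl)
    fix t assume "t \<in> realization X"
    then show "mccord_map X t \<in> U \<longleftrightarrow> (\<exists>y\<in>U. t y \<noteq> 0)"
      by (rule mccord_map_in_down_set[OF X]) (auto simp: U_def intro: space_le_trans dest: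
          space_le_in_topspace)
  qed
  have eq: "subtopology (order_complex X) S = subtopology (powertop_real UNIV) S"
  proof -
    have "realization X \<inter> S = S" by (auto simp: S_def)
    then show ?thesis by (simp add: order_complex_realization subtopology_subtopology)
  qed
  define v where "v = (\<lambda>i. if i = x then 1 else (0::real))"
  have v: "v \<in> S" using vertex_in_realization[OF x] U(2) by (auto simp: S_def v_def)
  \<comment> \<open>Restriction to \<open>U\<close> with renormalization; \<open>sum t U\<close> is
    positive because the support of \<open>t\<close> meets \<open>U\<close>.\<close>
  define r where "r t i = (if i \<in> U then t i / sum t U else 0)" for t :: "'a \<Rightarrow> real" and i
  have pos: "sum t U > 0" if tS: "t \<in> S" for t
  proof -
    obtain y where y: "y \<in> U" "t y \<noteq> 0" and t: "t \<in> realization X" using tS by (auto simp: S_def)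
    then have "0 < t y" using realization_support(2)[OF t, of y] by simp
    then show ?thesis using sum_pos2[OF U(1) y(1)] realization_support(2)[OF t] by blast
  qed
  have r_supp: "r t y \<noteq> 0 \<longleftrightarrow> y \<in> U \<and> t y \<noteq> 0" if "t \<in> S" for t y using pos[OF that] by (auto simp: r_def)
  have r_in: "r t \<in> S" if t: "t \<in> S" for t
  proof -
    have tR: "t \<in> realization X" using t by (simp add: S_def)
    have supp: "{y. r t y \<noteq> 0} = U \<inter> {y. t y \<noteq> 0}" using r_supp[OF t] by auto
    have "{y. r t y \<noteq> 0} \<noteq> {}" unfolding supp using t by (auto simp: S_def)
    moreover have "{y. t y \<noteq> 0} \<in> order_chains X" using tR by (simp add: realization_def)
    ultimately have "{y. r t y \<noteq> 0} \<in> order_chains X" unfolding supp using U(1)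
        by (auto simp: order_chains_def)
    moreover have "sum (r t) U = 1" using pos[OF t] by (simp add: r_def sum_divide_distrib[symmetric])
    moreover have "0 \<le> r t y" for y using pos[OF t] realization_support(2)[OF tR, of y] by (simp add: r_def)
    moreover have "{y. r t y \<noteq> 0} \<subseteq> U" using supp by auto
    ultimately have "r t \<in> realization X" using realization_iff[OF U(1)] by blast
    moreover have "\<exists>y\<in>U. r t y \<noteq> 0" using t r_supp[OF t] by (auto simp: S_def)
    ultimately show ?thesis by (simp add: S_def)
  qed
  let ?T = "subtopology (powertop_real UNIV) S"
  have r_cont: "continuous_map ?T euclideanreal (\<lambda>t. r t i)" for i
  proof (cases "i \<in> U")
    case True
    have "continuous_map ?T euclideanreal (\<lambda>t. t i / sum t U)"
    proof (rule continuous_map_real_divide)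
      show "continuous_map ?T euclideanreal (\<lambda>t. sum t U)"
        by (rule continuous_map_sum[OF U(1)]) (rule continuous_map_coordinate)
      show "sum t U \<noteq> 0" if "t \<in> topspace ?T" for t using pos[of t] that by simp
    qed (rule continuous_map_coordinate)
    then show ?thesis using True by (simp add: r_def)
  qed (simp add: r_def)
  have conv: "(\<lambda>i. (1 - s) * t i + s * u i) \<in> S"
    if t: "t \<in> S" and u: "u \<in> S" and s: "0 \<le> s" "s \<le> 1"
        and chain: "{y. t y \<noteq> 0 \<or> u y \<noteq> 0} \<in> order_chains X" for s t u
  proof -
    have tu: "t \<in> realization X" "u \<in> realization X" using t u by (auto simp: S_def)
    have R: "(\<lambda>i. (1 - s) * t i + s * u i) \<in> realization X" by (rule realization_convex[OF fin tu chain s])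
    have "\<exists>y\<in>U. (1 - s) * t y + s * u y \<noteq> 0"
    proof -
      obtain y z where yz: "y \<in> U" "t y \<noteq> 0" "z \<in> U" "u z \<noteq> 0" using t u by (auto simp: S_def)
      have nn: "0 \<le> (1 - s) * t w" "0 \<le> s * u w" for w
          using s realization_support(2)[OF tu(1)] realization_support(2)[OF tu(2)] by simp_all
      show ?thesis
      proof (cases "s = 0")
        case True
        then show ?thesis using yz by auto
      next
        case False
        then have "0 < s * u z" using yz(4) s nn(2)[of z] by (metis mult_eq_0_iff order_le_less)
        then show ?thesis using yz(3) nn(1)[of z] by (intro bexI[of _ z]) auto
      qed
    qed
    then show ?thesis using R by (simp add: S_def)
  qed
  have "homotopic_with (\<lambda>_. True) ?T ?T id r"
  proof (rule homotopic_with_linear)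
    fix s :: real and t assume t: "t \<in> S" and s: "0 \<le> s" "s \<le> 1"
    have "{y. t y \<noteq> 0 \<or> r t y \<noteq> 0} = {y. t y \<noteq> 0}" using r_supp[OF t] by auto
    then have "{y. t y \<noteq> 0 \<or> r t y \<noteq> 0} \<in> order_chains X" using t by (auto simp: S_def realization_def)
    then show "(\<lambda>i. (1 - s) * id t i + s * r t i) \<in> S" using conv[OF t r_in[OF t] s] by simp
  qed (auto simp: continuous_map_coordinate r_cont)
  moreover have "homotopic_with (\<lambda>_. True) ?T ?T r (\<lambda>_. v)"
  proof (rule homotopic_with_linear)
    fix s :: real and t assume t: "t \<in> S" and s: "0 \<le> s" "s \<le> 1"
    \<comment> \<open>The support of \<open>r t\<close> lies below \<open>x\<close>, so it remains a
      chain when \<open>x\<close> is added.\<close>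
    have supp: "{y. r t y \<noteq> 0 \<or> v y \<noteq> 0} = insert x {y. r t y \<noteq> 0}" by (auto simp: v_def)
    have "{y. r t y \<noteq> 0} \<in> order_chains X" using r_in[OF t] by (auto simp: S_def realization_def)
    moreover have "\<forall>y\<in>{y. r t y \<noteq> 0}. space_le X y x" using r_supp[OF t] by (auto simp: U_def)
    ultimately have "{y. r t y \<noteq> 0 \<or> v y \<noteq> 0} \<in> order_chains X"
      unfolding supp order_chains_def using x space_le_refl by auto
    then show "(\<lambda>i. (1 - s) * r t i + s * v i) \<in> S" using conv[OF r_in[OF t] v s] by simp
  qed (auto simp: r_cont)
  ultimately have "homotopic_with (\<lambda>_. True) ?T ?T id (\<lambda>_. v)" by (rule homotopic_with_trans)
  then have "aug_acyclic ?T" using v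
    by (intro aug_acyclic_contractible contractible_space_homotopic_constI[of _ v]) auto
  then show ?thesis using S eq unfolding U_def by simp
qed

section \<open>Carried chain maps and homology classes\<close>

text \<open>An augmentation-preserving chain map with carrier \<open>K\<close>. The augmentation
  module is the same for all subspaces, so \<open>aug_unit\<close> is an admissible value at the
  empty list whatever \<open>K []\<close> is.\<close>

definition carried ::
    "('a \<Rightarrow> 'a \<Rightarrow> bool) \<Rightarrow> 'a set \<Rightarrow> 'e topology \<Rightarrow> ('a list \<Rightarrow> 'e set) \<Rightarrow> ('a list \<Rightarrow> 'e chain) \<Rightarrow> bool"
  where "carried R A E K \<psi> \<longleftrightarrow> \<psi> [] = aug_unit \<and>
    (\<forall>n. \<forall>l\<in>chain_lists R A n. \<psi> l \<in> aug_chains (subtopology E (K l)) n \<and>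
        aug_boundary n (\<psi> l) = frag_extend \<psi> (face_sum l))"

lemma carriedD:
  assumes "carried R A E K \<psi>"
  shows "\<psi> [] = aug_unit" "l \<in> chain_lists R A n \<Longrightarrow> \<psi> l \<in> aug_chains (subtopology E (K l)) n"
    "l \<in> chain_lists R A n \<Longrightarrow> \<psi> l \<in> aug_chains E n"
    "l \<in> chain_lists R A n \<Longrightarrow> aug_boundary n (\<psi> l) = frag_extend \<psi> (face_sum l)"
  using assms aug_chains_subtopology unfolding carried_def by blast+

lemma carried_mono:
  assumes "carried R A E K \<psi>" "\<And>n l. l \<in> chain_lists R A n \<Longrightarrow> l \<noteq> [] \<Longrightarrow> topspace E \<inter> K l \<subseteq> K' l"
  shows "carried R A E K' \<psi>"
  unfolding carried_def
proof (intro conjI allI ballI)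
  fix n l assume l: "l \<in> chain_lists R A n"
  show "\<psi> l \<in> aug_chains (subtopology E (K' l)) n"
  proof (cases "l = []")
    case True
    then show ?thesis using l carriedD(1)[OF assms(1)] aug_unit_in
        by (auto simp: chain_lists_def simp del: aug_chains_simps)
  next
    case False
    have "\<psi> l \<in> aug_chains (subtopology E (topspace E \<inter> K l)) n"
      using carriedD(2)[OF assms(1) l] by (simp add: subtopology_restrict)
    then show ?thesis using aug_chains_mono[OF assms(2)[OF l False]] by blast
  qed
qed (use carriedD[OF assms(1)] in auto)

lemma frag_extend_carried:
  assumes "carried R A E K \<psi>" "c \<in> list_chains R A n"
  shows "frag_extend \<psi> c \<in> aug_chains E n" "aug_boundary n (frag_extend \<psi> c)
      = frag_extend \<psi> (list_boundary c)"
proof -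
  show "frag_extend \<psi> c \<in> aug_chains E n"
    using assms(2) carriedD(3)[OF assms(1)]
    by (intro frag_extend_in_subgroup[OF frag_subgroup_aug_chains]) (auto simp: list_chains_def simp
        del: aug_chains_simps)
  show "aug_boundary n (frag_extend \<psi> c) = frag_extend \<psi> (list_boundary c)"
    by (rule chain_map_frag_extend[OF carriedD(4)[OF assms(1)] assms(2)])
qed

text \<open>The empty list is a face of every vertex, yet no inclusion of \<open>K []\<close> into
  other values is available. The empty subspace takes its place; its augmented complex consists of
  the unit alone.\<close>

lemma carried_lift:
  assumes mono: "\<And>l l' n. l \<in> chain_lists R A n \<Longrightarrow> l' \<in> Poly_Mapping.keys (face_sum l) \<Longrightarrow> l' \<noteq> [] \<Longrightarrow> K l' \<subseteq> K l"
    and ac: "\<And>l n. l \<in> chain_lists R A n \<Longrightarrow> l \<noteq> [] \<Longrightarrow> aug_acyclic (subtopology E (K l))"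
    and h0: "h0 \<in> aug_chains (subtopology E {}) k" "aug_boundary k h0 = g []"
    and g: "\<And>l n. l \<in> chain_lists R A (Suc n) \<Longrightarrow> g l \<in> aug_chains (subtopology E (K l)) (n + k) \<and>
      aug_boundary (n + k) (g l) = frag_cmul s (frag_extend g (face_sum l))"
  obtains H where "H [] = h0"
    "\<And>l n. l \<in> chain_lists R A n \<Longrightarrow> H l \<in> aug_chains (subtopology E (K l)) (n + k)"
    "\<And>l n. l \<in> chain_lists R A n \<Longrightarrow> aug_boundary (n + k) (H l)
        = g l - frag_cmul s (frag_extend H (face_sum l))"
proof -
  define L where "L = {l. sorted_wrt R l \<and> set l \<subseteq> A}"
  have L: "l \<in> L \<longleftrightarrow> l \<in> chain_lists R A (length l)" for l by (auto simp: L_def chain_lists_def)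
  define S where "S l = aug_chains (subtopology E (if l = [] then {} else K l))" for l
  obtain H where H: "H [] = h0" "\<And>l. l \<in> L \<Longrightarrow> H l \<in> S l (length l + k)"
    "\<And>l. l \<in> L \<Longrightarrow> aug_boundary (length l + k) (H l) = g l - frag_cmul s (frag_extend H (face_sum l))"
  proof (rule acyclic_carrier_lift[where S=S and D=aug_boundary and L=L and g=g and k=k and s=s and ?h0.0=h0])
    show "frag_subgroup (S l n)" for l n unfolding S_def by (rule frag_subgroup_aug_chains)
    show "S l' n \<subseteq> S l n" if "l \<in> L" "l' \<in> Poly_Mapping.keys (face_sum l)" for l l' n
    proof -
      have "l \<noteq> []" using that(2) by auto
      then show ?thesis
        unfolding S_def using mono[OF _ that(2)] that(1) L by (intro aug_chains_mono) auto
    qed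
    show "Poly_Mapping.keys (face_sum l) \<subseteq> L" if l: "l \<in> L" for l
    proof
      fix l' assume "l' \<in> Poly_Mapping.keys (face_sum l)"
      from keys_face_sum(2)[OF this] keys_face_sum(3)[OF this, of R] show "l' \<in> L" using l
          by (auto simp: L_def)
    qed
    show "\<exists>t\<in>S l (Suc n). aug_boundary (Suc n) t = c"
      if l: "l \<in> L" "l \<noteq> []" and c: "c \<in> S l n" "aug_boundary n c = 0" for l n c
    proof -
      have "l \<in> chain_lists R A (length l)" using l(1) L by blast
      from aug_acyclicD[OF ac[OF this l(2)] _ c(2)] show ?thesis
        using c(1) unfolding S_def if_not_P[OF l(2)] by blast
    qed
    show "h0 \<in> S [] k" unfolding S_def using h0(1) by (simp only: if_P)
    show "g l \<in> S l (m + k) \<and> aug_boundary (m + k) (g l) = frag_cmul s (frag_extend g (face_sum l))"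
      if l: "l \<in> L" "length l = Suc m" for l m
    proof -
      have "l \<in> chain_lists R A (Suc m)" "l \<noteq> []" using l L by auto
      then show ?thesis using g[of l m] unfolding S_def by (simp only: if_False)
    qed
  qed (auto simp: aug_boundary_diff h0(2))
  show ?thesis
  proof (rule that[of H])
    show "H [] = h0" by (rule H(1))
    fix n l assume "l \<in> chain_lists R A n"
    then have l: "l \<in> L" "length l = n" using L by (auto simp: chain_lists_def)
    have "S l (n + k) \<subseteq> aug_chains (subtopology E (K l)) (n + k)"
      unfolding S_def by (rule aug_chains_mono) auto
    then show "H l \<in> aug_chains (subtopology E (K l)) (n + k)" using H(2)[OF l(1)] l(2) by auto
    show "aug_boundary (n + k) (H l) = g l - frag_cmul s (frag_extend H (face_sum l))"
        using H(3)[OF l(1)] l(2) by simp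
  qed
qed

lemma carried_exists:
  assumes mono: "\<And>l l' n. l \<in> chain_lists R A n \<Longrightarrow> l' \<in> Poly_Mapping.keys (face_sum l) \<Longrightarrow> l' \<noteq> [] \<Longrightarrow> K l' \<subseteq> K l"
    and ac: "\<And>l n. l \<in> chain_lists R A n \<Longrightarrow> l \<noteq> [] \<Longrightarrow> aug_acyclic (subtopology E (K l))"
  shows "\<exists>\<psi>. carried R A E K \<psi>"
proof -
  obtain H where H: "H [] = aug_unit"
    "\<And>l n. l \<in> chain_lists R A n \<Longrightarrow> H l \<in> aug_chains (subtopology E (K l)) (n + 0)"
    "\<And>l n. l \<in> chain_lists R A n \<Longrightarrow> aug_boundary (n + 0) (H l)
        = 0 - frag_cmul (- 1) (frag_extend H (face_sum l))"
  proof (rule carried_lift[where R=R and A=A and E=E and K=K and k=0 and g="\<lambda>_. 0" and s="- 1"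
      and ?h0.0=aug_unit])
    show "aug_unit \<in> aug_chains (subtopology E {}) 0" by (rule aug_unit_in)
    show "0 \<in> aug_chains (subtopology E (K l)) (n + 0) \<and>
        aug_boundary (n + 0) 0 = frag_cmul (- 1) (frag_extend (\<lambda>_. 0) (face_sum l))" for l n
    proof
      show "0 \<in> aug_chains (subtopology E (K l)) (n + 0)"
          by (rule frag_module.subspace_0[OF frag_subgroup_aug_chains])
    qed (simp add: frag_extend_eq_0)
  qed (erule (2) mono, erule (1) ac, auto)
  then have "carried R A E K H" by (simp add: carried_def del: aug_chains_simps)
  then show ?thesis by (intro exI[of _ H])
qed

text \<open>The carrier lift is applied to the difference of the two maps. The resulting homotopy is
  zero at the empty list, so for \<open>m = 0\<close> the boundary of \<open>c\<close> contributes
  nothing even if \<open>c\<close> has nonzero augmentation.\<close>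

lemma carried_homotopic:
  assumes \<psi>: "carried R A E K \<psi>" and \<psi>': "carried R A E K \<psi>'"
    and mono: "\<And>l l' n. l \<in> chain_lists R A n \<Longrightarrow> l' \<in> Poly_Mapping.keys (face_sum l) \<Longrightarrow> l' \<noteq> [] \<Longrightarrow> K l' \<subseteq> K l"
    and ac: "\<And>l n. l \<in> chain_lists R A n \<Longrightarrow> l \<noteq> [] \<Longrightarrow> aug_acyclic (subtopology E (K l))"
    and c: "c \<in> list_chains R A (Suc m)" "m = 0 \<or> list_boundary c = 0"
  shows "\<exists>t\<in>aug_chains E (Suc (Suc m)). frag_extend \<psi> c - frag_extend \<psi>' c = aug_boundary (Suc (Suc m)) t"
proof -
  define g where "g l = \<psi> l - \<psi>' l" for l
  obtain H where H: "H [] = 0"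
    "\<And>l n. l \<in> chain_lists R A n \<Longrightarrow> H l \<in> aug_chains (subtopology E (K l)) (n + 1)"
    "\<And>l n. l \<in> chain_lists R A n \<Longrightarrow> aug_boundary (n + 1) (H l)
        = g l - frag_cmul 1 (frag_extend H (face_sum l))"
  proof (rule carried_lift[where R=R and A=A and E=E and K=K and k=1 and g=g and s=1 and ?h0.0=0])
    show "0 \<in> aug_chains (subtopology E {}) 1" by (rule frag_module.subspace_0[OF frag_subgroup_aug_chains])
    show "aug_boundary 1 0 = g []" using carriedD(1)[OF \<psi>] carriedD(1)[OF \<psi>'] by (simp add: g_def)
    show "g l \<in> aug_chains (subtopology E (K l)) (n + 1) \<and>
        aug_boundary (n + 1) (g l) = frag_cmul 1 (frag_extend g (face_sum l))"
      if l: "l \<in> chain_lists R A (Suc n)" for l n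
      using carriedD(2,4)[OF \<psi> l] carriedD(2,4)[OF \<psi>' l] frag_module.subspace_diff[OF
          frag_subgroup_aug_chains]
      by (simp add: g_def[abs_def] aug_boundary_diff frag_extend_minus_fun del: aug_chains_simps)
  qed (erule (2) mono, erule (1) ac, auto)
  have keys: "l \<in> chain_lists R A (Suc m)" if "l \<in> Poly_Mapping.keys c" for l
    using that c(1) by (auto simp: list_chains_def)
  have "aug_boundary (Suc (Suc m)) (frag_extend H c) = frag_extend (\<lambda>l. aug_boundary (Suc (Suc m)) (H l)) c"
    by (rule frag_extend_additive) (rule aug_boundary_diff)
  also have "\<dots> = frag_extend (\<lambda>l. g l - frag_extend H (face_sum l)) c"
  proof (rule frag_extend_eq)
    fix l assume "l \<in> Poly_Mapping.keys c"
    then show "aug_boundary (Suc (Suc m)) (H l) = g l - frag_extend H (face_sum l)"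
      using H(3)[OF keys] by simp
  qed
  also have "\<dots> = frag_extend \<psi> c - frag_extend \<psi>' c - frag_extend (\<lambda>l. frag_extend H (face_sum l)) c"
    by (simp add: frag_extend_minus_fun g_def)
  also have "frag_extend (\<lambda>l. frag_extend H (face_sum l)) c = frag_extend H (list_boundary c)"
    unfolding list_boundary_def by (rule frag_extend_additive[symmetric]) (rule frag_extend_diff)
  also have "frag_extend H (list_boundary c) = 0"
    using c(2)
  proof
    assume "m = 0"
    then have "list_boundary c \<in> list_chains R A 0" using c(1) list_boundary_in_list_chains by blast
    then have "Poly_Mapping.keys (list_boundary c) \<subseteq> {[]}" by (auto simp: list_chains_def chain_lists_def)
    then show ?thesis using H(1) by (intro frag_extend_eq_0) auto
  qed simp
  finally have "frag_extend \<psi> c - frag_extend \<psi>' c = aug_boundary (Suc (Suc m)) (frag_extend H c)" by simp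
  moreover have "frag_extend H c \<in> aug_chains E (Suc (Suc m))"
  proof (rule frag_extend_in_subgroup[OF frag_subgroup_aug_chains])
    fix l assume "l \<in> Poly_Mapping.keys c"
    then show "H l \<in> aug_chains E (Suc (Suc m))" using H(2)[OF keys] aug_chains_subtopology by fastforce
  qed
  ultimately show ?thesis by blast
qed

section \<open>Push-forward of carried chain maps along continuous maps\<close>

lemma frag_extend_aug_map:
  assumes "c \<in> list_chains R A n"
  shows "frag_extend (\<lambda>l. aug_map (length l) f (\<psi> l)) c = aug_map n f (frag_extend \<psi> c)"
proof -
  have "aug_map n f (frag_extend \<psi> c) = frag_extend (\<lambda>l. aug_map n f (\<psi> l)) c"
    by (rule frag_extend_additive) (rule aug_map_diff)
  also have "\<dots> = frag_extend (\<lambda>l. aug_map (length l) f (\<psi> l)) c"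
    using assms by (intro frag_extend_eq) (auto simp: list_chains_def chain_lists_def)
  finally show ?thesis by simp
qed

lemma carried_map:
  assumes \<psi>: "carried R A E K \<psi>" and f: "continuous_map E E' f"
    and K: "\<And>l n. l \<in> chain_lists R A n \<Longrightarrow> l \<noteq> [] \<Longrightarrow> f ` (topspace E \<inter> K l) \<subseteq> K' l"
  shows "carried R A E' K' (\<lambda>l. aug_map (length l) f (\<psi> l))"
  unfolding carried_def
proof (intro conjI allI ballI)
  show "aug_map (length []) f (\<psi> []) = aug_unit" using carriedD(1)[OF \<psi>] by simp
  fix n l assume l: "l \<in> chain_lists R A n"
  have len: "length l = n" using l by (simp add: chain_lists_def)
  show "aug_map (length l) f (\<psi> l) \<in> aug_chains (subtopology E' (K' l)) n"
  proof (cases "l = []")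
    case True
    then show ?thesis using len carriedD(1)[OF \<psi>] aug_unit_in by (auto simp del: aug_chains_simps)
  next
    case False
    have "continuous_map (subtopology E (K l)) (subtopology E' (K' l)) f"
      using f K[OF l False] by (auto simp: continuous_map_in_subtopology intro:
          continuous_map_from_subtopology)
    then show ?thesis unfolding len by (rule aug_map_in[OF carriedD(2)[OF \<psi> l]])
  qed
  show "aug_boundary n (aug_map (length l) f (\<psi> l))
      = frag_extend (\<lambda>l. aug_map (length l) f (\<psi> l)) (face_sum l)"
  proof (cases n)
    case 0
    then show ?thesis using len by simp
  next
    case (Suc m)
    then have "face_sum l \<in> list_chains R A m" using face_sum_in_list_chains l by blast
    then show ?thesis
      using aug_boundary_map[OF carriedD(3)[OF \<psi> l], of f] carriedD(4)[OF \<psi> l] Suc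
      by (simp add: len frag_extend_aug_map)
  qed
qed

text \<open>Cycles for unreduced homology: in dimension \<open>0\<close> the boundary of lists is
  the augmentation, which must be ignored.\<close>

definition list_cycles :: "('a \<Rightarrow> 'a \<Rightarrow> bool) \<Rightarrow> 'a set \<Rightarrow> nat \<Rightarrow> ('a list \<Rightarrow>\<^sub>0 int) set"
  where "list_cycles R A m = {c \<in> list_chains R A (Suc m). m = 0 \<or> list_boundary c = 0}"

section \<open>Homology classes represented by simplicial cycles\<close>

lemma singular_relcycle_carried:
  assumes \<psi>: "carried R A E K \<psi>" and z: "z \<in> list_cycles R A m"
  shows "singular_relcycle m E {} (frag_extend \<psi> z)"
proof -
  have z': "z \<in> list_chains R A (Suc m)" "m = 0 \<or> list_boundary z = 0" using z by (auto simp: list_cycles_def)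
  have "chain_boundary m (frag_extend \<psi> z) = 0"
  proof (cases m)
    case (Suc k)
    then show ?thesis using frag_extend_carried(2)[OF \<psi> z'(1)] z'(2) by simp
  qed (simp add: chain_boundary_def)
  then show ?thesis using frag_extend_carried(1)[OF \<psi> z'(1)] by (simp add: singular_cycle)
qed

lemma homologous_rel_set_eqI:
  assumes "\<exists>t\<in>aug_chains E (Suc (Suc m)). a - b = aug_boundary (Suc (Suc m)) t"
  shows "homologous_rel_set m E {} a = homologous_rel_set m E {} b"
proof -
  have "singular_relboundary m E {} (a - b)" using assms by (auto simp: singular_boundary)
  then have "homologous_rel m E {} a b" by (simp add: homologous_rel_def)
  then show ?thesis by (simp only: homologous_rel_set_eq)
qed

lemma homologous_rel_set_add:
  assumes "singular_relcycle m E {} a" "singular_relcycle m E {} b"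
  shows "homologous_rel_set m E {} (a + b)
    = homologous_rel_set m E {} a \<otimes>\<^bsub>homology_group (int m) E\<^esub> homologous_rel_set m E {} b"
  unfolding mult_relative_homology_group
proof
  show "homologous_rel_set m E {} (a + b) \<subseteq> (\<Union>r\<in>homologous_rel_set m E {} a. \<Union>s\<in>homologous_rel_set
      m E {} b. {r + s})"
  proof
    fix x assume "x \<in> homologous_rel_set m E {} (a + b)"
    then have "homologous_rel m E {} b (x - a)"
      by (simp add: homologous_rel_def algebra_simps)
    then show "x \<in> (\<Union>r\<in>homologous_rel_set m E {} a. \<Union>s\<in>homologous_rel_set m E {} b. {r + s})"
      by (intro UN_I[of a] UN_I[of "x - a"]) auto
  qed
  show "(\<Union>r\<in>homologous_rel_set m E {} a. \<Union>s\<in>homologous_rel_set m E {} b. {r + s}) \<subseteq>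
      homologous_rel_set m E {} (a + b)"
    by (auto intro: homologous_rel_add)
qed

text \<open>Surjectivity is exactness of the cone at \<open>(c, s)\<close>, with
  \<open>c = 0\<close> in positive dimensions; in dimension \<open>0\<close>, \<open>c\<close>
  records the augmentation of \<open>s\<close>.\<close>

lemma homology_class_carried_surj:
  assumes \<psi>: "carried R A E K \<psi>" and ex: "cone_exact R \<psi> A E"
    and q: "q \<in> carrier (homology_group (int m) E)"
  shows "\<exists>z\<in>list_cycles R A m. q = homologous_rel_set m E {} (frag_extend \<psi> z)"
proof -
  obtain s where s: "singular_relcycle m E {} s" "q = homologous_rel_set m E {} s"
    using q by (auto simp: carrier_relative_homology_group)
  have sc: "s \<in> aug_chains E (Suc m)" using s(1) by (simp add: singular_cycle)
  have "\<exists>c\<in>list_chains R A m. list_boundary c = 0 \<and>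
      aug_boundary (Suc m) s = frag_extend \<psi> c \<and> (m = 0 \<or> c = 0)"
  proof (cases m)
    case 0
    obtain k where k: "aug_boundary (Suc m) s = frag_cmul k aug_unit" using aug_boundary_in[OF sc] 0 by auto
    have "frag_cmul k (frag_of []) \<in> list_chains R A m"
      by (rule frag_module.subspace_scale[OF frag_subgroup_list_chains]) (simp add: 0 chain_lists_def)
    then show ?thesis using k 0 carriedD(1)[OF \<psi>]
        by (intro bexI[of _ "frag_cmul k (frag_of [])"]) (auto simp: frag_extend_cmul)
  next
    case (Suc k)
    then have "aug_boundary (Suc m) s = 0" using s(1) by (simp add: singular_cycle)
    then show ?thesis using frag_module.subspace_0[OF frag_subgroup_list_chains] by (intro bexI[of _ 0]) auto
  qed
  then obtain c where c: "c \<in> list_chains R A m" "list_boundary c = 0" "aug_boundary (Suc m) s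
      = frag_extend \<psi> c" "m = 0 \<or> c = 0"
    by blast
  obtain z t where z: "z \<in> list_chains R A (Suc m)" "t \<in> aug_chains E (Suc (Suc m))"
    "list_boundary z = c" "frag_extend \<psi> z - s = aug_boundary (Suc (Suc m)) t"
    by (rule cone_exactD[OF ex c(1) sc c(2,3)])
  have "z \<in> list_cycles R A m" using z(1,3) c(4) by (auto simp: list_cycles_def)
  moreover have "q = homologous_rel_set m E {} (frag_extend \<psi> z)"
    unfolding s(2) by (rule homologous_rel_set_eqI[symmetric]) (use z in blast)
  ultimately show ?thesis by blast
qed

text \<open>Injectivity is exactness of the cone at \<open>(z, t)\<close>, where \<open>t\<close>
  bounds the image of \<open>z\<close>. This needs a genuine cycle: in dimension \<open>0\<close>
  the augmentation of \<open>z\<close> is zero because its image bounds and \<psi> preserves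
  augmentations.\<close>

lemma homology_class_carried_eq_one:
  assumes \<psi>: "carried R A E K \<psi>" and ex: "cone_exact R \<psi> A E" and z: "z \<in> list_cycles R A m"
  shows "homologous_rel_set m E {} (frag_extend \<psi> z) = \<one>\<^bsub>homology_group (int m) E\<^esub>
    \<longleftrightarrow> z \<in> list_boundary ` list_chains R A (Suc (Suc m))"
proof
  have z': "z \<in> list_chains R A (Suc m)" "m = 0 \<or> list_boundary z = 0" using z by (auto simp: list_cycles_def)
  assume "homologous_rel_set m E {} (frag_extend \<psi> z) = \<one>\<^bsub>homology_group (int m) E\<^esub>"
  then have "singular_relboundary m E {} (frag_extend \<psi> z)" by (simp add: homologous_rel_set_eq_relboundary)
  then obtain t where t: "t \<in> aug_chains E (Suc (Suc m))" "aug_boundary (Suc (Suc m)) t = frag_extend \<psi> z"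
    by (auto simp: singular_boundary)
  have "list_boundary z = 0"
    using z'(2)
  proof
    assume m: "m = 0"
    have "frag_extend \<psi> (list_boundary z) = 0"
      using aug_boundary_boundary[OF t(1)] frag_extend_carried(2)[OF \<psi> z'(1)] t(2) by simp
    moreover have "list_boundary z \<in> list_chains R A 0" using list_boundary_in_list_chains z'(1) m by blast
    then obtain k where k: "list_boundary z = frag_cmul k (frag_of [])" using list_chains_0 by blast
    ultimately have "frag_cmul k (aug_unit :: 'b chain) = 0" using carriedD(1)[OF \<psi>]
        by (simp add: frag_extend_cmul)
    then show "list_boundary z = 0" using k by (simp add: aug_unit_def)
  qed
  then obtain c s where "c \<in> list_chains R A (Suc (Suc m))" "s \<in> aug_chains E (Suc (Suc (Suc m)))"
      "list_boundary c = z"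
      "frag_extend \<psi> c - t = aug_boundary (Suc (Suc (Suc m))) s"
    using cone_exactD[OF ex z'(1) t(1) _ t(2)] by metis
  then show "z \<in> list_boundary ` list_chains R A (Suc (Suc m))" by blast
next
  assume "z \<in> list_boundary ` list_chains R A (Suc (Suc m))"
  then obtain c where c: "c \<in> list_chains R A (Suc (Suc m))" "z = list_boundary c" by blast
  have "singular_relboundary m E {} (frag_extend \<psi> z)"
    using frag_extend_carried[OF \<psi> c(1)] c(2) by (auto simp: singular_boundary)
  then show "homologous_rel_set m E {} (frag_extend \<psi> z) = \<one>\<^bsub>homology_group (int m) E\<^esub>"
    by (simp add: homologous_rel_set_eq_relboundary)
qed

lemma hom_induced_carried:
  assumes \<psi>: "carried R A E K \<psi>" and f: "continuous_map E E' f" and z: "z \<in> list_cycles R A m"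
  shows "hom_induced (int m) E {} E' {} f (homologous_rel_set m E {} (frag_extend \<psi> z))
    = homologous_rel_set m E' {} (frag_extend (\<lambda>l. aug_map (length l) f (\<psi> l)) z)"
proof -
  have "z \<in> list_chains R A (Suc m)" using z by (simp add: list_cycles_def)
  then show ?thesis
    using hom_induced_chain_map[OF f _ singular_relcycle_carried[OF \<psi> z], of "{}"]
    by (simp add: frag_extend_aug_map)
qed

text \<open>Compatible maps let the same simplicial cycles compute the homology of both spaces, so
  in terms of these cycles \<open>f\<close> acts as the identity.\<close>

lemma inj_on_hom_induced_carried:
  assumes \<psi>: "carried R A E K \<psi>" and ex: "cone_exact R \<psi> A E" and f: "continuous_map E E' f"
    and f\<psi>: "carried R A E' K' (\<lambda>l. aug_map (length l) f (\<psi> l))"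
        and ex': "cone_exact R (\<lambda>l. aug_map (length l) f (\<psi> l)) A E'"
  shows "inj_on (hom_induced (int m) E {} E' {} f) (carrier (homology_group (int m) E))"
proof -
  interpret group_hom "homology_group (int m) E" "homology_group (int m) E'" "hom_induced
      (int m) E {} E' {} f"
    by (simp add: group_hom_def group_hom_axioms_def hom_induced_empty_hom)
  show ?thesis
    unfolding inj_on_one_iff
  proof (intro allI impI)
    fix q assume q: "q \<in> carrier (homology_group (int m) E)"
        and one: "hom_induced (int m) E {} E' {} f q = \<one>\<^bsub>homology_group (int m) E'\<^esub>"
    obtain z where z: "z \<in> list_cycles R A m" "q = homologous_rel_set m E {} (frag_extend \<psi> z)"
      using homology_class_carried_surj[OF \<psi> ex q] by blast
    have "z \<in> list_boundary ` list_chains R A (Suc (Suc m))"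
      using homology_class_carried_eq_one[OF f\<psi> ex' z(1)] hom_induced_carried[OF \<psi> f z(1)] one z(2) by simp
    then show "q = \<one>\<^bsub>homology_group (int m) E\<^esub>"
      using homology_class_carried_eq_one[OF \<psi> ex z(1)] z(2) by simp
  qed
qed

text \<open>For an injective map any preimage in the carrier is the value of
  \<open>inv_into\<close>, and the class of \<open>\<psi> z\<close> is such a preimage.\<close>

lemma inv_hom_induced_carried:
  assumes \<psi>: "carried R A E K \<psi>" and ex: "cone_exact R \<psi> A E" and f: "continuous_map E E' f"
    and f\<psi>: "carried R A E' K' (\<lambda>l. aug_map (length l) f (\<psi> l))"
        and ex': "cone_exact R (\<lambda>l. aug_map (length l) f (\<psi> l)) A E'"
    and z: "z \<in> list_cycles R A m"
  shows "inv_into (carrier (homology_group (int m) E)) (hom_induced (int m) E {} E' {} f)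
      (homologous_rel_set m E' {} (frag_extend (\<lambda>l. aug_map (length l) f (\<psi> l)) z))
    = homologous_rel_set m E {} (frag_extend \<psi> z)"
proof (rule inv_into_f_eq)
  show "inj_on (hom_induced (int m) E {} E' {} f) (carrier (homology_group (int m) E))"
    by (rule inj_on_hom_induced_carried[OF \<psi> ex f f\<psi> ex'])
  show "homologous_rel_set m E {} (frag_extend \<psi> z) \<in> carrier (homology_group (int m) E)"
    using singular_relcycle_carried[OF \<psi> z] by (auto simp: carrier_relative_homology_group)
  show "hom_induced (int m) E {} E' {} f (homologous_rel_set m E {} (frag_extend \<psi> z))
    = homologous_rel_set m E' {} (frag_extend (\<lambda>l. aug_map (length l) f (\<psi> l)) z)"
    by (rule hom_induced_carried[OF \<psi> f z])
qed

section \<open>Covers of finite spaces\<close>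

lemma space_le_refl_subset: "x \<in> A \<Longrightarrow> A \<subseteq> topspace X \<Longrightarrow> space_le X x x"
  by (rule space_le_refl) blast

text \<open>The covering theorem for a subspace \<open>A\<close> of a finite space, in terms of
  carriers: each down-closed set that contains the vertices of \<open>l\<close> has to receive the
  carrier of \<open>l\<close> under \<open>p\<close>.\<close>

lemma carried_cone_exact:
  fixes p :: "'e \<Rightarrow> 'a"
  assumes fin: "finite (topspace X)" and X: "t0_space X" and A: "A \<subseteq> topspace X"
    and R: "\<And>x y. R x y \<Longrightarrow> space_le X x y \<or> space_le X y x"
    and list_ac: "\<And>x. x \<in> A \<Longrightarrow> list_acyclic R {y \<in> A. space_le X y x}"
    and p: "continuous_map E (subtopology X A) p"
    and aug_ac: "\<And>x. x \<in> A \<Longrightarrow> aug_acyclic (subtopology E {e \<in> topspace E. p e \<in> {y \<in> A. space_le X y x}})"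
    and \<psi>: "carried R A E K \<psi>"
    and K: "\<And>l n W. l \<in> chain_lists R A n \<Longrightarrow> l \<noteq> [] \<Longrightarrow> down_closed A (space_le X) W \<Longrightarrow> set l \<subseteq> W \<Longrightarrow>
      topspace E \<inter> K l \<subseteq> {e \<in> topspace E. p e \<in> W}"
  shows "cone_exact R \<psi> A E"
proof -
  have finA: "finite A" using A fin finite_subset by blast
  have pA: "{e \<in> topspace E. p e \<in> A} = topspace E"
    using p by (auto simp: continuous_map_in_subtopology)
  have "cone_exact R \<psi> A (subtopology E {e \<in> topspace E. p e \<in> A})"
  proof (rule acyclic_cover_cone_exact[OF finA, where r="space_le X" and p=p and E=E])
    show "space_le X x x" if "x \<in> A" for x by (rule space_le_refl_subset[OF that A])
    show "space_le X x z" if "space_le X x y" "space_le X y z" for x y z using that by (rule space_le_trans)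
    show "x = y" if "space_le X x y" "space_le X y x" for x y using that by (rule space_le_antisym[OF X])
    show "openin E {e \<in> topspace E. p e \<in> W}" if W: "down_closed A (space_le X) W" for W
    proof -
      \<comment> \<open>\<open>W\<close> is down-closed only within \<open>A\<close>; its
        down-closure in the whole space is open and cuts out \<open>W\<close>.\<close>
      define D where "D = {x \<in> topspace X. \<exists>y\<in>W. space_le X x y}"
      have "openin X D"
        unfolding openin_iff_down_set[OF fin] D_def by (auto intro: space_le_trans dest: space_le_in_topspace)
      moreover have "W = D \<inter> A"
      proof
        show "W \<subseteq> D \<inter> A" using W A by (auto simp: D_def down_closed_def intro!: bexI space_le_refl)
        show "D \<inter> A \<subseteq> W" using W by (auto simp: D_def down_closed_def)
      qed
      ultimately have "openin (subtopology X A) W" unfolding openin_subtopology by blast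
      then show ?thesis using p by (simp add: continuous_map)
    qed
    show "\<psi> [] = aug_unit" by (rule carriedD(1)[OF \<psi>])
    show "aug_boundary n (\<psi> l) = frag_extend \<psi> (face_sum l)" if "l \<in> chain_lists R A n" for l n
      by (rule carriedD(4)[OF \<psi> that])
    show "\<psi> l \<in> aug_chains (subtopology E {e \<in> topspace E. p e \<in> W}) n"
      if l: "l \<in> chain_lists R A n" and W: "down_closed A (space_le X) W" and lW: "set l \<subseteq> W" for l n W
    proof (cases "l = []")
      case True
      then show ?thesis using l carriedD(1)[OF \<psi>] aug_unit_in
          by (auto simp: chain_lists_def simp del: aug_chains_simps)
    next
      case False
      have "\<psi> l \<in> aug_chains (subtopology E (topspace E \<inter> K l)) n"
        using carriedD(2)[OF \<psi> l] by (simp add: subtopology_restrict)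
      then show ?thesis using aug_chains_mono[OF K[OF l False W lW]] by blast
    qed
    show "down_closed A (space_le X) A" by (auto simp: down_closed_def)
  qed (use R list_ac aug_ac in auto)
  then show ?thesis unfolding pA by simp
qed

text \<open>Chains of \<open>X\<close> are listed in descending order, so \<open>hd\<close> is the largest vertex and
  \<open>last\<close> the smallest.\<close>
definition descends :: "'a topology \<Rightarrow> 'a \<Rightarrow> 'a \<Rightarrow> bool"
  where "descends X x y \<longleftrightarrow> space_le X y x \<and> x \<noteq> y"

lemma list_acyclic_down_set:
  assumes "t0_space X" "x \<in> A" "A \<subseteq> topspace X"
  shows "list_acyclic (descends X) {y \<in> A. space_le X y x}"
  by (rule list_acyclic_top[of x])
    (use assms space_le_refl_subset[OF assms(2,3)] space_le_antisym[OF assms(1)] in \<open>auto simp: descends_def\<close>)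

lemma list_acyclic_up_set:
  assumes "t0_space X" "x \<in> A" "A \<subseteq> topspace X"
  shows "list_acyclic (descends X) {y \<in> A. space_le X x y}"
  by (rule list_acyclic_bottom[of x])
    (use assms space_le_refl_subset[OF assms(2,3)] space_le_antisym[OF assms(1)] in \<open>auto simp: descends_def\<close>)

section \<open>Chains of a finite space as descending lists\<close>

lemma chain_lists_comparable:
  assumes "l \<in> chain_lists (descends X) A n" "x \<in> set l" "y \<in> set l" "A \<subseteq> topspace X"
  shows "space_le X x y \<or> space_le X y x"
proof (cases "x = y")
  case True
  then show ?thesis using assms space_le_refl_subset[of x A X] by (auto simp: chain_lists_def)
next
  case False
  have "descends X x y \<or> descends X y x"
    using assms False unfolding chain_lists_def
    by (auto simp: in_set_conv_nth sorted_wrt_iff_nth_less) (metis linorder_neqE_nat)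
  then show ?thesis by (auto simp: descends_def)
qed

lemma set_in_order_chains:
  assumes "l \<in> chain_lists (descends X) (topspace X) n" "l \<noteq> []"
  shows "set l \<in> order_chains X"
  using chain_lists_comparable[OF assms(1)] assms by (auto simp: order_chains_def chain_lists_def)

lemma chain_lists_hd:
  assumes "l \<in> chain_lists (descends X) A n" "l \<noteq> []" "A \<subseteq> topspace X"
  shows "hd l \<in> set l \<and> (\<forall>y\<in>set l. space_le X y (hd l))"
  using assms by (cases l) (auto simp: chain_lists_def descends_def intro: space_le_refl_subset)

lemma chain_lists_last:
  assumes "l \<in> chain_lists (descends X) A n" "l \<noteq> []" "A \<subseteq> topspace X"
  shows "last l \<in> set l \<and> (\<forall>y\<in>set l. space_le X (last l) y)"
  using assms by (cases l rule: rev_cases) (auto simp: chain_lists_def descends_def sorted_wrt_append intro: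
      space_le_refl_subset)

text \<open>Since the carrier of a chain is its own vertex set, \<open>j\<close> restricts to every
  subspace. With the identity as projection, the covering theorem shows that the chains inside
  \<open>A\<close> compute the singular homology of \<open>A\<close>.\<close>

lemma cone_exact_subspace:
  assumes fin: "finite (topspace X)" and X: "t0_space X" and A: "A \<subseteq> topspace X"
    and j: "carried (descends X) (topspace X) X set j"
  shows "carried (descends X) A (subtopology X A) set j" "cone_exact (descends X) j A (subtopology X A)"
proof -
  have sub: "l \<in> chain_lists (descends X) (topspace X) n" if "l \<in> chain_lists (descends X) A n" for l n
    using that A by (auto simp: chain_lists_def)
  show j': "carried (descends X) A (subtopology X A) set j"
    unfolding carried_def
  proof (intro conjI allI ballI)
    fix n l assume l: "l \<in> chain_lists (descends X) A n"
    have "A \<inter> set l = set l" using l by (auto simp: chain_lists_def)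
    then show "j l \<in> aug_chains (subtopology (subtopology X A) (set l)) n"
      using carriedD(2)[OF j sub[OF l]] by (simp add: subtopology_subtopology)
    show "aug_boundary n (j l) = frag_extend j (face_sum l)" by (rule carriedD(4)[OF j sub[OF l]])
  qed (rule carriedD(1)[OF j])
  show "cone_exact (descends X) j A (subtopology X A)"
  proof (rule carried_cone_exact[OF fin X A _ _ _ _ j', where p="\<lambda>x. x"])
    show "list_acyclic (descends X) {y \<in> A. space_le X y x}" if "x \<in> A" for x
      by (rule list_acyclic_down_set[OF X that A])
    show "aug_acyclic (subtopology (subtopology X A) {e \<in> topspace (subtopology X A). e \<in> {y \<in> A. space_le X y
        x}})" if x: "x \<in> A" for x
    proof -
      have e: "A \<inter> {e \<in> topspace (subtopology X A). e \<in> {y \<in> A. space_le X y x}} = {y \<in> A. space_le X y x}"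
        using A by auto
      show ?thesis
        unfolding subtopology_subtopology e using A x space_le_refl_subset[OF x A]
            by (intro aug_acyclic_with_maximum[where x=x]) auto
    qed
    show "topspace (subtopology X A) \<inter> set l \<subseteq> {e \<in> topspace (subtopology X A). e \<in> W}" if "set l \<subseteq> W" for l W
      using that by auto
  qed (auto simp: descends_def)
qed

text \<open>The image of a simplicial cycle under \<open>j\<close> bounds, and exactness of the cone
  pulls the filler back. This converts singular acyclicity of the values of \<open>F\<close> into
  what a simplicial carrier needs.\<close>

lemma list_acyclic_if_acyclic:
  assumes fin: "finite (topspace X)" and X: "t0_space X" and A: "A \<subseteq> topspace X"
    and j: "carried (descends X) (topspace X) X set j" and ac: "acyclic_space (subtopology X A)"
  shows "list_acyclic (descends X) A"
  unfolding list_acyclic_def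
proof (intro allI ballI impI)
  note j' = cone_exact_subspace[OF fin X A j]
  fix n c assume c: "c \<in> list_chains (descends X) A n" "list_boundary c = 0"
  have "aug_boundary n (frag_extend j c) = 0" using frag_extend_carried(2)[OF j'(1) c(1)] c(2) by simp
  then obtain s where s: "s \<in> aug_chains (subtopology X A) (Suc n)" "aug_boundary (Suc n) s = frag_extend j c"
    using aug_acyclicD[OF aug_acyclic_if_acyclic_space[OF ac] frag_extend_carried(1)[OF j'(1) c(1)]] by blast
  obtain d t where "d \<in> list_chains (descends X) A (Suc n)" "t \<in> aug_chains (subtopology X A) (Suc (Suc n))"
    "list_boundary d = c" "frag_extend j d - s = aug_boundary (Suc (Suc n)) t"
    by (rule cone_exactD[OF j'(2) c(1) s(1) c(2) s(2)])
  then show "\<exists>d\<in>list_chains (descends X) A (Suc n). list_boundary d = c" by blast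
qed

section \<open>The induced map on simplicial chains\<close>

text \<open>A simplicial chain map imitating \<open>F\<close>: the image of \<open>l\<close> is made
  of chains inside a single value of \<open>F\<close>. If \<open>m l\<close> is a vertex of
  \<open>l\<close> outside \<open>F (m l)\<close>, then \<open>l\<close> cannot occur among
  them.\<close>

definition simplicial_selection :: "'a topology \<Rightarrow> ('a \<Rightarrow> 'a set) \<Rightarrow> ('a list \<Rightarrow> 'a) \<Rightarrow> ('a list \<Rightarrow> 'a
    list \<Rightarrow>\<^sub>0 int) \<Rightarrow> bool"
  where "simplicial_selection X F m \<phi> \<longleftrightarrow>
    (\<forall>n. \<forall>l\<in>chain_lists (descends X) (topspace X) n. \<phi> l \<in> list_chains (descends X) (topspace X) n \<and>
      (l \<noteq> [] \<longrightarrow> \<phi> l \<in> list_chains (descends X) (F (m l)) n) \<and>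
          list_boundary (\<phi> l) = frag_extend \<phi> (face_sum l))"

text \<open>The space \<open>Y\<close> is \<open>X\<close> in the upper semicontinuous case and \<open>op_space X\<close> in the lower
  semicontinuous case; \<open>m l\<close> is the largest vertex of \<open>l\<close> with respect to \<open>Y\<close>.\<close>
lemma susc_induced_simplicial:
  fixes X Y :: "'a topology" and F :: "'a \<Rightarrow> 'a set"
  defines "R \<equiv> descends X" and "T \<equiv> topspace X"
  assumes fin: "finite T" and X: "t0_space X" and Y: "t0_space Y" "topspace Y = T"
    and R: "\<And>x y. R x y \<Longrightarrow> space_le Y x y \<or> space_le Y y x"
    and list_ac: "\<And>x. x \<in> T \<Longrightarrow> list_acyclic R {y \<in> T. space_le Y y x}"
    and m: "\<And>l n. l \<in> chain_lists R T n \<Longrightarrow> l \<noteq> [] \<Longrightarrow> m l \<in> set l \<and> (\<forall>y\<in>set l. space_le Y y (m l))"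
    and F: "multimap X T F" "acyclic_values X X F" "\<And>x x'. space_le Y x' x \<Longrightarrow> F x' \<subseteq> F x"
    and j: "carried R T X set j" and i: "carried R T Y set i"
  shows "\<exists>\<phi>. simplicial_selection X F m \<phi> \<and>
      (\<forall>q. \<forall>z\<in>list_cycles R T q. susc_induced (int q) Y X F (homologous_rel_set q Y {} (frag_extend i z))
        = homologous_rel_set q X {} (frag_extend j (frag_extend \<phi> z)))"
proof -
  have FT: "F x \<subseteq> T" if "x \<in> T" for x using F(1) that by (auto simp: multimap_def T_def)
  have Fac: "acyclic_space (subtopology X (F x))" if "x \<in> T" for x using F(2) that
      by (auto simp: acyclic_values_def T_def)
  have finX: "finite (topspace X)" and finY: "finite (topspace Y)" using fin Y(2) by (simp_all add: T_def)
  have mT: "m l \<in> T" if "l \<in> chain_lists R T n" "l \<noteq> []" for l n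
    using m[OF that] that(1) by (auto simp: chain_lists_def)
  \<comment> \<open>The largest vertex of a face is below that of the simplex; this makes all
    carriers defined through \<open>m l\<close> monotone.\<close>
  have m_face: "space_le Y (m l') (m l)"
    if l: "l \<in> chain_lists R T n" and l': "l' \<in> Poly_Mapping.keys (face_sum l)" "l' \<noteq> []" for l l' n
  proof -
    have "l' \<in> chain_lists R T (length l')"
      using l keys_face_sum(2)[OF l'(1)] keys_face_sum(3)[OF l'(1), of R] by (auto simp: chain_lists_def)
    then have "m l' \<in> set l" using m[of l'] l'(2) keys_face_sum(2)[OF l'(1)] by blast
    moreover have "l \<noteq> []" using l'(1) by auto
    ultimately show ?thesis using m[OF l] by blast
  qed

  \<comment> \<open>The empty set at the empty list lies below every other value and still carries
    the empty chain.\<close>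
  define \<F> where "\<F> l = (if l = [] then {} else F (m l))" for l :: "'a list"
  have \<F>_mono: "\<F> l' \<subseteq> \<F> l" if "l \<in> chain_lists R T n" "l' \<in> Poly_Mapping.keys (face_sum l)" for l l' n
  proof -
    have "l \<noteq> []" using that(2) by auto
    then show ?thesis using F(3)[OF m_face[OF that]] by (auto simp: \<F>_def)
  qed
  have Fla: "list_acyclic R (F x)" if "x \<in> T" for x
    unfolding R_def
    by (rule list_acyclic_if_acyclic[OF finX X _ j[unfolded R_def T_def] Fac[OF that]]) (use FT[OF that]
        in \<open>simp add: T_def\<close>)
  have \<F>T: "\<F> l \<subseteq> T" if "l \<in> chain_lists R T n" for l n
    using FT[OF mT[OF that]] by (auto simp: \<F>_def)
  define L where "L = {l. sorted_wrt R l \<and> set l \<subseteq> T}"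
  have L: "l \<in> L \<longleftrightarrow> l \<in> chain_lists R T (length l)" for l by (auto simp: L_def chain_lists_def)
  obtain \<phi> where \<phi>: "\<phi> [] = frag_of []" "\<And>l. l \<in> L \<Longrightarrow> \<phi> l \<in> list_chains R (\<F> l) (length l + 0)"
    "\<And>l. l \<in> L \<Longrightarrow> list_boundary (\<phi> l) = 0 - frag_cmul (- 1) (frag_extend \<phi> (face_sum l))"
  proof (rule acyclic_carrier_lift[where S="\<lambda>l. list_chains R (\<F> l)" and D="\<lambda>_. list_boundary"
      and L=L and g="\<lambda>_. 0"
        and k=0 and s="- 1" and ?h0.0="frag_of []"])
    show "list_chains R (\<F> l') n \<subseteq> list_chains R (\<F> l) n"
        if "l \<in> L" "l' \<in> Poly_Mapping.keys (face_sum l)" for l l' n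
      using that L \<F>_mono by (intro list_chains_mono) blast
    show "Poly_Mapping.keys (face_sum l) \<subseteq> L" if l: "l \<in> L" for l
    proof
      fix l' assume "l' \<in> Poly_Mapping.keys (face_sum l)"
      from keys_face_sum(2)[OF this] keys_face_sum(3)[OF this, of R] show "l' \<in> L" using l
          by (auto simp: L_def)
    qed
    show "\<exists>t\<in>list_chains R (\<F> l) (Suc n). list_boundary t = c"
      if "l \<in> L" "l \<noteq> []" "c \<in> list_chains R (\<F> l) n" "list_boundary c = 0" for l n c
    proof -
      have "m l \<in> T" using mT that(1,2) L by blast
      then show ?thesis using Fla[of "m l"] that(2-4) unfolding list_acyclic_def \<F>_def by simp
    qed
    show "frag_of [] \<in> list_chains R (\<F> []) 0" by (simp add: chain_lists_def)
    show "0 \<in> list_chains R (\<F> l) (m + 0) \<and> list_boundary 0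
        = frag_cmul (- 1) (frag_extend (\<lambda>_. 0) (face_sum l))" for l m
    proof
      show "0 \<in> list_chains R (\<F> l) (m + 0)" by (rule frag_module.subspace_0[OF frag_subgroup_list_chains])
    qed (simp add: frag_extend_eq_0)
  qed (auto simp: frag_subgroup_list_chains)
  have \<phi>_in: "\<phi> l \<in> list_chains R (\<F> l) n" and \<phi>_bd: "list_boundary (\<phi> l) = frag_extend \<phi> (face_sum l)"
    if "l \<in> chain_lists R T n" for l n
  proof -
    have "length l = n" "l \<in> L" using that by (auto simp: chain_lists_def L_def)
    then show "\<phi> l \<in> list_chains R (\<F> l) n" "list_boundary (\<phi> l) = frag_extend \<phi> (face_sum l)"
      using \<phi>(2,3)[of l] by auto
  qed

  let ?G = "graph_space Y X F"
  \<comment> \<open>The part of the graph over the principal down-set of \<open>m l\<close>; the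
    projections send it to that down-set and, by monotonicity, into \<open>F (m l)\<close>.\<close>
  define KG where "KG l = {e \<in> topspace ?G. space_le Y (fst e) (m l)}" for l
  have fiber: "aug_acyclic (subtopology ?G {e \<in> topspace ?G. space_le Y (fst e) x})" if x: "x \<in> T" for x
    by (rule aug_acyclic_if_acyclic_space, rule acyclic_graph_fiber)
      (use F(3) FT Fac x Y(2) in \<open>simp_all add: T_def\<close>)
  have KG_ac: "aug_acyclic (subtopology ?G (KG l))" if "l \<in> chain_lists R T n" "l \<noteq> []" for l n
    unfolding KG_def by (rule fiber[OF mT[OF that]])
  have KG_mono: "KG l' \<subseteq> KG l" if "l \<in> chain_lists R T n" "l' \<in> Poly_Mapping.keys (face_sum l)"
      "l' \<noteq> []" for l l' n
    using m_face[OF that] by (auto simp: KG_def intro: space_le_trans)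
  have "\<exists>\<psi>. carried R T ?G KG \<psi>"
    by (rule carried_exists, erule (2) KG_mono, erule (1) KG_ac)
  then obtain \<psi> where \<psi>: "carried R T ?G KG \<psi>" ..
  have fst_cont: "continuous_map ?G Y fst"
    unfolding graph_space_def by (intro continuous_map_from_subtopology continuous_map_fst)
  have snd_cont: "continuous_map ?G X snd"
    unfolding graph_space_def by (intro continuous_map_from_subtopology continuous_map_snd)
  have YT: "subtopology Y T = Y" using Y(2) by (metis subtopology_topspace)
  have \<psi>_exact: "cone_exact R \<psi> T ?G"
  proof (rule carried_cone_exact[OF finY Y(1) _ R list_ac _ _ \<psi>, where p=fst])
    show "continuous_map ?G (subtopology Y T) fst" unfolding YT by (rule fst_cont)
    show "aug_acyclic (subtopology ?G {e \<in> topspace ?G. fst e \<in> {y \<in> T. space_le Y y x}})" if x: "x \<in> T" for x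
    proof -
      have "{e \<in> topspace ?G. fst e \<in> {y \<in> T. space_le Y y x}} = {e \<in> topspace ?G. space_le Y (fst e) x}"
        using space_le_in_topspace[of Y] Y(2) by auto
      then show ?thesis using fiber[OF x] by simp
    qed
    show "topspace ?G \<inter> KG l \<subseteq> {e \<in> topspace ?G. fst e \<in> W}"
      if "l \<in> chain_lists R T n" "l \<noteq> []" "down_closed T (space_le Y) W" "set l \<subseteq> W" for l n W
      using m[OF that(1,2)] that(3,4) space_le_in_topspace(1)[of Y] Y(2)
          by (auto simp: KG_def down_closed_def)
  qed (use Y(2) in auto)
  \<comment> \<open>\<open>i\<close> and the first projection of \<psi> share this acyclic carrier,
    so they agree in homology.\<close>
  define KY where "KY l = {y \<in> T. space_le Y y (m l)}" for l
  have KY_ac: "aug_acyclic (subtopology Y (KY l))" if "l \<in> chain_lists R T n" "l \<noteq> []" for l n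
    using mT[OF that] space_le_refl[of _ Y] Y(2)
        by (intro aug_acyclic_with_maximum[where x="m l"]) (auto simp: KY_def)
  have KY_mono: "KY l' \<subseteq> KY l" if "l \<in> chain_lists R T n" "l' \<in> Poly_Mapping.keys (face_sum l)"
      "l' \<noteq> []" for l l' n
    using m_face[OF that] by (auto simp: KY_def intro: space_le_trans)
  let ?p = "\<lambda>l. aug_map (length l) fst (\<psi> l)"
  have p: "carried R T Y KY ?p"
    by (rule carried_map[OF \<psi> fst_cont]) (use space_le_in_topspace(1)[of Y] Y(2) in \<open>auto
        simp: KG_def KY_def\<close>)
  have p_exact: "cone_exact R ?p T Y"
  proof (rule carried_cone_exact[OF finY Y(1) _ R list_ac _ _ p, where p="\<lambda>x. x"])
    show "aug_acyclic (subtopology Y {e \<in> topspace Y. e \<in> {y \<in> T. space_le Y y x}})" if x: "x \<in> T" for x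
      using x space_le_refl[of _ Y] Y(2) by (intro aug_acyclic_with_maximum[where x=x]) auto
    show "topspace Y \<inter> KY l \<subseteq> {e \<in> topspace Y. e \<in> W}"
      if "l \<in> chain_lists R T n" "l \<noteq> []" "down_closed T (space_le Y) W" "set l \<subseteq> W" for l n W
      using m[OF that(1,2)] that(3,4) by (auto simp: KY_def down_closed_def)
  qed (use Y(2) YT in auto)
  have i': "carried R T Y KY i"
    by (rule carried_mono[OF i]) (use m Y(2) in \<open>auto simp: KY_def\<close>)

  \<comment> \<open>The second projection of \<psi> and \<open>j\<close> after \<phi> share this
    acyclic carrier. Inverting \<open>fst\<close> thus takes the class of \<open>i z\<close> to that
    of \<open>\<psi> z\<close>, and \<open>snd\<close> takes it on to the class of
    \<open>j (\<phi> z)\<close>.\<close>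
  define KX where "KX l = F (m l)" for l
  have KX_ac: "aug_acyclic (subtopology X (KX l))" if "l \<in> chain_lists R T n" "l \<noteq> []" for l n
    unfolding KX_def by (rule aug_acyclic_if_acyclic_space[OF Fac[OF mT[OF that]]])
  have KX_mono: "KX l' \<subseteq> KX l" if "l \<in> chain_lists R T n" "l' \<in> Poly_Mapping.keys (face_sum l)"
      "l' \<noteq> []" for l l' n
    using F(3)[OF m_face[OF that]] by (simp add: KX_def)
  let ?q = "\<lambda>l. aug_map (length l) snd (\<psi> l)"
  have q: "carried R T X KX ?q"
  proof (rule carried_map[OF \<psi> snd_cont])
    fix l n assume "l \<in> chain_lists R T n" "l \<noteq> []"
    show "snd ` (topspace ?G \<inter> KG l) \<subseteq> KX l"
    proof
      fix y assume "y \<in> snd ` (topspace ?G \<inter> KG l)"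
      then obtain x where "(x, y) \<in> topspace ?G" "space_le Y x (m l)" by (auto simp: KG_def)
      then have "y \<in> F x" "F x \<subseteq> F (m l)" using F(3) by (auto simp: graph_space_def)
      then show "y \<in> KX l" by (auto simp: KX_def)
    qed
  qed
  let ?j\<phi> = "\<lambda>l. frag_extend j (\<phi> l)"
  have j\<phi>_extend: "frag_extend j (frag_extend \<phi> c) = frag_extend ?j\<phi> c" for c
    by (rule frag_extend_additive) (rule frag_extend_diff)
  have j\<phi>: "carried R T X KX ?j\<phi>"
    unfolding carried_def
  proof (intro conjI allI ballI)
    show "?j\<phi> [] = aug_unit" using \<phi>(1) carriedD(1)[OF j] by simp
    fix n l assume l: "l \<in> chain_lists R T n"
    have \<phi>T: "\<phi> l \<in> list_chains R T n" using \<phi>_in[OF l] list_chains_mono[OF \<F>T[OF l]] by blast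
    show "aug_boundary n (?j\<phi> l) = frag_extend ?j\<phi> (face_sum l)"
      using frag_extend_carried(2)[OF j \<phi>T] \<phi>_bd[OF l] j\<phi>_extend by simp
    show "?j\<phi> l \<in> aug_chains (subtopology X (KX l)) n"
    proof (rule frag_extend_in_subgroup[OF frag_subgroup_aug_chains])
      fix k assume k: "k \<in> Poly_Mapping.keys (\<phi> l)"
      then have k': "k \<in> chain_lists R (\<F> l) n" "k \<in> chain_lists R T n"
        using \<phi>_in[OF l] \<phi>T by (auto simp: list_chains_def)
      have "\<F> l \<subseteq> KX l" by (auto simp: \<F>_def KX_def)
      then have "set k \<subseteq> KX l" using k'(1) by (auto simp: chain_lists_def)
      then show "j k \<in> aug_chains (subtopology X (KX l)) n"
        using carriedD(2)[OF j k'(2)] aug_chains_mono by blast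
    qed
  qed
  have main: "susc_induced (int d) Y X F (homologous_rel_set d Y {} (frag_extend i z))
      = homologous_rel_set d X {} (frag_extend j (frag_extend \<phi> z))" if z: "z \<in> list_cycles R T d" for d z
  proof -
    have z': "z \<in> list_chains R T (Suc d)" "d = 0 \<or> list_boundary z = 0" using z
        by (auto simp: list_cycles_def)
    have "homologous_rel_set d Y {} (frag_extend i z) = homologous_rel_set d Y {} (frag_extend ?p z)"
      by (rule homologous_rel_set_eqI, rule carried_homotopic[OF i' p _ _ z'], erule (2)
          KY_mono, erule (1) KY_ac)
    then have "inv_into (carrier (homology_group (int d) ?G)) (hom_induced (int d) ?G {} Y {} fst)
        (homologous_rel_set d Y {} (frag_extend i z))
        = homologous_rel_set d ?G {} (frag_extend \<psi> z)"
      using inv_hom_induced_carried[OF \<psi> \<psi>_exact fst_cont p p_exact z] by simp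
    then have "susc_induced (int d) Y X F (homologous_rel_set d Y {} (frag_extend i z))
        = homologous_rel_set d X {} (frag_extend ?q z)"
      using hom_induced_carried[OF \<psi> snd_cont z] by (simp add: susc_induced_def)
    also have "\<dots> = homologous_rel_set d X {} (frag_extend ?j\<phi> z)"
      by (rule homologous_rel_set_eqI, rule carried_homotopic[OF q j\<phi> _ _ z'], erule (2)
          KX_mono, erule (1) KX_ac)
    finally show ?thesis by (simp add: j\<phi>_extend)
  qed
  have "simplicial_selection X F m \<phi>"
    unfolding simplicial_selection_def R_def[symmetric] T_def[symmetric]
  proof (intro conjI allI ballI impI)
    fix n l assume l: "l \<in> chain_lists R T n"
    show "\<phi> l \<in> list_chains R T n" using \<phi>_in[OF l] list_chains_mono[OF \<F>T[OF l]] by blast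
    show "\<phi> l \<in> list_chains R (F (m l)) n" if "l \<noteq> []" using \<phi>_in[OF l] that by (simp add: \<F>_def)
    show "list_boundary (\<phi> l) = frag_extend \<phi> (face_sum l)" by (rule \<phi>_bd[OF l])
  qed
  then show ?thesis using main by (intro exI[of _ \<phi>] conjI allI ballI)
qed

text \<open>Through \<open>j\<close> the simplicial cycles modulo boundaries are the homology of
  \<open>X\<close>, with \<phi> corresponding to \<Phi>; the Hopf trace formula for \<phi> then
  evaluates the Lefschetz number.\<close>

lemma lefschetz_number_eq_0:
  fixes X :: "'a topology"
  defines "R \<equiv> descends X" and "T \<equiv> topspace X"
  assumes fin: "finite T" and X: "t0_space X" and j: "carried R T X set j"
    and \<phi>: "\<And>l n. l \<in> chain_lists R T n \<Longrightarrow> \<phi> l \<in> list_chains R T n"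
      "\<And>l n. l \<in> chain_lists R T n \<Longrightarrow> list_boundary (\<phi> l) = frag_extend \<phi> (face_sum l)"
      "\<And>l n. l \<in> chain_lists R T n \<Longrightarrow> l \<noteq> [] \<Longrightarrow> Poly_Mapping.lookup (\<phi> l) l = 0"
    and \<Phi>: "\<And>q z. z \<in> list_cycles R T q \<Longrightarrow> \<Phi> (int q) (homologous_rel_set q X {} (frag_extend j z))
        = homologous_rel_set q X {} (frag_extend j (frag_extend \<phi> z))"
  shows "lefschetz_number X \<Phi> = 0"
proof -
  have j_exact: "cone_exact R j T X"
    using cone_exact_subspace(2)[OF fin[unfolded T_def] X _ j[unfolded R_def T_def], of T]
        by (simp add: R_def T_def)
  \<comment> \<open>Return to the unaugmented complex: an \<open>n\<close>-simplex is a list of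
    length \<open>Suc n\<close>, and the boundary of points is set to zero.\<close>
  define L where "L n = chain_lists R T (Suc n)" for n
  define D where "D n c = (if n = 0 then 0 else list_boundary c)" for n :: nat and c :: "'a list \<Rightarrow>\<^sub>0 int"
  \<comment> \<open>A chain has no repeated vertices, so there are no simplices of dimension
    \<open>card T\<close> or more.\<close>
  have distinct: "distinct l" if "l \<in> chain_lists R T n" for l n
    using that by (auto simp: chain_lists_def R_def descends_def distinct_conv_nth sorted_wrt_iff_nth_less)
        (metis linorder_neqE_nat)
  have len: "length l \<le> card T" if "l \<in> chain_lists R T n" for l n
    using distinct_card[OF distinct[OF that]] card_mono[OF fin, of "set l"] that
        by (simp add: chain_lists_def)
  have finL: "finite (L n)" for n
    by (rule finite_subset[OF _ finite_lists_length_eq[OF fin, of "Suc n"]]) (auto simp: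
        L_def chain_lists_def)
  have top: "L n = {}" if "n \<ge> card T" for n
    using len[of _ "Suc n"] that by (force simp: L_def chain_lists_def)
  have C: "{c. Poly_Mapping.keys c \<subseteq> L n} = list_chains R T (Suc n)" for n
      by (simp add: L_def list_chains_def)
  have \<phi>_in: "frag_extend \<phi> c \<in> list_chains R T n" if "c \<in> list_chains R T n" for c n
    by (rule frag_extend_in_subgroup[OF frag_subgroup_list_chains]) (use that \<phi>(1) in \<open>auto
        simp: list_chains_def\<close>)
  have \<phi>_bd: "list_boundary (frag_extend \<phi> c) = frag_extend \<phi> (list_boundary c)"
      if "c \<in> list_chains R T n" for c n
  proof -
    have "list_boundary (frag_extend \<phi> c) = frag_extend (\<lambda>l. list_boundary (\<phi> l)) c"
      by (rule frag_extend_additive) simp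
    also have "\<dots> = frag_extend (\<lambda>l. frag_extend \<phi> (face_sum l)) c"
      using that by (intro frag_extend_eq \<phi>(2)) (auto simp: list_chains_def)
    also have "\<dots> = frag_extend \<phi> (list_boundary c)"
      unfolding list_boundary_def by (rule frag_extend_additive[symmetric]) (rule frag_extend_diff)
    finally show ?thesis .
  qed
  have Z: "{c \<in> {c. Poly_Mapping.keys c \<subseteq> L n}. D n c = 0} = list_cycles R T n" for n
    unfolding C by (auto simp: D_def list_cycles_def)
  have B: "D (Suc n) ` {c. Poly_Mapping.keys c \<subseteq> L (Suc n)}
      = list_boundary ` list_chains R T (Suc (Suc n))" for n
    unfolding C by (simp add: D_def)
  obtain ps where ps: "\<And>n. dual_system {c \<in> {c. Poly_Mapping.keys c \<subseteq> L n}. D n c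
      = 0} (D (Suc n) ` {c. Poly_Mapping.keys c \<subseteq> L (Suc n)}) (ps n)"
    "\<And>n. n \<ge> card T \<Longrightarrow> system_trace (ps n) (frag_extend \<phi>) = 0"
    "(\<Sum>n\<le>card T. (- 1) ^ n * system_trace (ps n) (frag_extend \<phi>)) = 0"
  proof (rule hopf_trace[where L=L and D=D and N="card T" and \<phi>="frag_extend \<phi>"])
    show "D n (x + y) = D n x + D n y" for n x y by (simp add: D_def)
    show "D (Suc n) c \<in> {c. Poly_Mapping.keys c \<subseteq> L n}" if "c \<in> {c. Poly_Mapping.keys c \<subseteq> L (Suc n)}" for n c
      using that list_boundary_in_list_chains unfolding C by (simp add: D_def)
    show "frag_extend \<phi> c \<in> {c. Poly_Mapping.keys c \<subseteq> L n}" if "c \<in> {c. Poly_Mapping.keys c \<subseteq> L n}" for n c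
      using that \<phi>_in unfolding C by blast
    show "D n (frag_extend \<phi> c) = frag_extend \<phi> (D n c)" if "c \<in> {c. Poly_Mapping.keys c \<subseteq> L n}" for n c
      using that \<phi>_bd unfolding C by (simp add: D_def)
    show "Poly_Mapping.lookup (frag_extend \<phi> (frag_of l)) l = 0" if "l \<in> L n" for n l
      using that \<phi>(3)[of l "Suc n"] by (cases l) (auto simp: L_def chain_lists_def)
  qed (auto simp: finL top D_def frag_extend_add)
  have trace: "of_int (trace_mod_torsion (homology_group (int n) X) (\<Phi> (int n)))
      = system_trace (ps n) (frag_extend \<phi>)" for n
  proof -
    have subZ: "frag_subgroup (list_cycles R T n)"
      using frag_module.subspace_0[OF frag_subgroup_list_chains] frag_module.subspace_diff[OF
          frag_subgroup_list_chains]
      by (intro frag_subgroupI) (auto simp: list_cycles_def)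
    have subB: "frag_subgroup (list_boundary ` list_chains R T (Suc (Suc n)))"
    proof (rule frag_subgroupI)
      show "0 \<in> list_boundary ` list_chains R T (Suc (Suc n))"
        using frag_module.subspace_0[OF frag_subgroup_list_chains] by (intro image_eqI[of _ _ 0]) auto
      fix a b assume "a \<in> list_boundary ` list_chains R T (Suc (Suc n))" "b \<in> list_boundary `
          list_chains R T (Suc (Suc n))"
      then obtain a' b' where "a' \<in> list_chains R T (Suc (Suc n))" "a
          = list_boundary a'" "b' \<in> list_chains R T (Suc (Suc n))" "b = list_boundary b'"
        by blast
      then show "a - b \<in> list_boundary ` list_chains R T (Suc (Suc n))"
        using frag_module.subspace_diff[OF frag_subgroup_list_chains]
            by (intro image_eqI[of _ _ "a' - b'"]) auto
    qed
    have BZ: "list_boundary ` list_chains R T (Suc (Suc n)) \<subseteq> list_cycles R T n"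
      using list_boundary_in_list_chains by (auto simp: list_cycles_def)
    obtain S where S: "finite S" "list_cycles R T n = frag_span S"
      using finitely_generated_subgroup[OF finL[of n] subZ]
          by (auto simp: list_cycles_def list_chains_def L_def)
    have S': "S \<subseteq> list_cycles R T n" unfolding S(2) by (auto intro: frag_module.span_base)
    have gen: "list_cycles R T n \<subseteq> frag_span (list_boundary ` list_chains R T (Suc (Suc n)) \<union> S)"
      unfolding S(2) by (intro frag_module.span_mono) auto
    have endo: "quotient_endo (list_cycles R T n) (list_boundary ` list_chains R T (Suc (Suc
        n))) (frag_extend \<phi>)"
    proof (rule quotient_endo_additiveI)
      show "frag_extend \<phi> z \<in> list_cycles R T n" if "z \<in> list_cycles R T n" for z
        using that \<phi>_in \<phi>_bd by (auto simp: list_cycles_def)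
      show "frag_extend \<phi> b \<in> list_boundary ` list_chains R T (Suc (Suc n))"
          if b: "b \<in> list_boundary ` list_chains R T (Suc (Suc n))" for b
      proof -
        obtain c where c: "c \<in> list_chains R T (Suc (Suc n))" "b = list_boundary c" using b by blast
        show ?thesis unfolding c(2) \<phi>_bd[OF c(1), symmetric] by (rule imageI[OF \<phi>_in[OF c(1)]])
      qed
    qed (auto simp: subB frag_extend_add)
    define h where "h z = homologous_rel_set n X {} (frag_extend j z)" for z
    show ?thesis
    proof (rule trace_mod_torsion_eq_system_trace[OF abelian_homology_group subZ subB BZ S(1) S' gen endo
        ps(1)[of n, unfolded Z B], where h=h])
      show "h z \<in> carrier (homology_group (int n) X)" if "z \<in> list_cycles R T n" for z
        using singular_relcycle_carried[OF j that] by (auto simp: h_def carrier_relative_homology_group)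
      show "h (x + y) = h x \<otimes>\<^bsub>homology_group (int n) X\<^esub> h y"
          if "x \<in> list_cycles R T n" "y \<in> list_cycles R T n" for x y
        unfolding h_def frag_extend_add
        by (rule homologous_rel_set_add[OF singular_relcycle_carried[OF j that(1)]
            singular_relcycle_carried[OF j that(2)]])
      show "carrier (homology_group (int n) X) \<subseteq> h ` list_cycles R T n"
        using homology_class_carried_surj[OF j j_exact] unfolding h_def by blast
      show "h z = \<one>\<^bsub>homology_group (int n) X\<^esub> \<longleftrightarrow> z \<in> list_boundary ` list_chains R T (Suc (Suc n))"
          if "z \<in> list_cycles R T n" for z
        unfolding h_def by (rule homology_class_carried_eq_one[OF j j_exact that])
      show "\<Phi> (int n) (h z) = h (frag_extend \<phi> z)" if "z \<in> list_cycles R T n" for z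
        unfolding h_def by (rule \<Phi>[OF that])
    qed
  qed
  define t where "t n = (- 1) ^ n * trace_mod_torsion (homology_group (int n) X) (\<Phi> (int n))" for n
  have t: "of_int (t n) = (- 1) ^ n * system_trace (ps n) (frag_extend \<phi>)" for n by (simp add: t_def trace)
  \<comment> \<open>Only finitely many terms remain, so \<open>Sum_any\<close> is an ordinary finite
    sum.\<close>
  have "t n = 0" if "n \<ge> card T" for n
    using t[of n] ps(2)[OF that] by simp
  then have "{n. t n \<noteq> 0} \<subseteq> {..card T}" using nat_le_linear by auto
  then have "lefschetz_number X \<Phi> = sum t {..card T}"
    unfolding lefschetz_number_def t_def[symmetric] by (intro Sum_any.expand_superset) auto
  moreover have "rat_of_int (sum t {..card T}) = 0" using ps(3) by (simp add: t)
  then have "sum t {..card T} = 0" unfolding of_int_eq_0_iff .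
  ultimately show ?thesis by simp
qed

section \<open>The fixed point theorem\<close>

text \<open>Openness is tested on \<open>B = F x\<close>.\<close>

lemma susc_mono:
  assumes "susc X T F" "F x \<subseteq> T" "space_le X x' x"
  shows "F x' \<subseteq> F x"
proof -
  have "openin X {y \<in> topspace X. F y \<subseteq> F x}" using assms(1,2) by (simp add: susc_def)
  moreover have "x \<in> topspace X" using space_le_in_topspace(2)[OF assms(3)] .
  ultimately show ?thesis using assms(3) unfolding space_le_iff by blast
qed

text \<open>Openness is tested on singletons. The inclusion is reversed, so \<open>F\<close> is
  monotone for the opposite order.\<close>

lemma slsc_antimono:
  assumes "slsc X T F" "F x \<subseteq> T" "space_le X x' x"
  shows "F x \<subseteq> F x'"
proof
  fix y assume y: "y \<in> F x"
  then have "openin X {z \<in> topspace X. F z \<inter> {y} \<noteq> {}}" using assms(1,2) unfolding slsc_def by blast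
  moreover have "x \<in> topspace X" using space_le_in_topspace(2)[OF assms(3)] .
  ultimately have "x' \<in> {z \<in> topspace X. F z \<inter> {y} \<noteq> {}}" using y assms(3) unfolding space_le_iff by blast
  then show "y \<in> F x'" by auto
qed

text \<open>A single chain map into the common order complex, carried by closed simplices, is
  followed by each of the two McCord maps. Passing from \<open>X\<close> to the opposite space
  therefore keeps the simplicial cycle \<open>z\<close> fixed.\<close>

lemma mccord_map_simplicial:
  fixes X :: "'a topology"
  defines "R \<equiv> descends X" and "T \<equiv> topspace X" and "K \<equiv> order_complex X"
  defines "j \<equiv> \<lambda>\<psi> Y l. aug_map (length l) (mccord_map Y) (\<psi> l)"
  assumes fin: "finite T" and X: "t0_space X"
  obtains \<psi> where "carried R T X set (j \<psi> X)" "carried R T (op_space X) set (j \<psi> (op_space X))"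
    "\<And>d z. z \<in> list_cycles R T d \<Longrightarrow>
      inv_into (carrier (homology_group (int d) K)) (hom_induced (int d) K {} X {} (mccord_map X))
          (homologous_rel_set d X {} (frag_extend (j \<psi> X) z))
        = homologous_rel_set d K {} (frag_extend \<psi> z)"
    "\<And>d z. z \<in> list_cycles R T d \<Longrightarrow>
      hom_induced (int d) K {} (op_space X) {} (mccord_map (op_space X)) (homologous_rel_set d K
          {} (frag_extend \<psi> z))
        = homologous_rel_set d (op_space X) {} (frag_extend (j \<psi> (op_space X)) z)"
proof -
  have finX: "finite (topspace X)" using fin by (simp add: T_def)
  \<comment> \<open>Points of the closed simplex on \<open>l\<close>. Either McCord map picks a
    vertex of the support, hence sends the simplex into \<open>set l\<close>.\<close>
  define S where "S l = {t :: 'a \<Rightarrow> real. {x. t x \<noteq> 0} \<subseteq> set l}" for l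
  have "aug_acyclic (subtopology K (S l))" if "l \<in> chain_lists R T n" "l \<noteq> []" for l n
    unfolding K_def S_def using that by (intro aug_acyclic_closed_simplex[OF finX] set_in_order_chains)
        (auto simp: R_def T_def)
  moreover have "S l' \<subseteq> S l" if "l' \<in> Poly_Mapping.keys (face_sum l)" for l l'
    using keys_face_sum(2)[OF that] by (auto simp: S_def)
  ultimately obtain \<psi> where \<psi>: "carried R T K S \<psi>"
    using carried_exists[of R T S K] by blast
  have cont: "continuous_map K X (mccord_map X)" unfolding K_def by (rule continuous_mccord_map[OF finX X])
  have cont_op: "continuous_map K (op_space X) (mccord_map (op_space X))"
    using continuous_mccord_map[of "op_space X"] finX t0_op_space[OF X]
        by (simp add: K_def order_complex_op_space)
  have vertex: "mccord_map X ` (topspace K \<inter> S l) \<subseteq> set l" "mccord_map (op_space X) ` (topspace K \<inter>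
      S l) \<subseteq> set l" for l
  proof -
    have "realization (op_space X) = realization X"
      by (metis order_complex_op_space topspace_order_complex)
    then show "mccord_map X ` (topspace K \<inter> S l) \<subseteq> set l" "mccord_map (op_space X) `
        (topspace K \<inter> S l) \<subseteq> set l"
      using mccord_map(1)[OF X] mccord_map(1)[OF t0_op_space[OF X]]
          by (auto simp: K_def topspace_order_complex S_def)
  qed
  have jX: "carried R T X set (j \<psi> X)"
    unfolding j_def by (rule carried_map[OF \<psi> cont vertex(1)])
  have jO: "carried R T (op_space X) set (j \<psi> (op_space X))"
    unfolding j_def by (rule carried_map[OF \<psi> cont_op vertex(2)])
  have XT: "subtopology X T = X" by (simp add: T_def)
  have \<psi>_exact: "cone_exact R \<psi> T K"
  proof (rule carried_cone_exact[OF finX X _ _ _ _ _ \<psi>, where p="mccord_map X"])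
    show "continuous_map K (subtopology X T) (mccord_map X)" unfolding XT by (rule cont)
    show "list_acyclic R {y \<in> T. space_le X y x}" if "x \<in> T" for x
      unfolding R_def by (rule list_acyclic_down_set[OF X that]) (simp add: T_def)
    show "aug_acyclic (subtopology K {e \<in> topspace K. mccord_map X e \<in> {y \<in> T. space_le X y
        x}})" if "x \<in> T" for x
      using aug_acyclic_mccord_fiber[OF finX X, of x] that by (simp add: K_def T_def topspace_order_complex)
    show "topspace K \<inter> S l \<subseteq> {e \<in> topspace K. mccord_map X e \<in> W}" if "set l \<subseteq> W" for l W
      using vertex(1)[of l] that by auto
  qed (auto simp: R_def descends_def T_def)
  have jX_exact: "cone_exact R (j \<psi> X) T X"
    using cone_exact_subspace(2)[OF finX X _ jX[unfolded R_def T_def], of T] by (simp add: R_def T_def)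
  show ?thesis
    by (rule that[OF jX jO])
      (use inv_hom_induced_carried[OF \<psi> \<psi>_exact cont] hom_induced_carried[OF \<psi> cont_op] jX jX_exact in
          \<open>unfold j_def\<close>, blast+)
qed

theorem theorem5p3:
  fixes X :: "'a topology" and F :: "'a \<Rightarrow> 'a set"
  assumes "finite (topspace X)" and "t0_space X"
    and "multimap X (topspace X) F"
    and "acyclic_values X X F"
    and "(susc X (topspace X) F \<and> lefschetz_number X (\<lambda>n. susc_induced n X X F) \<noteq> 0) \<or>
         (slsc X (topspace X) F \<and> lefschetz_number X (\<lambda>n. slsc_induced n X X F) \<noteq> 0)"
  shows "\<exists>x\<in>topspace X. x \<in> F x"
proof (rule ccontr)
  assume no_fix: "\<not> (\<exists>x\<in>topspace X. x \<in> F x)"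
  note fin = assms(1) and X = assms(2)
  let ?R = "descends X" and ?T = "topspace X"
  have FT: "F x \<subseteq> ?T" if "x \<in> ?T" for x using assms(3) that by (simp add: multimap_def)
  define j where "j \<psi> Y l = aug_map (length l) (mccord_map Y) (\<psi> l)" for \<psi> :: "'a list \<Rightarrow> ('a \<Rightarrow> real) chain"
      and Y and l :: "'a list"
  obtain \<psi> where jX: "carried ?R ?T X set (j \<psi> X)" and jO: "carried ?R ?T (op_space X) set (j \<psi> (op_space X))"
    and inv: "\<And>d z. z \<in> list_cycles ?R ?T d \<Longrightarrow>
      inv_into (carrier (homology_group (int d) (order_complex X))) (hom_induced (int d) (order_complex X) {}
          X {} (mccord_map X))
        (homologous_rel_set d X {} (frag_extend (j \<psi> X) z))
            = homologous_rel_set d (order_complex X) {} (frag_extend \<psi> z)"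
    and op: "\<And>d z. z \<in> list_cycles ?R ?T d \<Longrightarrow>
      hom_induced (int d) (order_complex X) {} (op_space X) {} (mccord_map (op_space X)) (homologous_rel_set d
          (order_complex X) {} (frag_extend \<psi> z))
        = homologous_rel_set d (op_space X) {} (frag_extend (j \<psi> (op_space X)) z)"
    using mccord_map_simplicial[OF fin X, folded j_def] by blast
  \<comment> \<open>Without fixed points \<open>m l\<close> is outside \<open>F (m l)\<close>. As
    \<open>m l\<close> is a vertex of \<open>l\<close>, the chain \<open>l\<close> does not lie in
    \<open>F (m l)\<close> and cannot occur in \<open>\<phi> l\<close>: the diagonal is
    zero.\<close>
  have vanish: "lefschetz_number X \<Phi> = 0"
    if m: "\<And>l n. l \<in> chain_lists ?R ?T n \<Longrightarrow> l \<noteq> [] \<Longrightarrow> m l \<in> set l" and \<phi>: "simplicial_selection X F m \<phi>"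
      and \<Phi>: "\<And>q z. z \<in> list_cycles ?R ?T q \<Longrightarrow> \<Phi> (int q) (homologous_rel_set q X {} (frag_extend (j \<psi> X) z))
        = homologous_rel_set q X {} (frag_extend (j \<psi> X) (frag_extend \<phi> z))" for m \<phi> \<Phi>
  proof (rule lefschetz_number_eq_0[OF fin X jX])
    fix l n assume l: "l \<in> chain_lists ?R ?T n"
    show "\<phi> l \<in> list_chains ?R ?T n" "list_boundary (\<phi> l) = frag_extend \<phi> (face_sum l)"
      using \<phi> l unfolding simplicial_selection_def by blast+
    assume ne: "l \<noteq> []"
    have "m l \<in> set l" "m l \<in> ?T" using m[OF l ne] l by (auto simp: chain_lists_def)
    then have "\<not> set l \<subseteq> F (m l)" using no_fix by blast
    moreover have "\<phi> l \<in> list_chains ?R (F (m l)) n" using \<phi> l ne unfolding simplicial_selection_def by blast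
    ultimately have "l \<notin> Poly_Mapping.keys (\<phi> l)" by (auto simp: list_chains_def chain_lists_def)
    then show "Poly_Mapping.lookup (\<phi> l) l = 0" by (simp add: in_keys_iff)
  qed (rule \<Phi>)
  show False
    using assms(5)
  proof (elim disjE conjE)
    \<comment> \<open>\<open>F\<close> is monotone, so the value at the largest vertex, the head,
      contains those at all other vertices.\<close>
    assume F: "susc X ?T F" and L: "lefschetz_number X (\<lambda>n. susc_induced n X X F) \<noteq> 0"
    have "\<exists>\<phi>. simplicial_selection X F hd \<phi> \<and>
      (\<forall>q. \<forall>z\<in>list_cycles ?R ?T q. susc_induced (int q) X X F (homologous_rel_set q X {}
          (frag_extend (j \<psi> X) z))
        = homologous_rel_set q X {} (frag_extend (j \<psi> X) (frag_extend \<phi> z)))"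
    proof (rule susc_induced_simplicial[OF fin X X refl _ _ _ assms(3,4) _ jX jX])
      show "space_le X x y \<or> space_le X y x" if "?R x y" for x y using that by (simp add: descends_def)
      show "list_acyclic ?R {y \<in> ?T. space_le X y x}" if "x \<in> ?T" for x
        by (rule list_acyclic_down_set[OF X that order_refl])
      show "hd l \<in> set l \<and> (\<forall>y\<in>set l. space_le X y (hd l))" if "l \<in> chain_lists ?R ?T n" "l \<noteq> []" for l n
        by (rule chain_lists_hd[OF that order_refl])
      show "F x' \<subseteq> F x" if "space_le X x' x" for x x'
        by (rule susc_mono[OF F FT[OF space_le_in_topspace(2)[OF that]] that])
    qed
    then obtain \<phi> where \<phi>: "simplicial_selection X F hd \<phi>"
      and \<Phi>: "\<forall>q. \<forall>z\<in>list_cycles ?R ?T q. susc_induced (int q) X X F (homologous_rel_set q X {}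
          (frag_extend (j \<psi> X) z))
        = homologous_rel_set q X {} (frag_extend (j \<psi> X) (frag_extend \<phi> z))"
      by (elim exE conjE) (rule that)
    have "lefschetz_number X (\<lambda>n. susc_induced n X X F) = 0"
      by (rule vanish[OF _ \<phi>]) (use \<Phi> in auto)
    then show False using L by simp
  next
    \<comment> \<open>Now the value at the smallest vertex contains the others; \<open>last\<close>
      is the largest vertex for the opposite order.\<close>
    assume F: "slsc X ?T F" and L: "lefschetz_number X (\<lambda>n. slsc_induced n X X F) \<noteq> 0"
    have "\<exists>\<phi>. simplicial_selection X F last \<phi> \<and>
      (\<forall>q. \<forall>z\<in>list_cycles ?R ?T q. susc_induced (int q) (op_space X) X F (homologous_rel_set q (op_space X) {}
          (frag_extend (j \<psi> (op_space X)) z))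
        = homologous_rel_set q X {} (frag_extend (j \<psi> X) (frag_extend \<phi> z)))"
    proof (rule susc_induced_simplicial[OF fin X t0_op_space[OF X] topspace_op_space _ _ _
        assms(3,4) _ jX jO])
      show "space_le (op_space X) x y \<or> space_le (op_space X) y x" if "?R x y" for x y
        using that by (simp add: descends_def space_le_op_space)
      show "list_acyclic ?R {y \<in> ?T. space_le (op_space X) y x}" if "x \<in> ?T" for x
        unfolding space_le_op_space by (rule list_acyclic_up_set[OF X that order_refl])
      show "last l \<in> set l \<and> (\<forall>y\<in>set l. space_le (op_space X) y (last l))"
          if "l \<in> chain_lists ?R ?T n" "l \<noteq> []" for l n
        unfolding space_le_op_space by (rule chain_lists_last[OF that order_refl])
      show "F x' \<subseteq> F x" if "space_le (op_space X) x' x" for x x'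
      proof -
        have le: "space_le X x x'" using that by (simp add: space_le_op_space)
        show ?thesis by (rule slsc_antimono[OF F FT[OF space_le_in_topspace(2)[OF le]] le])
      qed
    qed
    then obtain \<phi> where \<phi>: "simplicial_selection X F last \<phi>"
      and \<Phi>: "\<forall>q. \<forall>z\<in>list_cycles ?R ?T q. susc_induced (int q) (op_space X) X F (homologous_rel_set q
          (op_space X) {} (frag_extend (j \<psi> (op_space X)) z))
        = homologous_rel_set q X {} (frag_extend (j \<psi> X) (frag_extend \<phi> z))"
      by (elim exE conjE) (rule that)
    have "lefschetz_number X (\<lambda>n. slsc_induced n X X F) = 0"
    proof (rule vanish[OF _ \<phi>])
      show "last l \<in> set l" if "l \<noteq> []" for l using that by simp
      \<comment> \<open>The inverse of one McCord map followed by the other takes the class given by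
        \<open>j \<psi> X\<close> to the class given by \<open>j \<psi> (op_space X)\<close> at the
        same \<open>z\<close>, where the upper semicontinuous map on the opposite space is already
        computed.\<close>
      show "slsc_induced (int q) X X F (homologous_rel_set q X {} (frag_extend (j \<psi> X) z))
        = homologous_rel_set q X {} (frag_extend (j \<psi> X) (frag_extend \<phi> z))"
            if z: "z \<in> list_cycles ?R ?T q" for q z
        using inv[OF z] op[OF z] \<Phi>[rule_format, OF z] by (simp add: slsc_induced_def order_complex_op_space)
    qed
    then show False using L by simp
  qed
qed

end
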